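(* The operator $A$ is self-adjoint in the Hilbert space $H_1$ (with inner product $\langle\cdot,\cdot\rangle_1$).
   Context: Standing assumptions: $a<c<b$ are real numbers; $q$ is a real-valued function, continuous on $[a,c)$ and on $(c,b]$, with finite one-sided limits $q(c-0)$ and $q(c+0)$. All coefficients $\alpha_{10},\alpha_{11},\alpha_{20},\alpha_{21},\alpha'_{20},\alpha'_{21}$ and $\beta^\pm_{ij}$ ($i=1,2$, $j=0,1$) are real, with $(\alpha_{10},\alpha_{11})\neq(0,0)$. Let $\Delta_{kj}$ denote the determinant formed by the $k$-th and $j$-th columns of the matrix $T=\begin{bmatrix}\beta_{10}^- & \beta_{11}^- & \beta_{10}^+ & \beta_{11}^+\\ \beta_{20}^- & \beta_{21}^- & \beta_{20}^+ & \beta_{21}^+\end{bmatrix}$. It is assumed that $\Delta_{12}>0$, $\Delta_{34}>0$, and $\Delta_0:=\alpha_{21}\alpha'_{20}-\alpha_{20}\alpha'_{21}>0$. Notation: $\mathcal{L}f:=-f''+qf$ on $[a,c)\cup(c,b]$. Define $\tau_1(y):=\alpha_{10}y(a)+\alpha_{11}y'(a)$, $\tau_3(y):=\beta_{11}^-y'(c-)+\beta_{10}^-y(c-)+\beta_{11}^+y'(c+)+\beta_{10}^+y(c+)$, $\tau_4(y):=\beta_{21}^-y'(c-)+\beta_{20}^-y(c-)+\beta_{21}^+y'(c+)+\beta_{20}^+y(c+)$, $T_b(f):=\alpha_{20}f(b)-\alpha_{21}f'(b)$, $T'_b(f):=\alpha'_{20}f(b)-\alpha'_{21}f'(b)$.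 Hilbert space: $H_1=L_2(a,c)\oplus L_2(c,b)\oplus\mathbb{C}$ with inner product, for $F=(f,f_1)$, $G=(g,g_1)$: $\langle F,G\rangle_1:=\Delta_{12}\int_a^{c}f\bar g\,dx+\Delta_{34}\int_c^b f\bar g\,dx+\frac{\Delta_{34}}{\Delta_0}f_1\overline{g_1}$. Operator $A$: $D(A)$ consists of all $(f,f_1)\in H_1$ such that $f$ and $f'$ are absolutely continuous on $[a,c)$ and on $(c,b]$ with finite one-sided limits $f(c\mp0)$, $f'(c\mp0)$ (so they extend absolutely continuously to $[a,c]$ and $[c,b]$), $\mathcal{L}f\in L_2(a,c)\oplus L_2(c,b)$, $\tau_1(f)=\tau_3(f)=\tau_4(f)=0$, and $f_1=T'_b(f)$; for such $F$, $AF:=(\mathcal{L}f,\,-T_b(f))$. *)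

theory Defs
  imports "HOL-Analysis.Analysis"
begin

definition ac_on :: "real set \<Rightarrow> (real \<Rightarrow> 'a::real_normed_vector) \<Rightarrow> bool" where
  "ac_on S f \<longleftrightarrow> (\<forall>\<epsilon>>0. \<exists>\<delta>>0. \<forall>(n::nat) (s::nat \<Rightarrow> real) (t::nat \<Rightarrow> real).
     (\<forall>i<n. s i \<in> S \<and> t i \<in> S \<and> s i \<le> t i) \<and>
     (\<forall>i<n. \<forall>j<n. i \<noteq> j \<longrightarrow> t i \<le> s j \<or> t j \<le> s i) \<and>
     (\<Sum>i<n. t i - s i) < \<delta> \<longrightarrow> (\<Sum>i<n. norm (f (t i) - f (s i))) < \<epsilon>)"

definition L2_on :: "real set \<Rightarrow> (real \<Rightarrow> complex) \<Rightarrow> bool" where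
  "L2_on S f \<longleftrightarrow> set_borel_measurable lebesgue S f \<and>
                  set_integrable lebesgue S (\<lambda>x. (cmod (f x))^2)"

definition D1 :: "real \<Rightarrow> real \<Rightarrow> real \<Rightarrow> (real \<Rightarrow> complex) \<Rightarrow> real \<Rightarrow> complex" where
  "D1 a c b f x = (if x < c then vector_derivative f (at x within {a..<c})
                   else vector_derivative f (at x within {c<..b}))"

definition Lop :: "real \<Rightarrow> real \<Rightarrow> real \<Rightarrow> (real \<Rightarrow> real) \<Rightarrow> (real \<Rightarrow> complex) \<Rightarrow> real \<Rightarrow> complex" where
  "Lop a c b q f x = - D1 a c b (D1 a c b f) x + complex_of_real (q x) * f x"

definition tau1 :: "real \<Rightarrow> real \<Rightarrow> real \<Rightarrow> real \<Rightarrow> real \<Rightarrow> (real \<Rightarrow> complex) \<Rightarrow> complex" where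
  "tau1 a c b al10 al11 f = of_real al10 * f a + of_real al11 * D1 a c b f a"

definition tau_c :: "real \<Rightarrow> real \<Rightarrow> real \<Rightarrow> real \<Rightarrow> real \<Rightarrow> real \<Rightarrow> real \<Rightarrow> (real \<Rightarrow> complex) \<Rightarrow> complex" where
  "tau_c a c b b0m b1m b0p b1p f =
     of_real b1m * Lim (at_left c) (D1 a c b f) + of_real b0m * Lim (at_left c) f +
     of_real b1p * Lim (at_right c) (D1 a c b f) + of_real b0p * Lim (at_right c) f"

definition Tb :: "real \<Rightarrow> real \<Rightarrow> real \<Rightarrow> real \<Rightarrow> real \<Rightarrow> (real \<Rightarrow> complex) \<Rightarrow> complex" where
  "Tb a c b al0 al1 f = of_real al0 * f b - of_real al1 * D1 a c b f b"

type_synonym H1vec = "(real \<Rightarrow> complex) \<times> complex"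

definition inH1 :: "real \<Rightarrow> real \<Rightarrow> real \<Rightarrow> H1vec \<Rightarrow> bool" where
  "inH1 a c b F \<longleftrightarrow> L2_on {a<..<c} (fst F) \<and> L2_on {c<..<b} (fst F)"

definition eqH1 :: "real \<Rightarrow> real \<Rightarrow> H1vec \<Rightarrow> H1vec \<Rightarrow> bool" where
  "eqH1 a b F G \<longleftrightarrow> (AE x in lebesgue. x \<in> {a<..<b} \<longrightarrow> fst F x = fst G x) \<and> snd F = snd G"

definition subH1 :: "H1vec \<Rightarrow> H1vec \<Rightarrow> H1vec" where
  "subH1 F G = ((\<lambda>x. fst F x - fst G x), snd F - snd G)"

definition ipH1 :: "real \<Rightarrow> real \<Rightarrow> real \<Rightarrow> real \<Rightarrow> real \<Rightarrow> real \<Rightarrow> H1vec \<Rightarrow> H1vec \<Rightarrow> complex" where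
  "ipH1 a c b D12 D34 D0 F G =
     of_real D12 * (LINT x:{a<..<c}|lebesgue. fst F x * cnj (fst G x)) +
     of_real D34 * (LINT x:{c<..<b}|lebesgue. fst F x * cnj (fst G x)) +
     of_real (D34 / D0) * snd F * cnj (snd G)"

definition pw_regular :: "real \<Rightarrow> real \<Rightarrow> real \<Rightarrow> (real \<Rightarrow> complex) \<Rightarrow> bool" where
  "pw_regular a c b f \<longleftrightarrow>
     (\<forall>x\<in>{a..<c}. f differentiable (at x within {a..<c})) \<and>
     (\<forall>x\<in>{c<..b}. f differentiable (at x within {c<..b})) \<and>
     ac_on {a..<c} f \<and> ac_on {c<..b} f \<and>
     ac_on {a..<c} (D1 a c b f) \<and> ac_on {c<..b} (D1 a c b f) \<and>
     (\<exists>L. (f \<longlongrightarrow> L) (at_left c)) \<and> (\<exists>L. (f \<longlongrightarrow> L) (at_right c)) \<and>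
     (\<exists>L. (D1 a c b f \<longlongrightarrow> L) (at_left c)) \<and> (\<exists>L. (D1 a c b f \<longlongrightarrow> L) (at_right c))"

definition domA :: "real \<Rightarrow> real \<Rightarrow> real \<Rightarrow> (real \<Rightarrow> real) \<Rightarrow> real \<Rightarrow> real \<Rightarrow> real \<Rightarrow> real \<Rightarrow>
    real \<Rightarrow> real \<Rightarrow> real \<Rightarrow> real \<Rightarrow> real \<Rightarrow> real \<Rightarrow> real \<Rightarrow> real \<Rightarrow> H1vec \<Rightarrow> bool" where
  "domA a c b q al10 al11 al20' al21' b10m b11m b10p b11p b20m b21m b20p b21p F \<longleftrightarrow>
     inH1 a c b F \<and> pw_regular a c b (fst F) \<and>
     L2_on {a<..<c} (Lop a c b q (fst F)) \<and> L2_on {c<..<b} (Lop a c b q (fst F)) \<and>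
     tau1 a c b al10 al11 (fst F) = 0 \<and>
     tau_c a c b b10m b11m b10p b11p (fst F) = 0 \<and>
     tau_c a c b b20m b21m b20p b21p (fst F) = 0 \<and>
     snd F = Tb a c b al20' al21' (fst F)"

definition opA :: "real \<Rightarrow> real \<Rightarrow> real \<Rightarrow> (real \<Rightarrow> real) \<Rightarrow> real \<Rightarrow> real \<Rightarrow> H1vec \<Rightarrow> H1vec" where
  "opA a c b q al20 al21 F = (Lop a c b q (fst F), - Tb a c b al20 al21 (fst F))"

text \<open>Self-adjointness of an operator given on representatives: A maps D into H,
  D is dense, and A* = A (graph of the adjoint equals the graph of A, modulo equality in H).\<close>
definition self_adjoint_op ::
  "('v \<Rightarrow> bool) \<Rightarrow> ('v \<Rightarrow> 'v \<Rightarrow> bool) \<Rightarrow> ('v \<Rightarrow> 'v \<Rightarrow> complex) \<Rightarrow> ('v \<Rightarrow> 'v \<Rightarrow> 'v) \<Rightarrow>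
   ('v \<Rightarrow> bool) \<Rightarrow> ('v \<Rightarrow> 'v) \<Rightarrow> bool" where
  "self_adjoint_op H eqv ip sub D A \<longleftrightarrow>
     (\<forall>F. D F \<longrightarrow> H F \<and> H (A F)) \<and>
     (\<forall>G. H G \<longrightarrow> (\<forall>\<epsilon>>0. \<exists>F. D F \<and> Re (ip (sub F G) (sub F G)) < \<epsilon>)) \<and>
     (\<forall>G K. H G \<and> H K \<longrightarrow>
        ((\<forall>F. D F \<longrightarrow> ip (A F) G = ip F K) \<longleftrightarrow> (\<exists>G'. D G' \<and> eqv G' G \<and> eqv (A G') K)))"

end

theory Submission
  imports Defs
begin

text \<open>
  Symmetry of \<open>A\<close> is the Lagrange identity on each half: the transmission conditions say that the two
  Wronskians at \<open>c\<close> agree up to the factor \<open>\<Delta>\<^sub>1\<^sub>2 / \<Delta>\<^sub>3\<^sub>4\<close>, and the weight \<open>\<Delta>\<^sub>3\<^sub>4 / \<Delta>\<^sub>0\<close> of the second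
  component cancels the Wronskian at \<open>b\<close>. For the converse, \<open>A\<close> differs from an explicitly solvable
  operator \<open>B\<close> (with \<open>q = 0\<close>, and with a suitable multiple of the projection onto the second component
  added) by a bounded symmetric operator. Solving \<open>-f'' = h\<close> by two integrations shows that \<open>B\<close> is
  onto. If \<open>G\<close> lies in the domain of the adjoint, choose \<open>G'\<close> in the domain of \<open>A\<close> with
  \<open>B G' = B\<^sup>* G\<close> and \<open>F\<close> with \<open>B F = G - G'\<close>; then \<open>\<parallel>G - G'\<parallel>\<^sup>2 = \<langle>B F, G - G'\<rangle> = 0\<close>.

  The analytic input is the fundamental theorem of calculus for absolutely continuous functions.
  A real absolutely continuous function is the difference of two monotone ones, by its positive
  variation; the Stieltjes measure of a monotone one has a Radon-Nikodym density; and an indefinite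
  integral is differentiable almost everywhere.
\<close>

section \<open>Differentiation of indefinite integrals\<close>


text \<open>The potential is stripped off because \<open>-f'' + q f = h\<close> would call for an
  existence theory of differential equations, while \<open>-f'' = h\<close> has an explicit
  solution; \<open>q\<close> and the multiple of the second component are real, so they cancel when
  the two adjoint identities are subtracted. For given \<open>h\<close> the conditions at
  \<open>a\<close> and \<open>c\<close> leave a one-parameter family: a particular solution plus
  \<open>s\<close> times the affine solution of \<open>f'' = 0\<close> carried from \<open>a\<close>
  across \<open>c\<close>. The second component is then one scalar equation for \<open>s\<close>.
  Its coefficient may vanish without perturbation, but \<open>\<Delta>\<^sub>0 > 0\<close> makes the
  two functionals at \<open>b\<close> independent, so \<open>\<epsilon> = 0\<close> or
  \<open>\<epsilon> = 1\<close> always works. A separate obstacle is the form of the domain: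
  derivatives are taken within half-open intervals, values at \<open>c\<close> are limits, and the
  second derivative exists only almost everywhere, with an unspecified value elsewhere. Computations
  therefore take place on the closed halves (\<open>sobolev2\<close>), and \<open>glues\<close>
  translates between them and the domain.\<close>

lemma real_indefinite_integral_right_deriv:
  fixes h :: "real \<Rightarrow> 'a::euclidean_space"
  assumes "h integrable_on UNIV"
  obtains N where "negligible N"
    "\<And>x. x \<notin> N \<Longrightarrow> ((\<lambda>t. integral {x..x + t} h /\<^sub>R t) \<longlongrightarrow> h x) (at_right 0)"
proof -
  have int: "h integrable_on cbox a b" for a b
    using assms integrable_on_subcbox by blast
  \<comment> \<open>The differentiation theorem averages over cubes with \<open>x\<close> as lower
    corner; in dimension one these are intervals to the right of \<open>x\<close>, so only
    right-hand quotients are obtained.\<close>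
  obtain N where N: "negligible N" and
    *: "\<And>x e. \<lbrakk>x \<notin> N; 0 < e\<rbrakk> \<Longrightarrow> \<exists>d>0. \<forall>t. 0 < t \<and> t < d \<longrightarrow>
                norm (integral (cbox x (x + t *\<^sub>R One)) h /\<^sub>R t ^ DIM(real) - h x) < e"
    using integrable_ccontinuous_explicit[OF int] by metis
  show thesis
  proof
    fix x assume "x \<notin> N"
    then show "((\<lambda>t. integral {x..x + t} h /\<^sub>R t) \<longlongrightarrow> h x) (at_right 0)"
      using * by (fastforce simp: tendsto_iff eventually_at_right_field dist_norm)
  qed fact
qed

text \<open>Left-hand quotients at \<open>x\<close> are right-hand quotients of the reflected
  function at \<open>- x\<close>, so the one-sided result is used twice and the exceptional sets are
  united. Extension by zero provides the integrability on the whole line that it asks for.\<close>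

lemma indefinite_integral_has_vector_derivative_ae:
  fixes h :: "real \<Rightarrow> 'a::euclidean_space"
  assumes h: "h integrable_on {u..v}"
  obtains N where "negligible N"
    "\<And>x. x \<in> {u<..<v} - N \<Longrightarrow> ((\<lambda>x. integral {u..x} h) has_vector_derivative h x) (at x)"
proof -
  define k where "k = (\<lambda>x. if x \<in> {u..v} then h x else 0)"
  have k: "k integrable_on UNIV"
    using h unfolding k_def integrable_restrict_UNIV .
  have k': "(\<lambda>x. k (- x)) integrable_on UNIV"
  proof -
    have "(\<lambda>x. if x \<in> {- v..- u} then h (- x) else 0) integrable_on UNIV"
      using integrable_reflect_real[where f=h and a=u and b=v] h unfolding integrable_restrict_UNIV by simp
    then show ?thesis
      by (rule integrable_eq) (auto simp: k_def)
  qed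
  obtain N1 where N1: "negligible N1"
    and R: "\<And>x. x \<notin> N1 \<Longrightarrow> ((\<lambda>t. integral {x..x + t} k /\<^sub>R t) \<longlongrightarrow> k x) (at_right 0)"
    using real_indefinite_integral_right_deriv[OF k] by blast
  obtain N2 where N2: "negligible N2"
    and L: "\<And>x. x \<notin> N2 \<Longrightarrow> ((\<lambda>t. integral {x..x + t} (\<lambda>x. k (- x)) /\<^sub>R t) \<longlongrightarrow> k (- x)) (at_right 0)"
    using real_indefinite_integral_right_deriv[OF k'] by blast
  define N where "N = N1 \<union> uminus ` N2"
  show thesis
  proof
    show "negligible N"
      unfolding N_def using N1 N2
      by (auto intro!: negligible_Un negligible_differentiable_image_negligible derivative_intros)
    fix x assume x: "x \<in> {u<..<v} - N"
    then have xN: "x \<notin> N1" "- x \<notin> N2"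
      by (auto simp: N_def image_iff) 
    have kx: "k x = h x" using x by (auto simp: k_def)
    have right: "\<forall>\<^sub>F t in at_right 0. integral {x..x + t} k /\<^sub>R t = (integral {u..x + t} h - integral {u..x} h) /\<^sub>R t"
    proof -
      have "\<forall>\<^sub>F t in at_right 0. t \<in> {0<..<v - x}"
        using x by (intro eventually_at_right_real) auto
      then show ?thesis
      proof eventually_elim
        case (elim t)
        have "integral {x..x + t} k = integral {x..x + t} h"
          using x elim by (intro integral_cong) (auto simp: k_def)
        moreover have "h integrable_on {u..x+t}"
          using x elim by (intro integrable_on_subinterval[OF h]) auto
        then have "integral {u..x} h + integral {x..x + t} h = integral {u..x + t} h"
          using x elim by (intro Henstock_Kurzweil_Integration.integral_combine) auto
        ultimately show ?case by (metis add_diff_cancel_left')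
      qed
    qed
    have left: "\<forall>\<^sub>F t in at_right 0. integral {- x..- x + t} (\<lambda>x. k (- x)) /\<^sub>R t
         = (integral {u..x - t} h - integral {u..x} h) /\<^sub>R (- t)"
    proof -
      have "\<forall>\<^sub>F t in at_right 0. t \<in> {0<..<x - u}"
        using x by (intro eventually_at_right_real) auto
      then show ?thesis
      proof eventually_elim
        case (elim t)
        have "integral {- x..- x + t} (\<lambda>x. k (- x)) = integral {x - t..x} k"
          using Henstock_Kurzweil_Integration.integral_reflect_real[where f=k and a="x - t" and b=x] by (simp add: algebra_simps)
        also have "\<dots> = integral {x - t..x} h"
          using x elim by (intro integral_cong) (auto simp: k_def)
        finally have "integral {- x..- x + t} (\<lambda>x. k (- x)) = integral {x - t..x} h" .
        moreover have "h integrable_on {u..x}"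
          using x elim by (intro integrable_on_subinterval[OF h]) auto
        then have "integral {u..x - t} h + integral {x - t..x} h = integral {u..x} h"
          using x elim by (intro Henstock_Kurzweil_Integration.integral_combine) auto
        ultimately show ?case by (simp add: algebra_simps flip: scaleR_diff_right scaleR_minus_right)
      qed
    qed
    have 1: "((\<lambda>t. (integral {u..x + t} h - integral {u..x} h) /\<^sub>R t) \<longlongrightarrow> h x) (at_right 0)"
      using R[OF xN(1)] right kx by (simp cong: filterlim_cong)
    have 2: "((\<lambda>t. (integral {u..x - t} h - integral {u..x} h) /\<^sub>R (- t)) \<longlongrightarrow> h x) (at_right 0)"
      using L[OF xN(2)] kx unfolding tendsto_cong[OF left] by (simp only: minus_minus)
    have 3: "((\<lambda>t. (integral {u..x + t} h - integral {u..x} h) /\<^sub>R t) \<longlongrightarrow> h x) (at_left 0)"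
      using 2 by (subst filterlim_at_left_to_right) simp
    have "((\<lambda>t. (integral {u..x + t} h - integral {u..x} h) /\<^sub>R t) \<longlongrightarrow> h x) (at 0)"
      using 1 3 filterlim_split_at by blast
    then have 4: "((\<lambda>t. norm ((integral {u..x + t} h - integral {u..x} h) /\<^sub>R t - h x)) \<longlongrightarrow> 0) (at 0)"
      by (simp add: LIM_zero tendsto_norm_zero)
    have "((\<lambda>t. norm (integral {u..x + t} h - integral {u..x} h - t *\<^sub>R h x) / norm t) \<longlongrightarrow> 0) (at 0)"
    proof (rule Lim_transform_eventually[OF 4])
      show "\<forall>\<^sub>F t in at 0. norm ((integral {u..x + t} h - integral {u..x} h) /\<^sub>R t - h x)
          = norm (integral {u..x + t} h - integral {u..x} h - t *\<^sub>R h x) / norm t"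
        unfolding eventually_at_filter
      proof (intro always_eventually allI impI)
        fix t :: real assume "t \<noteq> 0"
        then have "integral {u..x + t} h - integral {u..x} h - t *\<^sub>R h x
          = t *\<^sub>R ((integral {u..x + t} h - integral {u..x} h) /\<^sub>R t - h x)"
          by (simp add: scaleR_diff_right)
        then show "norm ((integral {u..x + t} h - integral {u..x} h) /\<^sub>R t - h x)
          = norm (integral {u..x + t} h - integral {u..x} h - t *\<^sub>R h x) / norm t"
          using \<open>t \<noteq> 0\<close> by (metis norm_scaleR nonzero_mult_div_cancel_left norm_eq_zero real_norm_def)
      qed
    qed
    then show "((\<lambda>x. integral {u..x} h) has_vector_derivative h x) (at x)"
      unfolding has_vector_derivative_def has_derivative_at by (simp add: bounded_linear_scaleR_left)
  qed
qed

section \<open>Positive variation\<close>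


text \<open>In contrast to \<open>ac_on\<close>, the index set is any finite set of any type: later
  families are indexed by pairs of naturals and by the members of a division.\<close>

definition nonoverlapping :: "'i set \<Rightarrow> ('i \<Rightarrow> real) \<Rightarrow> ('i \<Rightarrow> real) \<Rightarrow> bool" where
  "nonoverlapping I s t \<longleftrightarrow> finite I \<and> (\<forall>i\<in>I. s i \<le> t i) \<and>
     (\<forall>i\<in>I. \<forall>j\<in>I. i \<noteq> j \<longrightarrow> t i \<le> s j \<or> t j \<le> s i)"

lemma ac_on_nonoverlapping:
  assumes "ac_on S f" "0 < \<epsilon>"
  shows "\<exists>\<delta>>0. \<forall>(I::'i set) s t. nonoverlapping I s t \<longrightarrow> (\<forall>i\<in>I. s i \<in> S \<and> t i \<in> S) \<longrightarrow>
       (\<Sum>i\<in>I. t i - s i) < \<delta> \<longrightarrow> (\<Sum>i\<in>I. norm (f (t i) - f (s i))) < \<epsilon>"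
proof -
  obtain \<delta> where "0 < \<delta>" and \<delta>: "\<forall>(n::nat) s t. (\<forall>i<n. s i \<in> S \<and> t i \<in> S \<and> s i \<le> t i) \<and>
     (\<forall>i<n. \<forall>j<n. i \<noteq> j \<longrightarrow> t i \<le> s j \<or> t j \<le> s i) \<and>
     (\<Sum>i<n. t i - s i) < \<delta> \<longrightarrow> (\<Sum>i<n. norm (f (t i) - f (s i))) < \<epsilon>"
    using assms(1)[unfolded ac_on_def, rule_format, OF assms(2)] by (elim exE conjE)
  have "(\<Sum>i\<in>I. norm (f (t i) - f (s i))) < \<epsilon>"
    if I: "nonoverlapping I s t" and S: "\<forall>i\<in>I. s i \<in> S \<and> t i \<in> S" and len: "(\<Sum>i\<in>I. t i - s i) < \<delta>"
    for I :: "'i set" and s t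
  proof -
    have "finite I" using I by (simp add: nonoverlapping_def)
    then obtain g where g: "bij_betw g {..<card I} I"
      using ex_bij_betw_nat_finite[of I] by (metis atLeast0LessThan)
    have gI: "g k \<in> I" if "k < card I" for k
      using g that by (auto simp: bij_betw_def)
    have gne: "g k \<noteq> g l" if "k < card I" "l < card I" "k \<noteq> l" for k l
      using g that by (auto simp: bij_betw_def inj_on_def)
    have reindex: "(\<Sum>i\<in>I. \<phi> i) = (\<Sum>k<card I. \<phi> (g k))" for \<phi> :: "'i \<Rightarrow> real"
      using sum.reindex_bij_betw[OF g, of \<phi>] by simp
    have "(\<Sum>k<card I. norm (f (t (g k)) - f (s (g k)))) < \<epsilon>"
      using I gI gne S len[unfolded reindex]
      by (intro \<delta>[rule_format, of "card I" "\<lambda>k. s (g k)" "\<lambda>k. t (g k)"] conjI)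
         (auto simp: nonoverlapping_def)
    then show "(\<Sum>i\<in>I. norm (f (t i) - f (s i))) < \<epsilon>"
      by (simp add: reindex)
  qed
  with \<open>0 < \<delta>\<close> show ?thesis by blast
qed

lemma nonoverlapping_mono:
  "nonoverlapping I s t \<Longrightarrow> mono \<phi> \<Longrightarrow> nonoverlapping I (\<lambda>i. \<phi> (s i)) (\<lambda>i. \<phi> (t i))"
  unfolding nonoverlapping_def by (metis monoD)

text \<open>The half-open intervals \<open>{s i<..t i}\<close> are disjoint even where neighbours
  share an endpoint, and empty when degenerate, so their lengths add up as Lebesgue
  measures.\<close>

lemma nonoverlapping_length:
  assumes "nonoverlapping I s t" and "\<And>i. i \<in> I \<Longrightarrow> x \<le> s i \<and> t i \<le> y" and "x \<le> y"
  shows "(\<Sum>i\<in>I. t i - s i) \<le> y - x"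
proof -
  have fin: "finite I" and le: "\<And>i. i \<in> I \<Longrightarrow> s i \<le> t i"
    using assms by (auto simp: nonoverlapping_def)
  have "(\<Sum>i\<in>I. t i - s i) = (\<Sum>i\<in>I. measure lborel {s i<..t i})"
    using le by (intro sum.cong) auto
  also have "\<dots> = measure lborel (\<Union>i\<in>I. {s i<..t i})"
  proof (intro measure_UNION'[symmetric] fin)
    have "disjnt {s i<..t i} {s j<..t j}" if "i \<in> I" "j \<in> I" "i \<noteq> j" for i j
    proof -
      have "t i \<le> s j \<or> t j \<le> s i" using assms(1) that by (simp add: nonoverlapping_def)
      then show ?thesis by (auto simp: disjnt_iff)
    qed
    then show "pairwise (\<lambda>i j. disjnt {s i<..t i} {s j<..t j}) I" by (simp add: pairwise_def)
  qed (use le in \<open>auto simp: fmeasurable_def\<close>)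
  also have "\<dots> \<le> measure lborel {x<..y}"
  proof (intro measure_mono_fmeasurable)
    show "(\<Union>i\<in>I. {s i<..t i}) \<subseteq> {x<..y}" using assms(2) by fastforce
  qed (use fin le \<open>x \<le> y\<close> in \<open>auto simp: fmeasurable_def\<close>)
  finally show ?thesis using \<open>x \<le> y\<close> by simp
qed

text \<open>The increments are signed and the families may leave gaps. Since an interval with
  negative increment can be left out, the supremum is the positive variation.\<close>

definition incr_sums :: "(real \<Rightarrow> real) \<Rightarrow> real \<Rightarrow> real \<Rightarrow> real set" where
  "incr_sums f x y = {\<sigma>. \<exists>(I::nat set) s t. nonoverlapping I s t \<and> (\<forall>i\<in>I. x \<le> s i \<and> t i \<le> y) \<and>
     \<sigma> = (\<Sum>i\<in>I. f (t i) - f (s i))}"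

definition pos_var :: "(real \<Rightarrow> real) \<Rightarrow> real \<Rightarrow> real \<Rightarrow> real" where
  "pos_var f x y = Sup (incr_sums f x y)"

lemma incr_sumsI:
  fixes I :: "nat set"
  assumes "nonoverlapping I s t" "\<And>i. i \<in> I \<Longrightarrow> x \<le> s i" "\<And>i. i \<in> I \<Longrightarrow> t i \<le> y"
  shows "(\<Sum>i\<in>I. f (t i) - f (s i)) \<in> incr_sums f x y"
  unfolding incr_sums_def using assms by blast

lemma zero_in_incr_sums: "0 \<in> incr_sums f x y"
  unfolding incr_sums_def by (auto intro!: exI[of _ "{}"] simp: nonoverlapping_def)

lemma incr_sums_mono: "x' \<le> x \<Longrightarrow> y \<le> y' \<Longrightarrow> incr_sums f x y \<subseteq> incr_sums f x' y'"
  unfolding incr_sums_def by fastforce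

text \<open>Left of the base point only the empty family remains. Hence \<open>pos_var f x\<close>
  vanishes there, which makes it monotone on the whole line.\<close>

lemma incr_sums_empty: "y < x \<Longrightarrow> incr_sums f x y = {0}"
proof -
  assume "y < x"
  have "\<sigma> = 0" if "\<sigma> \<in> incr_sums f x y" for \<sigma>
  proof -
    from that obtain I :: "nat set" and s t where *: "nonoverlapping I s t" "\<forall>i\<in>I. x \<le> s i \<and> t i \<le> y"
       "\<sigma> = (\<Sum>i\<in>I. f (t i) - f (s i))"
      unfolding incr_sums_def by blast
    then have "I = {}"
      using \<open>y < x\<close> unfolding nonoverlapping_def by fastforce
    then show ?thesis using * by simp
  qed
  then show ?thesis using zero_in_incr_sums by blast
qed

text \<open>Clamping the intervals of a family at a point splits its increments exactly,
  because \<open>f t = f (min t x) + f (max t x) - f x\<close>.\<close>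

lemma incr_sums_split:
  assumes "\<sigma> \<in> incr_sums f x z" "x \<le> y" "y \<le> z"
  obtains \<sigma>1 \<sigma>2 where "\<sigma>1 \<in> incr_sums f x y" "\<sigma>2 \<in> incr_sums f y z" "\<sigma> = \<sigma>1 + \<sigma>2"
proof -
  from assms obtain I :: "nat set" and s t where I: "nonoverlapping I s t" "\<forall>i\<in>I. x \<le> s i \<and> t i \<le> z"
       and \<sigma>: "\<sigma> = (\<Sum>i\<in>I. f (t i) - f (s i))"
      unfolding incr_sums_def by blast
  show thesis
  proof
    have "mono (\<lambda>r. min r y)" by (auto simp: mono_def min_def)
    then have "nonoverlapping I (\<lambda>i. min (s i) y) (\<lambda>i. min (t i) y)"
      by (rule nonoverlapping_mono[OF I(1), of "\<lambda>r. min r y"])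
    then show "(\<Sum>i\<in>I. f (min (t i) y) - f (min (s i) y)) \<in> incr_sums f x y"
      by (rule incr_sumsI) (use I(2) assms(2,3) in auto)
    have "mono (\<lambda>r. max r y)" by (auto simp: mono_def max_def)
    then have "nonoverlapping I (\<lambda>i. max (s i) y) (\<lambda>i. max (t i) y)"
      by (rule nonoverlapping_mono[OF I(1), of "\<lambda>r. max r y"])
    then show "(\<Sum>i\<in>I. f (max (t i) y) - f (max (s i) y)) \<in> incr_sums f y z"
      by (rule incr_sumsI) (use I(2) assms(2,3) in auto)
    show "\<sigma> = (\<Sum>i\<in>I. f (min (t i) y) - f (min (s i) y)) + (\<Sum>i\<in>I. f (max (t i) y) - f (max (s i) y))"
      unfolding \<sigma> sum.distrib[symmetric] by (intro sum.cong) (auto simp: min_def max_def)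
  qed
qed

text \<open>The extra interval from \<open>y\<close> to \<open>z\<close> is what makes
  \<open>pos_var f x\<close> grow at least as fast as \<open>f\<close>, so that their difference is
  monotone.\<close>

lemma incr_sums_append:
  assumes "\<sigma> \<in> incr_sums f x y" "x \<le> y" "y \<le> z"
  shows "\<sigma> + (f z - f y) \<in> incr_sums f x z"
proof -
  from assms obtain I :: "nat set" and s t where I: "nonoverlapping I s t" "\<forall>i\<in>I. x \<le> s i \<and> t i \<le> y"
       and \<sigma>: "\<sigma> = (\<Sum>i\<in>I. f (t i) - f (s i))"
      unfolding incr_sums_def by blast
  have fin: "finite I" using I by (simp add: nonoverlapping_def)
  then obtain k where k: "k \<notin> I" using ex_new_if_finite infinite_UNIV_nat by blast
  have "\<sigma> + (f z - f y) = (\<Sum>i\<in>insert k I. f ((t(k:=z)) i) - f ((s(k:=y)) i))"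
    using fin k unfolding \<sigma> by (subst sum.insert) (auto intro!: sum.cong)
  moreover have "nonoverlapping (insert k I) (s(k:=y)) (t(k:=z))"
    using I fin k assms unfolding nonoverlapping_def by auto
  moreover have "\<forall>i\<in>insert k I. x \<le> (s(k:=y)) i \<and> (t(k:=z)) i \<le> z"
    using I k assms by fastforce
  ultimately show ?thesis unfolding incr_sums_def by blast
qed

lemma bdd_above_incr_sums_split:
  assumes "bdd_above (incr_sums f x y)" "bdd_above (incr_sums f y z)" "x \<le> y" "y \<le> z"
  shows "bdd_above (incr_sums f x z)"
proof -
  obtain A B where "\<And>\<sigma>. \<sigma> \<in> incr_sums f x y \<Longrightarrow> \<sigma> \<le> A" "\<And>\<sigma>. \<sigma> \<in> incr_sums f y z \<Longrightarrow> \<sigma> \<le> B"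
    using assms(1,2) unfolding bdd_above_def by blast
  then have "\<sigma> \<le> A + B" if "\<sigma> \<in> incr_sums f x z" for \<sigma>
    using incr_sums_split[OF that assms(3,4)] by (metis add_mono)
  then show ?thesis by (rule bdd_aboveI)
qed

text \<open>On an interval shorter than the \<open>\<delta>\<close> belonging to
  \<open>\<epsilon> = 1\<close> every sum is at most 1. Steps of length \<open>\<delta> / 2\<close>,
  strictly below \<open>\<delta>\<close>, reach \<open>y\<close> after finitely many repetitions,
  and the bounds add up.\<close>

lemma ac_on_bdd_above_incr_sums:
  assumes f: "ac_on UNIV f"
  shows "bdd_above (incr_sums f x y)"
proof -
  obtain \<delta> where "0 < \<delta>" and \<delta>: "\<forall>(I::nat set) s t. nonoverlapping I s t \<longrightarrow> (\<forall>i\<in>I. s i \<in> UNIV \<and> t i \<in> UNIV) \<longrightarrow>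
       (\<Sum>i\<in>I. t i - s i) < \<delta> \<longrightarrow> (\<Sum>i\<in>I. norm (f (t i) - f (s i))) < 1"
    using ac_on_nonoverlapping[OF f zero_less_one, where 'i=nat] by (elim exE conjE)
  have short: "bdd_above (incr_sums f x y)" if "x \<le> y" "y - x < \<delta>" for x y
  proof (rule bdd_aboveI[of _ 1])
    fix \<sigma> assume "\<sigma> \<in> incr_sums f x y"
    then obtain I :: "nat set" and s t where I: "nonoverlapping I s t" "\<forall>i\<in>I. x \<le> s i \<and> t i \<le> y"
       and \<sigma>: "\<sigma> = (\<Sum>i\<in>I. f (t i) - f (s i))"
      unfolding incr_sums_def by blast
    have "\<sigma> \<le> (\<Sum>i\<in>I. norm (f (t i) - f (s i)))"
      unfolding \<sigma> by (intro sum_mono) auto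
    also have "\<dots> < 1"
      using nonoverlapping_length[OF I(1), of x y] I that by (intro \<delta>[rule_format, OF I(1)]) auto
    finally show "\<sigma> \<le> 1" by simp
  qed
  have steps: "bdd_above (incr_sums f x (x + real n * (\<delta> / 2)))" for n
  proof (induction n)
    case 0
    then show ?case using short[of x x] \<open>0 < \<delta>\<close> by simp
  next
    case (Suc n)
    have "bdd_above (incr_sums f (x + real n * (\<delta> / 2)) (x + real (Suc n) * (\<delta> / 2)))"
      using \<open>0 < \<delta>\<close> by (intro short) (auto simp: field_simps)
    with Suc.IH show ?case
      using \<open>0 < \<delta>\<close> by (intro bdd_above_incr_sums_split[OF Suc.IH]) (auto simp: field_simps)
  qed
  obtain n where "(y - x) / (\<delta> / 2) < real n" using reals_Archimedean2 by blast
  then have "y \<le> x + real n * (\<delta> / 2)" using \<open>0 < \<delta>\<close> by (simp add: field_simps)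
  then show ?thesis
    by (intro bdd_above_mono[OF steps[of n]] incr_sums_mono) auto
qed

context
  fixes f :: "real \<Rightarrow> real"
  assumes f: "ac_on UNIV f"
begin

lemma pos_var_upper: "\<sigma> \<in> incr_sums f x y \<Longrightarrow> \<sigma> \<le> pos_var f x y"
  unfolding pos_var_def using ac_on_bdd_above_incr_sums[OF f] by (intro cSup_upper)

lemma pos_var_least: "(\<And>\<sigma>. \<sigma> \<in> incr_sums f x y \<Longrightarrow> \<sigma> \<le> B) \<Longrightarrow> pos_var f x y \<le> B"
  unfolding pos_var_def using zero_in_incr_sums by (intro cSup_least) blast+

lemma pos_var_mono: "y \<le> z \<Longrightarrow> pos_var f x y \<le> pos_var f x z"
  using incr_sums_mono[of x x y z f] pos_var_upper by (intro pos_var_least) auto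

lemma pos_var_diff_le: "y \<le> z \<Longrightarrow> pos_var f x z - pos_var f x y \<le> pos_var f y z"
proof (cases "x \<le> y")
  case True
  assume "y \<le> z"
  have "\<sigma> \<le> pos_var f x y + pos_var f y z" if "\<sigma> \<in> incr_sums f x z" for \<sigma>
    using incr_sums_split[OF that True \<open>y \<le> z\<close>] pos_var_upper by (metis add_mono)
  then have "pos_var f x z \<le> pos_var f x y + pos_var f y z" by (rule pos_var_least)
  then show ?thesis by simp
next
  case False
  assume "y \<le> z"
  have "pos_var f x y = 0"
    using False by (simp add: pos_var_def incr_sums_empty)
  moreover have "pos_var f x z \<le> pos_var f y z"
    using incr_sums_mono[of y x z z f] pos_var_upper False by (intro pos_var_least) auto
  ultimately show ?thesis by simp
qed

lemma increment_le_pos_var: "x \<le> y \<Longrightarrow> y \<le> z \<Longrightarrow> f z - f y \<le> pos_var f x z - pos_var f x y"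
proof -
  assume *: "x \<le> y" "y \<le> z"
  have "\<sigma> \<le> pos_var f x z - (f z - f y)" if "\<sigma> \<in> incr_sums f x y" for \<sigma>
    using pos_var_upper[OF incr_sums_append[OF that *]] by simp
  then have "pos_var f x y \<le> pos_var f x z - (f z - f y)" by (rule pos_var_least)
  then show ?thesis by simp
qed

text \<open>The growth of the positive variation over each given interval is nearly attained by a
  finite family inside that interval. All these families together form one nonoverlapping family,
  indexed by pairs, whose total length does not exceed the given one, so the absolute continuity of
  \<open>f\<close> applies to it.\<close>

lemma ac_on_pos_var: "ac_on UNIV (pos_var f x)"
  unfolding ac_on_def
proof (intro allI impI)
  fix \<epsilon> :: real assume "0 < \<epsilon>"
  then have "0 < \<epsilon> / 3" by simp
  obtain \<delta> where "0 < \<delta>" and \<delta>: "\<forall>(K::(nat\<times>nat) set) s t. nonoverlapping K s t \<longrightarrow> (\<forall>i\<in>K. s i \<in> UNIV \<and> t i \<in> UNIV) \<longrightarrow>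
       (\<Sum>i\<in>K. t i - s i) < \<delta> \<longrightarrow> (\<Sum>i\<in>K. norm (f (t i) - f (s i))) < \<epsilon> / 3"
    using ac_on_nonoverlapping[OF f \<open>0 < \<epsilon> / 3\<close>, where 'i="nat\<times>nat"] by (elim exE conjE)
  have "(\<Sum>i<n. norm (pos_var f x (t i) - pos_var f x (s i))) < \<epsilon>"
    if le: "\<forall>i<n. s i \<in> UNIV \<and> t i \<in> UNIV \<and> s i \<le> t i" and disj: "\<forall>i<n. \<forall>j<n. i \<noteq> j \<longrightarrow> t i \<le> s j \<or> t j \<le> s i"
      and len: "(\<Sum>i<n. t i - s i) < \<delta>" for n :: nat and s t
  proof -
    \<comment> \<open>The \<open>n\<close> approximation errors add up to at most
      \<open>\<epsilon> / 3\<close>; the summand 1 covers \<open>n = 0\<close>.\<close>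
    define \<eta> where "\<eta> = \<epsilon> / 3 / (real n + 1)"
    have "0 < \<eta>" using \<open>0 < \<epsilon>\<close> by (simp add: \<eta>_def)
    have "\<exists>\<sigma>\<in>incr_sums f (s i) (t i). pos_var f (s i) (t i) - \<eta> < \<sigma>" for i
    proof (rule ccontr)
      assume "\<not> ?thesis"
      then have "pos_var f (s i) (t i) \<le> pos_var f (s i) (t i) - \<eta>"
        by (intro pos_var_least) (auto simp: not_less)
      then show False using \<open>0 < \<eta>\<close> by simp
    qed
    moreover define Q where "Q i J s' t' \<longleftrightarrow> nonoverlapping (J::nat set) s' t' \<and> (\<forall>j\<in>J. s i \<le> s' j \<and> t' j \<le> t i) \<and>
        pos_var f (s i) (t i) - \<eta> < (\<Sum>j\<in>J. f (t' j) - f (s' j))" for i J s' t'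
    ultimately have "\<exists>J s' t'. Q i J s' t'" for i
      unfolding incr_sums_def by blast
    then obtain J s' t' where "\<And>i. Q i (J i) (s' i) (t' i)"
      by metis
    then have J: "\<And>i. nonoverlapping (J i) (s' i) (t' i)"
      and sub: "\<And>i j. j \<in> J i \<Longrightarrow> s i \<le> s' i j \<and> t' i j \<le> t i"
      and near: "\<And>i. pos_var f (s i) (t i) - \<eta> < (\<Sum>j\<in>J i. f (t' i j) - f (s' i j))"
      unfolding Q_def by auto
    have finJ: "finite (J i)" for i using J[of i] by (simp add: nonoverlapping_def)
    define K where "K = Sigma {..<n} J"
    define S T where "S k = s' (fst k) (snd k)" and "T k = t' (fst k) (snd k)" for k
    have sum_K: "(\<Sum>k\<in>K. \<phi> (fst k) (snd k)) = (\<Sum>i<n. \<Sum>j\<in>J i. \<phi> i j)" for \<phi> :: "nat \<Rightarrow> nat \<Rightarrow> real"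
      unfolding K_def using finJ by (subst sum.Sigma) (auto simp: case_prod_unfold)
    have "T k \<le> S l \<or> T l \<le> S k" if kl: "k \<in> K" "l \<in> K" "k \<noteq> l" for k l
    proof (cases "fst k = fst l")
      case True
      moreover have "snd k \<noteq> snd l" using kl True by (simp add: prod_eq_iff)
      moreover have "snd k \<in> J (fst k)" "snd l \<in> J (fst k)" using kl True by (auto simp: K_def)
      ultimately have "t' (fst k) (snd k) \<le> s' (fst k) (snd l) \<or> t' (fst k) (snd l) \<le> s' (fst k) (snd k)"
        using J[of "fst k"] unfolding nonoverlapping_def by blast
      then show ?thesis using True by (simp add: S_def T_def)
    next
      case False
      then have "t (fst k) \<le> s (fst l) \<or> t (fst l) \<le> s (fst k)"
        using disj[rule_format, of "fst k" "fst l"] kl by (auto simp: K_def)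
      moreover have "s (fst k) \<le> S k" "T k \<le> t (fst k)" "s (fst l) \<le> S l" "T l \<le> t (fst l)"
        using kl sub by (auto simp: K_def S_def T_def)
      ultimately show ?thesis by linarith
    qed
    moreover have "S k \<le> T k" if "k \<in> K" for k
      using J[of "fst k"] that by (auto simp: nonoverlapping_def K_def S_def T_def)
    moreover have "finite K" using finJ by (auto simp: K_def)
    ultimately have K: "nonoverlapping K S T"
      by (auto simp: nonoverlapping_def)
    have "(\<Sum>k\<in>K. T k - S k) = (\<Sum>i<n. \<Sum>j\<in>J i. t' i j - s' i j)"
      unfolding S_def T_def by (rule sum_K)
    also have "\<dots> \<le> (\<Sum>i<n. t i - s i)"
      using sub le by (intro sum_mono nonoverlapping_length[OF J]) auto
    finally have "(\<Sum>k\<in>K. T k - S k) < \<delta>" using len by simp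
    with K have *: "(\<Sum>k\<in>K. norm (f (T k) - f (S k))) < \<epsilon> / 3"
      by (intro \<delta>[rule_format]) auto
    have "(\<Sum>i<n. norm (pos_var f x (t i) - pos_var f x (s i))) \<le> (\<Sum>i<n. pos_var f (s i) (t i))"
      using le pos_var_mono pos_var_diff_le by (intro sum_mono) auto
    also have "\<dots> \<le> (\<Sum>i<n. (\<Sum>j\<in>J i. f (t' i j) - f (s' i j)) + \<eta>)"
      using near by (intro sum_mono) (simp add: less_imp_le algebra_simps)
    also have "\<dots> = (\<Sum>k\<in>K. f (T k) - f (S k)) + real n * \<eta>"
      unfolding S_def T_def sum.distrib sum_K[of "\<lambda>i j. f (t' i j) - f (s' i j)"] by simp
    also have "\<dots> \<le> (\<Sum>k\<in>K. norm (f (T k) - f (S k))) + real n * \<eta>"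
      by (intro add_right_mono sum_mono) auto
    also have "\<dots> \<le> \<epsilon> / 3 + \<epsilon> / 3"
      using * \<open>0 < \<epsilon>\<close> by (intro add_mono) (auto simp: \<eta>_def field_simps)
    also have "\<dots> < \<epsilon>" using \<open>0 < \<epsilon>\<close> by simp
    finally show ?thesis .
  qed
  then show "\<exists>\<delta>>0. \<forall>(n::nat) s t. (\<forall>i<n. s i \<in> UNIV \<and> t i \<in> UNIV \<and> s i \<le> t i) \<and>
     (\<forall>i<n. \<forall>j<n. i \<noteq> j \<longrightarrow> t i \<le> s j \<or> t j \<le> s i) \<and> (\<Sum>i<n. t i - s i) < \<delta> \<longrightarrow>
     (\<Sum>i<n. norm (pos_var f x (t i) - pos_var f x (s i))) < \<epsilon>"
    using \<open>0 < \<delta>\<close> by (intro exI[of _ \<delta>]) auto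
qed

end

section \<open>Absolutely continuous functions as indefinite integrals\<close>


text \<open>Common source of the closure properties: differences, products with a conjugate, linear
  combinations, real and imaginary parts. If only one function dominates, it is supplied
  twice.\<close>

lemma ac_on_dominated:
  assumes f: "ac_on S f" and g: "ac_on S g"
    and B: "\<And>x y. \<lbrakk>x \<in> S; y \<in> S\<rbrakk> \<Longrightarrow> norm (h y - h x) \<le> B * (norm (f y - f x) + norm (g y - g x))"
  shows "ac_on S h"
  unfolding ac_on_def
proof (intro allI impI)
  fix \<epsilon> :: real assume "0 < \<epsilon>"
  \<comment> \<open>A positive constant is needed to divide by; nothing is assumed about the sign of
    \<open>B\<close>.\<close>
  define C where "C = max B 1"
  have C: "0 < C" "B \<le> C" by (auto simp: C_def)
  define \<epsilon>' where "\<epsilon>' = \<epsilon> / (2 * C)"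
  have "0 < \<epsilon>'" using \<open>0 < \<epsilon>\<close> C by (simp add: \<epsilon>'_def)
  obtain \<delta>1 where "0 < \<delta>1" and \<delta>1: "\<forall>(n::nat) s t. (\<forall>i<n. s i \<in> S \<and> t i \<in> S \<and> s i \<le> t i) \<and>
     (\<forall>i<n. \<forall>j<n. i \<noteq> j \<longrightarrow> t i \<le> s j \<or> t j \<le> s i) \<and>
     (\<Sum>i<n. t i - s i) < \<delta>1 \<longrightarrow> (\<Sum>i<n. norm (f (t i) - f (s i))) < \<epsilon>'"
    using f[unfolded ac_on_def, rule_format, OF \<open>0 < \<epsilon>'\<close>] by (elim exE conjE)
  obtain \<delta>2 where "0 < \<delta>2" and \<delta>2: "\<forall>(n::nat) s t. (\<forall>i<n. s i \<in> S \<and> t i \<in> S \<and> s i \<le> t i) \<and>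
     (\<forall>i<n. \<forall>j<n. i \<noteq> j \<longrightarrow> t i \<le> s j \<or> t j \<le> s i) \<and>
     (\<Sum>i<n. t i - s i) < \<delta>2 \<longrightarrow> (\<Sum>i<n. norm (g (t i) - g (s i))) < \<epsilon>'"
    using g[unfolded ac_on_def, rule_format, OF \<open>0 < \<epsilon>'\<close>] by (elim exE conjE)
  show "\<exists>\<delta>>0. \<forall>(n::nat) s t. (\<forall>i<n. s i \<in> S \<and> t i \<in> S \<and> s i \<le> t i) \<and>
     (\<forall>i<n. \<forall>j<n. i \<noteq> j \<longrightarrow> t i \<le> s j \<or> t j \<le> s i) \<and>
     (\<Sum>i<n. t i - s i) < \<delta> \<longrightarrow> (\<Sum>i<n. norm (h (t i) - h (s i))) < \<epsilon>"
  proof (intro exI[of _ "min \<delta>1 \<delta>2"] conjI allI impI)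
    show "0 < min \<delta>1 \<delta>2" using \<open>0 < \<delta>1\<close> \<open>0 < \<delta>2\<close> by simp
    fix n :: nat and s t
    assume *: "(\<forall>i<n. s i \<in> S \<and> t i \<in> S \<and> s i \<le> t i) \<and>
     (\<forall>i<n. \<forall>j<n. i \<noteq> j \<longrightarrow> t i \<le> s j \<or> t j \<le> s i) \<and> (\<Sum>i<n. t i - s i) < min \<delta>1 \<delta>2"
    then have 1: "(\<Sum>i<n. norm (f (t i) - f (s i))) < \<epsilon>'" and 2: "(\<Sum>i<n. norm (g (t i) - g (s i))) < \<epsilon>'"
      using \<delta>1 \<delta>2 by simp_all
    have "(\<Sum>i<n. norm (h (t i) - h (s i)))
        \<le> (\<Sum>i<n. C * (norm (f (t i) - f (s i)) + norm (g (t i) - g (s i))))"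
    proof (intro sum_mono)
      fix i assume "i \<in> {..<n}"
      then have "norm (h (t i) - h (s i)) \<le> B * (norm (f (t i) - f (s i)) + norm (g (t i) - g (s i)))"
        using * by (intro B) auto
      also have "\<dots> \<le> C * (norm (f (t i) - f (s i)) + norm (g (t i) - g (s i)))"
        using C by (intro mult_right_mono) auto
      finally show "norm (h (t i) - h (s i)) \<le> C * (norm (f (t i) - f (s i)) + norm (g (t i) - g (s i)))" .
    qed
    also have "\<dots> = C * ((\<Sum>i<n. norm (f (t i) - f (s i))) + (\<Sum>i<n. norm (g (t i) - g (s i))))"
      by (simp add: sum_distrib_left sum.distrib distrib_left)
    also have "\<dots> < C * (\<epsilon>' + \<epsilon>')"
      using 1 2 C by (intro mult_strict_left_mono add_strict_mono) auto
    also have "\<dots> = \<epsilon>" using C by (simp add: \<epsilon>'_def field_simps)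
    finally show "(\<Sum>i<n. norm (h (t i) - h (s i))) < \<epsilon>" .
  qed
qed

lemma ac_on_diff: "ac_on S f \<Longrightarrow> ac_on S g \<Longrightarrow> ac_on S (\<lambda>x. f x - g x)"
  by (rule ac_on_dominated[where f=f and g=g and B=1]) (auto intro: order_trans[OF eq_refl norm_triangle_ineq4] simp: algebra_simps)

text \<open>A monotone map that does not expand distances keeps intervals nonoverlapping and does
  not increase their total length. Clamping to an interval extends functions to the line; the
  identity gives restriction to subsets.\<close>

lemma ac_on_compose_contraction:
  assumes f: "ac_on S f" and "mono \<phi>" and \<phi>: "\<And>x. x \<in> T \<Longrightarrow> \<phi> x \<in> S"
    and contr: "\<And>x y. x \<le> y \<Longrightarrow> \<phi> y - \<phi> x \<le> y - x"
  shows "ac_on T (\<lambda>x. f (\<phi> x))"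
  unfolding ac_on_def
proof (intro allI impI)
  fix \<epsilon> :: real assume "0 < \<epsilon>"
  obtain \<delta> where "0 < \<delta>" and \<delta>: "\<forall>(n::nat) s t. (\<forall>i<n. s i \<in> S \<and> t i \<in> S \<and> s i \<le> t i) \<and>
     (\<forall>i<n. \<forall>j<n. i \<noteq> j \<longrightarrow> t i \<le> s j \<or> t j \<le> s i) \<and>
     (\<Sum>i<n. t i - s i) < \<delta> \<longrightarrow> (\<Sum>i<n. norm (f (t i) - f (s i))) < \<epsilon>"
    using f[unfolded ac_on_def, rule_format, OF \<open>0 < \<epsilon>\<close>] by (elim exE conjE)
  show "\<exists>\<delta>>0. \<forall>(n::nat) s t. (\<forall>i<n. s i \<in> T \<and> t i \<in> T \<and> s i \<le> t i) \<and>
     (\<forall>i<n. \<forall>j<n. i \<noteq> j \<longrightarrow> t i \<le> s j \<or> t j \<le> s i) \<and>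
     (\<Sum>i<n. t i - s i) < \<delta> \<longrightarrow> (\<Sum>i<n. norm (f (\<phi> (t i)) - f (\<phi> (s i)))) < \<epsilon>"
  proof (intro exI[of _ \<delta>] conjI allI impI)
    fix n :: nat and s t
    assume *: "(\<forall>i<n. s i \<in> T \<and> t i \<in> T \<and> s i \<le> t i) \<and>
     (\<forall>i<n. \<forall>j<n. i \<noteq> j \<longrightarrow> t i \<le> s j \<or> t j \<le> s i) \<and> (\<Sum>i<n. t i - s i) < \<delta>"
    have "(\<Sum>i<n. \<phi> (t i) - \<phi> (s i)) \<le> (\<Sum>i<n. t i - s i)"
      using * by (intro sum_mono contr) auto
    moreover have "\<phi> (t i) \<le> \<phi> (s j) \<or> \<phi> (t j) \<le> \<phi> (s i)" if "i < n" "j < n" "i \<noteq> j" for i j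
      using * that monoD[OF \<open>mono \<phi>\<close>] by metis
    moreover have "\<phi> (s i) \<in> S \<and> \<phi> (t i) \<in> S \<and> \<phi> (s i) \<le> \<phi> (t i)" if "i < n" for i
      using * that \<phi> monoD[OF \<open>mono \<phi>\<close>] by simp
    ultimately show "(\<Sum>i<n. norm (f (\<phi> (t i)) - f (\<phi> (s i)))) < \<epsilon>"
      using * by (intro \<delta>[rule_format, of n "\<lambda>i. \<phi> (s i)" "\<lambda>i. \<phi> (t i)"]) auto
  qed fact
qed

lemma ac_on_imp_uniformly_continuous_on:
  assumes "ac_on S f"
  shows "uniformly_continuous_on S f"
  unfolding uniformly_continuous_on_def
proof (intro allI impI)
  fix \<epsilon> :: real assume "0 < \<epsilon>"
  obtain \<delta> where "0 < \<delta>" and \<delta>: "\<forall>(n::nat) s t. (\<forall>i<n. s i \<in> S \<and> t i \<in> S \<and> s i \<le> t i) \<and>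
     (\<forall>i<n. \<forall>j<n. i \<noteq> j \<longrightarrow> t i \<le> s j \<or> t j \<le> s i) \<and>
     (\<Sum>i<n. t i - s i) < \<delta> \<longrightarrow> (\<Sum>i<n. norm (f (t i) - f (s i))) < \<epsilon>"
    using assms[unfolded ac_on_def, rule_format, OF \<open>0 < \<epsilon>\<close>] by (elim exE conjE)
  have le: "norm (f y - f x) < \<epsilon>" if "x \<in> S" "y \<in> S" "x \<le> y" "y - x < \<delta>" for x y
    using \<delta>[rule_format, of 1 "\<lambda>_. x" "\<lambda>_. y"] that by simp
  have "dist (f y) (f x) < \<epsilon>" if "x \<in> S" "y \<in> S" "dist y x < \<delta>" for x y
    using le[of x y] le[of y x] that by (cases "x \<le> y") (auto simp: dist_norm norm_minus_commute)
  then show "\<exists>d>0. \<forall>x\<in>S. \<forall>x'\<in>S. dist x' x < d \<longrightarrow> dist (f x') (f x) < \<epsilon>"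
    using \<open>0 < \<delta>\<close> by blast
qed

text \<open>Uniform continuity provides the extension. To see that it is absolutely continuous, a
  family in \<open>[u, v]\<close> is shrunk towards the midpoint by \<open>\<phi> \<eta>\<close>,
  which moves it into \<open>S\<close> where \<open>g\<close> is under control; then
  \<open>\<eta>\<close> tends to 0. The limit only preserves \<open>\<le>\<close>, hence
  \<open>\<epsilon> / 2\<close>.\<close>

lemma ac_on_extension:
  fixes g :: "real \<Rightarrow> complex"
  assumes g: "ac_on S g" and "u < v" and S: "{u<..<v} \<subseteq> S" "S \<subseteq> {u..v}"
  obtains G where "ac_on {u..v} G" "\<And>x. x \<in> S \<Longrightarrow> G x = g x"
proof -
  have cl: "closure S = {u..v}"
  proof
    show "closure S \<subseteq> {u..v}" using S(2) by (simp add: closure_minimal)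
    show "{u..v} \<subseteq> closure S" using closure_mono[OF S(1)] \<open>u < v\<close> by simp
  qed
  obtain G where unif: "uniformly_continuous_on {u..v} G" and G: "\<And>x. x \<in> S \<Longrightarrow> g x = G x"
    using uniformly_continuous_on_extension_on_closure[OF ac_on_imp_uniformly_continuous_on[OF g]]
    unfolding cl by metis
  have cont: "continuous_on {u..v} G" using unif by (rule uniformly_continuous_imp_continuous)
  define m where "m = (u + v) / 2"
  define \<phi> where "\<phi> \<eta> x = x + \<eta> * (m - x)" for \<eta> x :: real
  have \<phi>_in: "\<phi> \<eta> x \<in> S" if "0 < \<eta>" "\<eta> < 1" "x \<in> {u..v}" for \<eta> x
  proof -
    have "\<phi> \<eta> x - u = (1 - \<eta>) * (x - u) + \<eta> * (m - u)" "v - \<phi> \<eta> x = (1 - \<eta>) * (v - x) + \<eta> * (v - m)"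
      by (auto simp: \<phi>_def algebra_simps)
    moreover have "0 < \<eta> * (m - u)" "0 < \<eta> * (v - m)"
      using that \<open>u < v\<close> by (auto simp: m_def)
    moreover have "0 \<le> (1 - \<eta>) * (x - u)" "0 \<le> (1 - \<eta>) * (v - x)"
      using that by auto
    ultimately have "0 < \<phi> \<eta> x - u" "0 < v - \<phi> \<eta> x"
      by (simp_all only: add_nonneg_pos)
    then show ?thesis using S by auto
  qed
  have \<phi>_diff: "\<phi> \<eta> y - \<phi> \<eta> x = (1 - \<eta>) * (y - x)" for \<eta> x y
    by (simp add: \<phi>_def algebra_simps)
  have \<phi>_mono: "\<phi> \<eta> x \<le> \<phi> \<eta> y" if "0 < \<eta>" "\<eta> < 1" "x \<le> y" for \<eta> x y
  proof -
    have "0 \<le> (1 - \<eta>) * (y - x)" using that by simp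
    then show ?thesis using \<phi>_diff[of \<eta> y x] by simp
  qed
  have lim: "((\<lambda>\<eta>. G (\<phi> \<eta> x)) \<longlongrightarrow> G x) (at_right 0)" if "x \<in> {u..v}" for x
  proof (rule continuous_on_tendsto_compose[OF cont _ that])
    have "((\<lambda>\<eta>. x + \<eta> * (m - x)) \<longlongrightarrow> x + 0 * (m - x)) (at_right 0)"
      by (intro tendsto_intros)
    then show "((\<lambda>\<eta>. \<phi> \<eta> x) \<longlongrightarrow> x) (at_right 0)" by (simp add: \<phi>_def)
    have "\<forall>\<^sub>F \<eta> in at_right 0. \<eta> \<in> {0<..<1::real}" by (rule eventually_at_right_real) simp
    then show "\<forall>\<^sub>F \<eta> in at_right 0. \<phi> \<eta> x \<in> {u..v}"
    proof eventually_elim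
      case (elim \<eta>)
      then have "\<phi> \<eta> x \<in> S" using that by (intro \<phi>_in) auto
      then show ?case using S(2) by blast
    qed
  qed
  have "ac_on {u..v} G"
    unfolding ac_on_def
  proof (intro allI impI)
    fix \<epsilon> :: real assume "0 < \<epsilon>"
    then have "0 < \<epsilon> / 2" by simp
    obtain \<delta> where "0 < \<delta>" and \<delta>: "\<forall>(n::nat) s t. (\<forall>i<n. s i \<in> S \<and> t i \<in> S \<and> s i \<le> t i) \<and>
       (\<forall>i<n. \<forall>j<n. i \<noteq> j \<longrightarrow> t i \<le> s j \<or> t j \<le> s i) \<and>
       (\<Sum>i<n. t i - s i) < \<delta> \<longrightarrow> (\<Sum>i<n. norm (g (t i) - g (s i))) < \<epsilon> / 2"
      using g[unfolded ac_on_def, rule_format, OF \<open>0 < \<epsilon> / 2\<close>] by (elim exE conjE)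
    show "\<exists>\<delta>>0. \<forall>(n::nat) s t. (\<forall>i<n. s i \<in> {u..v} \<and> t i \<in> {u..v} \<and> s i \<le> t i) \<and>
       (\<forall>i<n. \<forall>j<n. i \<noteq> j \<longrightarrow> t i \<le> s j \<or> t j \<le> s i) \<and>
       (\<Sum>i<n. t i - s i) < \<delta> \<longrightarrow> (\<Sum>i<n. norm (G (t i) - G (s i))) < \<epsilon>"
    proof (intro exI[of _ \<delta>] conjI allI impI)
      fix n :: nat and s t
      assume *: "(\<forall>i<n. s i \<in> {u..v} \<and> t i \<in> {u..v} \<and> s i \<le> t i) \<and>
       (\<forall>i<n. \<forall>j<n. i \<noteq> j \<longrightarrow> t i \<le> s j \<or> t j \<le> s i) \<and> (\<Sum>i<n. t i - s i) < \<delta>"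
      have le: "(\<Sum>i<n. norm (G (\<phi> \<eta> (t i)) - G (\<phi> \<eta> (s i)))) \<le> \<epsilon> / 2" if \<eta>: "0 < \<eta>" "\<eta> < 1" for \<eta>
      proof -
        have "(\<Sum>i<n. \<phi> \<eta> (t i) - \<phi> \<eta> (s i)) \<le> (\<Sum>i<n. t i - s i)"
        proof (intro sum_mono)
          fix i assume "i \<in> {..<n}"
          then have "0 \<le> \<eta> * (t i - s i)" using \<eta> * by simp
          then show "\<phi> \<eta> (t i) - \<phi> \<eta> (s i) \<le> t i - s i" by (simp add: \<phi>_diff algebra_simps)
        qed
        moreover have "\<phi> \<eta> (t i) \<le> \<phi> \<eta> (s j) \<or> \<phi> \<eta> (t j) \<le> \<phi> \<eta> (s i)" if "i < n" "j < n" "i \<noteq> j" for i j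
          using * that \<phi>_mono[OF \<eta>] by metis
        moreover have "\<phi> \<eta> (s i) \<in> S \<and> \<phi> \<eta> (t i) \<in> S \<and> \<phi> \<eta> (s i) \<le> \<phi> \<eta> (t i)" if "i < n" for i
          using * that \<phi>_in[OF \<eta>] \<phi>_mono[OF \<eta>] by simp
        ultimately have "(\<Sum>i<n. norm (g (\<phi> \<eta> (t i)) - g (\<phi> \<eta> (s i)))) < \<epsilon> / 2"
          using * by (intro \<delta>[rule_format, of n "\<lambda>i. \<phi> \<eta> (s i)" "\<lambda>i. \<phi> \<eta> (t i)"]) auto
        moreover have "(\<Sum>i<n. norm (G (\<phi> \<eta> (t i)) - G (\<phi> \<eta> (s i)))) = (\<Sum>i<n. norm (g (\<phi> \<eta> (t i)) - g (\<phi> \<eta> (s i))))"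
          using * \<phi>_in[OF \<eta>] by (intro sum.cong) (auto simp: G)
        ultimately show ?thesis by simp
      qed
      have "((\<lambda>\<eta>. \<Sum>i<n. norm (G (\<phi> \<eta> (t i)) - G (\<phi> \<eta> (s i)))) \<longlongrightarrow> (\<Sum>i<n. norm (G (t i) - G (s i)))) (at_right 0)"
        using * by (intro tendsto_sum tendsto_norm tendsto_diff lim) auto
      moreover have "\<forall>\<^sub>F \<eta> in at_right 0. \<eta> \<in> {0<..<1::real}" by (rule eventually_at_right_real) simp
      then have "\<forall>\<^sub>F \<eta> in at_right 0. (\<Sum>i<n. norm (G (\<phi> \<eta> (t i)) - G (\<phi> \<eta> (s i)))) \<le> \<epsilon> / 2"
        by eventually_elim (use le in auto)
      ultimately have "(\<Sum>i<n. norm (G (t i) - G (s i))) \<le> \<epsilon> / 2"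
        by (rule tendsto_upperbound) simp
      then show "(\<Sum>i<n. norm (G (t i) - G (s i))) < \<epsilon>" using \<open>0 < \<epsilon>\<close> by simp
    qed fact
  qed
  with G show thesis by (intro that) auto
qed

text \<open>A Lebesgue null set lies in an open set of measure below \<open>\<delta>\<close>. This
  set is an increasing union of finite unions of compact intervals; each finite union has a
  division, and its Stieltjes measure is at most the sum of the increments of \<open>F\<close>,
  which absolute continuity bounds by \<open>\<epsilon>\<close>.\<close>

lemma absolutely_continuous_interval_measure:
  fixes F :: "real \<Rightarrow> real"
  assumes "mono F" and ac: "ac_on UNIV F"
  shows "absolutely_continuous lborel (interval_measure F)"
  unfolding absolutely_continuous_def
proof
  have cont: "continuous_on UNIV F"
    using ac_on_imp_uniformly_continuous_on[OF ac] by (rule uniformly_continuous_imp_continuous)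
  have mono: "\<And>x y. x \<le> y \<Longrightarrow> F x \<le> F y" using \<open>mono F\<close> by (simp add: monoD)
  let ?M = "interval_measure F"
  fix N :: "real set" assume "N \<in> null_sets lborel"
  then have N: "N \<in> sets borel" "emeasure lborel N = 0" by auto
  have "emeasure ?M N \<le> ennreal \<epsilon>" if pos: "0 < \<epsilon>" for \<epsilon>
  proof -
    obtain \<delta> where "0 < \<delta>" and \<delta>: "\<forall>(I::real set set) s t. nonoverlapping I s t \<longrightarrow> (\<forall>i\<in>I. s i \<in> UNIV \<and> t i \<in> UNIV) \<longrightarrow>
       (\<Sum>i\<in>I. t i - s i) < \<delta> \<longrightarrow> (\<Sum>i\<in>I. norm (F (t i) - F (s i))) < \<epsilon>"
      using ac_on_nonoverlapping[OF ac pos, where 'i="real set"] by (elim exE conjE)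
    obtain U where U: "open U" "N \<subseteq> U" "emeasure lborel (U - N) < ennreal \<delta>"
      using outer_regular_lborel[OF N(1) \<open>0 < \<delta>\<close>] by metis
    have "emeasure lborel U = emeasure lborel (U - N)"
      using N U(1) by (subst emeasure_Diff_null_set) (auto simp: null_sets_def)
    then have U\<delta>: "emeasure lborel U < ennreal \<delta>" using U(3) by simp
    then have Ufm: "U \<in> lmeasurable"
      using U(1) \<open>0 < \<delta>\<close> by (auto simp: fmeasurable_def intro: less_trans)
    then have "emeasure lborel U = ennreal (measure lebesgue U)"
      using U(1) emeasure_eq_measure2[OF Ufm] by simp
    then have mU: "measure lebesgue U < \<delta>"
      using U\<delta> by (simp add: ennreal_less_iff)
    obtain \<D> where \<D>: "countable \<D>" "\<And>X. X \<in> \<D> \<Longrightarrow> \<exists>a b. X = cbox a b" "\<Union>\<D> = U"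
      using open_countable_Union_open_cbox[OF U(1)] by metis
    have \<D>_borel: "X \<in> sets borel" if "X \<in> \<D>" for X
      using \<D>(2)[OF that] by auto
    have fin: "emeasure ?M (\<Union>\<A>) \<le> ennreal \<epsilon>" if \<A>: "finite \<A>" "\<A> \<subseteq> \<D>" for \<A>
    proof -
      obtain p where p: "p division_of \<Union>\<A>"
        using elementary_unions_intervals[OF \<A>(1)] \<D>(2) \<A>(2) by (metis subset_iff)
      have finp: "finite p" using p by blast
      have pint: "\<exists>a b. K = {a..b} \<and> a \<le> b" if "K \<in> p" for K
        using division_ofD(3,4)[OF p that] by (metis atLeastatMost_empty_iff box_real(2))
      \<comment> \<open>Members of a division only have disjoint interiors, so a one-point member
        may sit inside another one and violate \<open>nonoverlapping\<close>. Such members carry no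
        increment and are dropped.\<close>
      define p' where "p' = {K \<in> p. interior K \<noteq> {}}"
      have no: "nonoverlapping p' Inf Sup"
        unfolding nonoverlapping_def
      proof (intro conjI ballI impI)
        show "finite p'" using finp by (simp add: p'_def)
        show "Inf K \<le> Sup K" if "K \<in> p'" for K :: "real set"
          using pint[of K] that by (auto simp: p'_def)
        show "Sup K \<le> Inf L \<or> Sup L \<le> Inf K" if KL: "K \<in> p'" "L \<in> p'" "K \<noteq> L" for K L :: "real set"
        proof (rule ccontr)
          assume *: "\<not> ?thesis"
          obtain a b c d where ab: "K = {a..b}" "a \<le> b" "L = {c..d}" "c \<le> d"
            using pint[of K] pint[of L] KL by (auto simp: p'_def)
          have "a < b" "c < d" using KL ab by (auto simp: p'_def interior_atLeastAtMost_real)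
          moreover have "c < b" "a < d" using * ab by auto
          ultimately have "(max a c + min b d) / 2 \<in> interior K \<inter> interior L"
            unfolding ab by (auto simp: interior_atLeastAtMost_real max_def min_def field_simps)
          then show False using division_ofD(5)[OF p, of K L] KL by (auto simp: p'_def)
        qed
      qed
      have content: "Sup K - Inf K = measure lebesgue (interior K)" if "K \<in> p" for K
        using pint[OF that] by (auto simp: interior_atLeastAtMost_real)
      have "(\<Sum>K\<in>p'. Sup K - Inf K) = (\<Sum>K\<in>p'. measure lebesgue (interior K))"
        by (intro sum.cong refl content) (simp add: p'_def)
      also have "\<dots> = measure lebesgue (\<Union>K\<in>p'. interior K)"
      proof (intro measure_UNION'[symmetric])
        show "finite p'" using finp by (simp add: p'_def)
        show "interior K \<in> lmeasurable" if "K \<in> p'" for K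
          using pint[of K] that by (auto simp: p'_def interior_atLeastAtMost_real)
        show "pairwise (\<lambda>K L. disjnt (interior K) (interior L)) p'"
          using division_ofD(5)[OF p] by (simp add: p'_def pairwise_def disjnt_def)
      qed
      also have "\<dots> \<le> measure lebesgue U"
      proof (rule measure_mono_fmeasurable[OF _ _ Ufm])
        have "interior K \<subseteq> U" if "K \<in> p'" for K
          using interior_subset[of K] division_ofD(6)[OF p] that \<A> \<D>(3) unfolding p'_def by blast
        then show "(\<Union>K\<in>p'. interior K) \<subseteq> U" by blast
        have "open (\<Union>K\<in>p'. interior K)" by auto
        then show "(\<Union>K\<in>p'. interior K) \<in> sets lebesgue"
          by (intro sets_completionI_sets) auto
      qed
      finally have sm: "(\<Sum>K\<in>p'. norm (F (Sup K) - F (Inf K))) < \<epsilon>"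
        using mU by (intro \<delta>[rule_format] no) auto
      have "emeasure ?M (\<Union>\<A>) = emeasure ?M (\<Union>K\<in>p. K)"
        using division_ofD(6)[OF p] by simp
      also have "\<dots> \<le> (\<Sum>K\<in>p. emeasure ?M K)"
        using finp pint by (intro emeasure_subadditive_finite) fastforce+
      also have "\<dots> = (\<Sum>K\<in>p. ennreal (F (Sup K) - F (Inf K)))"
      proof (intro sum.cong refl)
        fix K assume "K \<in> p"
        then obtain a b where "K = {a..b}" "a \<le> b" using pint by blast
        then show "emeasure ?M K = ennreal (F (Sup K) - F (Inf K))"
          using emeasure_interval_measure_Icc[of a b F] mono cont by simp
      qed
      also have "\<dots> = ennreal (\<Sum>K\<in>p. F (Sup K) - F (Inf K))"
        using pint mono by (intro sum_ennreal) fastforce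
      also have "(\<Sum>K\<in>p. F (Sup K) - F (Inf K)) = (\<Sum>K\<in>p'. F (Sup K) - F (Inf K))"
      proof (intro sum.mono_neutral_right finp ballI)
        fix K assume K: "K \<in> p - p'"
        then obtain a b where ab: "K = {a..b}" "a \<le> b" using pint by blast
        have "interior K = {}" using K by (auto simp: p'_def)
        then have "a = b" using ab by (simp add: interior_atLeastAtMost_real)
        then show "F (Sup K) - F (Inf K) = 0" using ab by simp
      qed (auto simp: p'_def)
      also have "\<dots> \<le> (\<Sum>K\<in>p'. norm (F (Sup K) - F (Inf K)))"
        by (intro sum_mono) auto
      finally show ?thesis using sm by (meson ennreal_leI le_less_trans less_imp_le order_trans)
    qed
    have "emeasure ?M U \<le> ennreal \<epsilon>"
    proof (cases "\<D> = {}")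
      case True
      then show ?thesis using \<D>(3) by auto
    next
      case False
      define A where "A n = \<Union>(from_nat_into \<D> ` {..n})" for n :: nat
      have "(\<Union>n. A n) = U"
      proof -
        have "(\<Union>n. A n) = \<Union>(range (from_nat_into \<D>))" by (auto simp: A_def)
        then show ?thesis using \<D>(3) range_from_nat_into[OF False \<D>(1)] by simp
      qed
      moreover have "incseq A"
        unfolding A_def incseq_def by (intro allI impI Union_mono image_mono) auto
      moreover have "A n \<in> sets ?M" for n
        unfolding A_def using from_nat_into[OF False] \<D>_borel
        by (intro sets.finite_Union) auto
      ultimately have "emeasure ?M U = (SUP n. emeasure ?M (A n))"
        by (subst SUP_emeasure_incseq) auto
      also have "\<dots> \<le> ennreal \<epsilon>"
        unfolding A_def using from_nat_into[OF False] by (intro SUP_least fin) auto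
      finally show ?thesis .
    qed
    then show ?thesis
      using emeasure_mono[OF U(2), of ?M] U(1) by (auto intro: order_trans)
  qed
  then have "emeasure ?M N = 0"
    using ennreal_le_epsilon[of 0 "emeasure ?M N"] by simp
  then show "N \<in> null_sets ?M" using N by auto
qed

lemma mono_ac_on_density:
  fixes F :: "real \<Rightarrow> real"
  assumes "mono F" and ac: "ac_on UNIV F"
  obtains h where "\<And>x y. x \<le> y \<Longrightarrow> h absolutely_integrable_on {x..y}"
    "\<And>x y. x \<le> y \<Longrightarrow> integral {x..y} h = F y - F x"
proof -
  have cont: "continuous_on UNIV F"
    using ac_on_imp_uniformly_continuous_on[OF ac] by (rule uniformly_continuous_imp_continuous)
  have mono: "\<And>x y. x \<le> y \<Longrightarrow> F x \<le> F y" using \<open>mono F\<close> by (simp add: monoD)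
  obtain g where g: "g \<in> borel_measurable lborel" "density lborel g = interval_measure F"
    using sigma_finite_measure.Radon_Nikodym[OF sigma_finite_lborel absolutely_continuous_interval_measure[OF assms]]
    by auto
  have [measurable]: "g \<in> borel_measurable borel" using g(1) by simp
  \<comment> \<open>\<open>g\<close> may be infinite at some points. The measure of every compact
    interval is finite, so this happens only on a null set, where \<open>enn2real\<close>
    substitutes 0.\<close>
  define h where "h x = enn2real (g x)" for x
  have [measurable]: "h \<in> borel_measurable borel" unfolding h_def by measurable
  have *: "set_integrable lborel {x..y} h \<and> (LINT t:{x..y}|lborel. h t) = F y - F x" if "x \<le> y" for x y
  proof -
    have 1: "(\<integral>\<^sup>+t. g t * indicator {x..y} t \<partial>lborel) = ennreal (F y - F x)"
      using emeasure_interval_measure_Icc[OF that mono cont] emeasure_density[of g lborel "{x..y}"] g(1)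
      unfolding g(2) by simp
    then have "AE t in lborel. g t * indicator {x..y} t \<noteq> \<infinity>"
      by (intro nn_integral_PInf_AE) auto
    then have "AE t in lborel. g t * indicator {x..y} t = ennreal (indicat_real {x..y} t * h t)"
      by eventually_elim (auto simp: h_def indicator_def less_top)
    then have 2: "(\<integral>\<^sup>+t. ennreal (indicat_real {x..y} t * h t) \<partial>lborel) = ennreal (F y - F x)"
      using 1 nn_integral_cong_AE by fastforce
    have "integrable lborel (\<lambda>t. indicat_real {x..y} t * h t)"
      by (rule integrableI_nn_integral_finite[OF _ _ 2]) (auto simp: h_def)
    moreover have "(LINT t|lborel. indicat_real {x..y} t * h t) = F y - F x"
      using 2 mono[OF that] by (subst integral_eq_nn_integral) (auto simp: h_def)
    ultimately show ?thesis
      by (simp add: set_integrable_def set_lebesgue_integral_def)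
  qed
  show thesis
  proof
    fix x y :: real assume xy: "x \<le> y"
    note ** = set_borel_integral_eq_integral[OF conjunct1[OF *[OF xy]]]
    show "h absolutely_integrable_on {x..y}"
      using **(1) by (intro nonnegative_absolutely_integrable_1) (auto simp: h_def)
    show "integral {x..y} h = F y - F x"
      using **(2) *[OF xy] by simp
  qed
qed


text \<open>After clamping, \<open>g\<close> lives on the whole line and is constant outside
  \<open>[u, v]\<close>. Both \<open>P\<close> and \<open>P - g\<close> are monotone and absolutely
  continuous, and the difference of their densities is the density of \<open>g\<close>.\<close>

lemma ac_on_real_density:
  fixes f :: "real \<Rightarrow> real"
  assumes f: "ac_on {u..v} f" and "u \<le> v"
  obtains h where "h absolutely_integrable_on {u..v}"
    "\<And>x. x \<in> {u..v} \<Longrightarrow> integral {u..x} h = f x - f u"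
proof -
  define \<phi> where "\<phi> x = max u (min v x)" for x
  define g where "g x = f (\<phi> x)" for x
  have "mono \<phi>" by (auto simp: mono_def \<phi>_def)
  have g: "ac_on UNIV g"
    unfolding g_def
    by (rule ac_on_compose_contraction[OF f \<open>mono \<phi>\<close>]) (use \<open>u \<le> v\<close> in \<open>auto simp: \<phi>_def\<close>)
  have g_eq: "g x = f x" if "x \<in> {u..v}" for x
    using that by (simp add: g_def \<phi>_def)
  have g_left: "g x = g u" if "x \<le> u" for x
    using that \<open>u \<le> v\<close> by (simp add: g_def \<phi>_def)
  define P where "P = pos_var g u"
  have P: "ac_on UNIV P" unfolding P_def by (rule ac_on_pos_var[OF g])
  have monoP: "mono P" unfolding P_def by (intro monoI pos_var_mono[OF g])
  have monoQ: "mono (\<lambda>x. P x - g x)"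
  proof (rule monoI)
    fix x y :: real assume "x \<le> y"
    \<comment> \<open>The comparison of increments with \<open>P\<close> is available only to the
      right of the base point \<open>u\<close>; to its left \<open>g\<close> is constant and
      monotonicity of \<open>P\<close> suffices.\<close>
    consider "u \<le> x" | "x < u" "u \<le> y" | "y < u" by linarith
    then show "P x - g x \<le> P y - g y"
    proof cases
      case 1
      then show ?thesis using increment_le_pos_var[OF g 1 \<open>x \<le> y\<close>] by (simp add: P_def)
    next
      case 2
      have "g y - g u \<le> P y - P u" using increment_le_pos_var[OF g order_refl 2(2)] by (simp add: P_def)
      moreover have "P x \<le> P u" using monoP 2 by (simp add: monoD)
      ultimately show ?thesis using g_left[of x] 2 by simp
    next
      case 3
      then show ?thesis using g_left[of x] g_left[of y] \<open>x \<le> y\<close> monoP by (simp add: monoD)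
    qed
  qed
  obtain p where p: "\<And>x y. x \<le> y \<Longrightarrow> p absolutely_integrable_on {x..y}"
    "\<And>x y. x \<le> y \<Longrightarrow> integral {x..y} p = P y - P x"
    using mono_ac_on_density[OF monoP P] by blast
  obtain k where k: "\<And>x y. x \<le> y \<Longrightarrow> k absolutely_integrable_on {x..y}"
    "\<And>x y. x \<le> y \<Longrightarrow> integral {x..y} k = (P y - g y) - (P x - g x)"
    using mono_ac_on_density[OF monoQ ac_on_diff[OF P g]] by blast
  show thesis
  proof
    show "(\<lambda>x. p x - k x) absolutely_integrable_on {u..v}"
      using p(1) k(1) \<open>u \<le> v\<close> by (intro set_integral_diff) auto
    fix x assume x: "x \<in> {u..v}"
    have "integral {u..x} (\<lambda>x. p x - k x) = integral {u..x} p - integral {u..x} k"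
      using x p(1)[of u x] k(1)[of u x]
      by (intro Henstock_Kurzweil_Integration.integral_diff) (auto dest: set_lebesgue_integral_eq_integral(1))
    then show "integral {u..x} (\<lambda>x. p x - k x) = f x - f u"
      using x p(2) k(2) g_eq by simp
  qed
qed

lemma ac_on_density:
  fixes f :: "real \<Rightarrow> complex"
  assumes f: "ac_on {u..v} f" and "u \<le> v"
  obtains h where "h absolutely_integrable_on {u..v}"
    "\<And>x. x \<in> {u..v} \<Longrightarrow> integral {u..x} h = f x - f u"
proof -
  have Re: "ac_on {u..v} (\<lambda>x. Re (f x))"
    by (rule ac_on_dominated[OF f f, where B=1])
       (metis abs_Re_le_cmod add_increasing mult_1 minus_complex.sel(1) norm_ge_zero real_norm_def)
  have Im: "ac_on {u..v} (\<lambda>x. Im (f x))"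
    by (rule ac_on_dominated[OF f f, where B=1])
       (metis abs_Im_le_cmod add_increasing mult_1 minus_complex.sel(2) norm_ge_zero real_norm_def)
  obtain r where r: "r absolutely_integrable_on {u..v}"
    "\<And>x. x \<in> {u..v} \<Longrightarrow> integral {u..x} r = Re (f x) - Re (f u)"
    using ac_on_real_density[OF Re \<open>u \<le> v\<close>] by blast
  obtain i where i: "i absolutely_integrable_on {u..v}"
    "\<And>x. x \<in> {u..v} \<Longrightarrow> integral {u..x} i = Im (f x) - Im (f u)"
    using ac_on_real_density[OF Im \<open>u \<le> v\<close>] by blast
  define h where "h x = r x *\<^sub>R (1::complex) + i x *\<^sub>R \<i>" for x
  show thesis
  proof
    have "(\<lambda>x. r x *\<^sub>R (1::complex)) absolutely_integrable_on {u..v}" "(\<lambda>x. i x *\<^sub>R \<i>) absolutely_integrable_on {u..v}"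
      using absolutely_integrable_linear[OF r(1) bounded_linear_scaleR_left]
        absolutely_integrable_linear[OF i(1) bounded_linear_scaleR_left] by (auto simp: o_def)
    then show "h absolutely_integrable_on {u..v}"
      unfolding h_def by (rule set_integral_add)
    fix x assume x: "x \<in> {u..v}"
    have int: "r integrable_on {u..x}" "i integrable_on {u..x}"
      using r(1) i(1) x by (auto dest!: set_lebesgue_integral_eq_integral(1) intro: integrable_on_subinterval)
    have "(h has_integral (integral {u..x} r *\<^sub>R 1 + integral {u..x} i *\<^sub>R \<i>)) {u..x}"
      unfolding h_def using int
      by (intro has_integral_add has_integral_scaleR_left integrable_integral)
    then have "integral {u..x} h = integral {u..x} r *\<^sub>R 1 + integral {u..x} i *\<^sub>R \<i>"
      by (rule integral_unique)
    then show "integral {u..x} h = f x - f u"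
      using r(2) i(2) x by (simp add: complex_eq_iff)
  qed
qed

lemma has_vector_derivative_of_density:
  fixes f :: "real \<Rightarrow> complex"
  assumes h: "h integrable_on {u..v}" and f: "\<And>x. x \<in> {u..v} \<Longrightarrow> integral {u..x} h = f x - f u"
  obtains N where "negligible N"
    "\<And>x. x \<in> {u<..<v} - N \<Longrightarrow> (f has_vector_derivative h x) (at x)"
proof -
  obtain N where N: "negligible N" "\<And>x. x \<in> {u<..<v} - N \<Longrightarrow> ((\<lambda>x. integral {u..x} h) has_vector_derivative h x) (at x)"
    using indefinite_integral_has_vector_derivative_ae[OF h] by blast
  show thesis
  proof
    fix x assume x: "x \<in> {u<..<v} - N"
    have "((\<lambda>x. f u + integral {u..x} h) has_vector_derivative 0 + h x) (at x)"
      using N(2)[OF x] by (intro derivative_intros)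
    then have "((\<lambda>x. f u + integral {u..x} h) has_vector_derivative h x) (at x)" by simp
    then show "(f has_vector_derivative h x) (at x)"
      by (rule has_vector_derivative_transform_within_open[of _ _ _ "{u<..<v}"]) (use x f in auto)
  qed fact
qed

text \<open>Derivatives are unique, so \<open>f'\<close> coincides almost everywhere with the
  density of \<open>f\<close> and inherits its integrability and its integrals.\<close>

lemma ac_on_fundamental_theorem:
  fixes f :: "real \<Rightarrow> complex"
  assumes f: "ac_on {u..v} f" and "u \<le> v" and M: "negligible M"
    and der: "\<And>x. x \<in> {u<..<v} - M \<Longrightarrow> (f has_vector_derivative f' x) (at x)"
  shows "f' absolutely_integrable_on {u..v}" "x \<in> {u..v} \<Longrightarrow> integral {u..x} f' = f x - f u"
proof -
  obtain h where h: "h absolutely_integrable_on {u..v}"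
    "\<And>x. x \<in> {u..v} \<Longrightarrow> integral {u..x} h = f x - f u"
    using ac_on_density[OF f \<open>u \<le> v\<close>] by blast
  obtain N where N: "negligible N" "\<And>x. x \<in> {u<..<v} - N \<Longrightarrow> (f has_vector_derivative h x) (at x)"
    using has_vector_derivative_of_density[OF set_lebesgue_integral_eq_integral(1)[OF h(1)] h(2)] by blast
  have neg: "negligible (M \<union> N \<union> {u, v})" using M N(1) by simp
  have eq: "f' x = h x" if "x \<in> {u..v} - (M \<union> N \<union> {u, v})" for x
    using that by (intro vector_derivative_unique_at[OF der N(2)]) auto
  show "f' absolutely_integrable_on {u..v}"
    by (rule absolutely_integrable_spike[OF h(1) neg eq])
  show "integral {u..x} f' = f x - f u" if "x \<in> {u..v}"
    using integral_spike[OF neg, of "{u..x}" f' h] eq h(2)[OF that] that by (auto simp: subset_iff)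
qed

text \<open>Square integrability allows a direct estimate: integrating
  \<open>2 |h| \<le> \<eta> |h|^2 + 1 / \<eta>\<close> over the family bounds the increments by half
  of \<open>\<eta> C\<close> plus the total length divided by \<open>\<eta>\<close>.\<close>

lemma ac_on_indefinite_integral:
  fixes h :: "real \<Rightarrow> complex"
  assumes h: "h absolutely_integrable_on {u..v}" and h2: "(\<lambda>x. (cmod (h x))\<^sup>2) integrable_on {u..v}"
    and f: "\<And>x. x \<in> {u..v} \<Longrightarrow> integral {u..x} h = f x - f u"
  shows "ac_on {u..v} f"
  unfolding ac_on_def
proof (intro allI impI)
  fix \<epsilon> :: real assume "0 < \<epsilon>"
  define C where "C = integral {u..v} (\<lambda>x. (cmod (h x))\<^sup>2)"
  have "0 \<le> C" unfolding C_def by (intro integral_nonneg h2) auto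
  \<comment> \<open>This choice gives \<open>\<eta> * C < \<epsilon>\<close>; a total length below
    \<open>\<epsilon> * \<eta>\<close> keeps the other term below \<open>\<epsilon>\<close> as
    well.\<close>
  define \<eta> where "\<eta> = \<epsilon> / (C + 1)"
  have "0 < \<eta>" using \<open>0 < \<epsilon>\<close> \<open>0 \<le> C\<close> by (simp add: \<eta>_def)
  have hint: "h integrable_on {u..v}" and nint: "(\<lambda>x. cmod (h x)) integrable_on {u..v}"
    using h by (auto simp: absolutely_integrable_on_def)
  have step: "norm (f y - f x) \<le> (\<eta> * integral {x..y} (\<lambda>x. (cmod (h x))\<^sup>2) + (y - x) / \<eta>) / 2"
    if "x \<in> {u..v}" "y \<in> {u..v}" "x \<le> y" for x y
  proof -
    have sub: "{x..y} \<subseteq> {u..v}" using that by auto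
    have i: "h integrable_on {x..y}" "(\<lambda>x. cmod (h x)) integrable_on {x..y}" "(\<lambda>x. (cmod (h x))\<^sup>2) integrable_on {x..y}"
      using hint nint h2 sub by (auto intro: integrable_on_subinterval)
    have iuy: "h integrable_on {u..y}"
      using that by (intro integrable_on_subinterval[OF hint]) auto
    have "integral {u..x} h + integral {x..y} h = integral {u..y} h"
      using that iuy by (intro Henstock_Kurzweil_Integration.integral_combine) auto
    then have "(f x - f u) + integral {x..y} h = f y - f u" using f that by simp
    then have "f y - f x = integral {x..y} h" by (simp add: algebra_simps)
    then have "norm (f y - f x) \<le> integral {x..y} (\<lambda>t. cmod (h t))"
      using integral_norm_bound_integral[OF i(1,2)] by simp
    also have "\<dots> \<le> integral {x..y} (\<lambda>t. (\<eta> * (cmod (h t))\<^sup>2 + 1 / \<eta>) / 2)"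
    proof (intro integral_le i(2))
      show "(\<lambda>t. (\<eta> * (cmod (h t))\<^sup>2 + 1 / \<eta>) / 2) integrable_on {x..y}"
        using integrable_on_divide[OF integrable_add[OF integrable_on_mult_right[OF i(3)] integrable_const_ivl]] .
      fix t
      have "0 \<le> (\<eta> * cmod (h t) - 1)\<^sup>2 / \<eta>" using \<open>0 < \<eta>\<close> by simp
      also have "\<dots> = \<eta> * (cmod (h t))\<^sup>2 + 1 / \<eta> - 2 * cmod (h t)"
        using \<open>0 < \<eta>\<close> by (simp add: power2_eq_square field_simps)
      finally show "cmod (h t) \<le> (\<eta> * (cmod (h t))\<^sup>2 + 1 / \<eta>) / 2" by simp
    qed
    also have "\<dots> = (\<eta> * integral {x..y} (\<lambda>x. (cmod (h x))\<^sup>2) + (y - x) / \<eta>) / 2"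
    proof (rule integral_unique)
      have "((\<lambda>t. (\<eta> * (cmod (h t))\<^sup>2 + 1 / \<eta>) / 2) has_integral
         (\<eta> * integral {x..y} (\<lambda>x. (cmod (h x))\<^sup>2) + measure lborel {x..y} *\<^sub>R (1 / \<eta>)) / 2) {x..y}"
        by (intro has_integral_divide has_integral_add has_integral_mult_right integrable_integral i(3) has_integral_const_real)
      with that show "((\<lambda>t. (\<eta> * (cmod (h t))\<^sup>2 + 1 / \<eta>) / 2) has_integral
         (\<eta> * integral {x..y} (\<lambda>x. (cmod (h x))\<^sup>2) + (y - x) / \<eta>) / 2) {x..y}" by simp
    qed
    finally show ?thesis .
  qed
  define V where "V x = integral {u..x} (\<lambda>x. (cmod (h x))\<^sup>2)" for x
  have V: "integral {x..y} (\<lambda>x. (cmod (h x))\<^sup>2) = V y - V x" if "x \<in> {u..v}" "y \<in> {u..v}" "x \<le> y" for x y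
  proof -
    have "(\<lambda>x. (cmod (h x))\<^sup>2) integrable_on {u..y}"
      using that by (intro integrable_on_subinterval[OF h2]) auto
    then show ?thesis
      using that Henstock_Kurzweil_Integration.integral_combine[of u x y "\<lambda>x. (cmod (h x))\<^sup>2"] by (simp add: V_def)
  qed
  show "\<exists>\<delta>>0. \<forall>(n::nat) s t. (\<forall>i<n. s i \<in> {u..v} \<and> t i \<in> {u..v} \<and> s i \<le> t i) \<and>
     (\<forall>i<n. \<forall>j<n. i \<noteq> j \<longrightarrow> t i \<le> s j \<or> t j \<le> s i) \<and>
     (\<Sum>i<n. t i - s i) < \<delta> \<longrightarrow> (\<Sum>i<n. norm (f (t i) - f (s i))) < \<epsilon>"
  proof (intro exI[of _ "\<epsilon> * \<eta>"] conjI allI impI)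
    show "0 < \<epsilon> * \<eta>" using \<open>0 < \<epsilon>\<close> \<open>0 < \<eta>\<close> by simp
    fix n :: nat and s t
    assume *: "(\<forall>i<n. s i \<in> {u..v} \<and> t i \<in> {u..v} \<and> s i \<le> t i) \<and>
     (\<forall>i<n. \<forall>j<n. i \<noteq> j \<longrightarrow> t i \<le> s j \<or> t j \<le> s i) \<and> (\<Sum>i<n. t i - s i) < \<epsilon> * \<eta>"
    have no: "nonoverlapping {..<n} s t" using * by (simp add: nonoverlapping_def)
    have Vmono: "V x \<le> V y" if "x \<in> {u..v}" "y \<in> {u..v}" "x \<le> y" for x y
    proof -
      have "(\<lambda>x. (cmod (h x))\<^sup>2) integrable_on {x..y}"
        using that by (intro integrable_on_subinterval[OF h2]) auto
      then have "0 \<le> integral {x..y} (\<lambda>x. (cmod (h x))\<^sup>2)"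
        by (intro integral_nonneg) auto
      then show ?thesis using V[OF that] by simp
    qed
    \<comment> \<open>The monotone \<open>V\<close> carries the family to a nonoverlapping one in
      \<open>[0, C]\<close>. Its total length is the integral of \<open>|h|^2\<close> over the
      family, which is thus at most \<open>C\<close>.\<close>
    have "nonoverlapping {..<n} (\<lambda>i. V (s i)) (\<lambda>i. V (t i))"
      unfolding nonoverlapping_def
    proof (intro conjI ballI impI)
      fix i j assume "i \<in> {..<n}" "j \<in> {..<n}" "i \<noteq> j"
      then show "V (t i) \<le> V (s j) \<or> V (t j) \<le> V (s i)"
        using * Vmono[of "t i" "s j"] Vmono[of "t j" "s i"] by (meson lessThan_iff)
    qed (use * Vmono in auto)
    moreover have "V u \<le> V (s i) \<and> V (t i) \<le> V v" if "i \<in> {..<n}" for i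
      using that * by (intro conjI Vmono) auto
    moreover have "V u \<le> V v" if "0 < n"
    proof -
      have "u \<le> v" using * that by fastforce
      then show ?thesis by (intro Vmono) auto
    qed
    moreover have "V u = 0" "V v = C" by (simp_all add: V_def C_def)
    ultimately have "(\<Sum>i<n. V (t i) - V (s i)) \<le> C"
      using nonoverlapping_length[of "{..<n}" "\<lambda>i. V (s i)" "\<lambda>i. V (t i)" "V u" "V v"] \<open>0 \<le> C\<close> by fastforce
    then have le_C: "(\<Sum>i<n. integral {s i..t i} (\<lambda>x. (cmod (h x))\<^sup>2)) \<le> C"
      using * V by simp
    have "(\<Sum>i<n. norm (f (t i) - f (s i)))
       \<le> (\<Sum>i<n. (\<eta> * integral {s i..t i} (\<lambda>x. (cmod (h x))\<^sup>2) + (t i - s i) / \<eta>) / 2)"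
      using * by (intro sum_mono step) auto
    also have "\<dots> = (\<eta> * (\<Sum>i<n. integral {s i..t i} (\<lambda>x. (cmod (h x))\<^sup>2)) + (\<Sum>i<n. t i - s i) / \<eta>) / 2"
      by (simp add: sum.distrib sum_distrib_left sum_divide_distrib[symmetric])
    also have "\<dots> \<le> (\<eta> * C + (\<Sum>i<n. t i - s i) / \<eta>) / 2"
      using le_C \<open>0 < \<eta>\<close> by (intro divide_right_mono add_right_mono mult_left_mono) auto
    also have "\<dots> < (\<epsilon> + \<epsilon>) / 2"
    proof -
      have "\<eta> * C < \<epsilon>" using \<open>0 < \<epsilon>\<close> \<open>0 \<le> C\<close> by (simp add: \<eta>_def field_simps)
      moreover have "(\<Sum>i<n. t i - s i) / \<eta> < \<epsilon>" using * \<open>0 < \<eta>\<close> by (simp add: field_simps)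
      ultimately show ?thesis by simp
    qed
    finally show "(\<Sum>i<n. norm (f (t i) - f (s i))) < \<epsilon>" by simp
  qed
qed

section \<open>Square-integrable functions and the Lagrange identity\<close>


lemma borel_measurable_cnj [measurable]: "cnj \<in> borel_measurable borel"
  by (intro borel_measurable_continuous_onI continuous_intros)

lemma L2_on_cong:
  assumes "\<And>x. x \<in> S \<Longrightarrow> f x = g x"
  shows "L2_on S f \<longleftrightarrow> L2_on S g"
proof -
  have "(\<lambda>x. indicat_real S x *\<^sub>R f x) = (\<lambda>x. indicat_real S x *\<^sub>R g x)"
    using assms by (auto simp: indicator_def of_bool_def)
  moreover have "(\<lambda>x. indicat_real S x *\<^sub>R (cmod (f x))\<^sup>2) = (\<lambda>x. indicat_real S x *\<^sub>R (cmod (g x))\<^sup>2)"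
    using assms by (auto simp: indicator_def of_bool_def)
  ultimately show ?thesis
    by (simp add: L2_on_def set_borel_measurable_def set_integrable_def)
qed

lemma L2_on_cong_AE:
  assumes f: "L2_on S f" and eq: "AE x in lebesgue. x \<in> S \<longrightarrow> f x = g x"
  shows "L2_on S g"
proof -
  have g: "(\<lambda>x. indicat_real S x *\<^sub>R g x) \<in> borel_measurable lebesgue"
    by (rule borel_measurable_AE[of "\<lambda>x. indicat_real S x *\<^sub>R f x"])
       (use f eq in \<open>auto simp: L2_on_def set_borel_measurable_def indicator_def elim!: eventually_mono\<close>)
  have *: "indicat_real S x *\<^sub>R (cmod (g x))\<^sup>2 = (cmod (indicat_real S x *\<^sub>R g x))\<^sup>2" for x
    by (auto simp: indicator_def)
  have "set_integrable lebesgue S (\<lambda>x. (cmod (g x))\<^sup>2)"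
    unfolding set_integrable_def
  proof (rule integrable_cong_AE_imp)
    show "integrable lebesgue (\<lambda>x. indicat_real S x *\<^sub>R (cmod (f x))\<^sup>2)"
      using f by (simp add: L2_on_def set_integrable_def)
    show "(\<lambda>x. indicat_real S x *\<^sub>R (cmod (g x))\<^sup>2) \<in> borel_measurable lebesgue"
      unfolding * using g by measurable
    show "AE x in lebesgue. indicat_real S x *\<^sub>R (cmod (f x))\<^sup>2 = indicat_real S x *\<^sub>R (cmod (g x))\<^sup>2"
      using eq by eventually_elim (auto simp: indicator_def)
  qed
  then show ?thesis using g by (simp add: L2_on_def set_borel_measurable_def)
qed

lemma L2_on_integrable_mult_cnj:
  assumes f: "L2_on S f" and g: "L2_on S g"
  shows "set_integrable lebesgue S (\<lambda>x. f x * cnj (g x))"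
  unfolding set_integrable_def
proof (rule Bochner_Integration.integrable_bound)
  have [measurable]: "(\<lambda>x. indicat_real S x *\<^sub>R f x) \<in> borel_measurable lebesgue"
    "(\<lambda>x. indicat_real S x *\<^sub>R g x) \<in> borel_measurable lebesgue"
    using f g by (auto simp: L2_on_def set_borel_measurable_def)
  show "integrable lebesgue (\<lambda>x. indicat_real S x *\<^sub>R (cmod (f x))\<^sup>2 + indicat_real S x *\<^sub>R (cmod (g x))\<^sup>2)"
    using f g by (auto simp: L2_on_def set_integrable_def)
  have "(\<lambda>x. indicat_real S x *\<^sub>R (f x * cnj (g x))) = (\<lambda>x. (indicat_real S x *\<^sub>R f x) * cnj (indicat_real S x *\<^sub>R g x))"
    by (auto simp: indicator_def)
  also have "\<dots> \<in> borel_measurable lebesgue" by measurable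
  finally show "(\<lambda>x. indicat_real S x *\<^sub>R (f x * cnj (g x))) \<in> borel_measurable lebesgue" .
  have "cmod (f x) * cmod (g x) \<le> (cmod (f x))\<^sup>2 + (cmod (g x))\<^sup>2" for x
    using sum_squares_bound[of "cmod (f x)" "cmod (g x)"]
      mult_nonneg_nonneg[OF norm_ge_zero norm_ge_zero, of "f x" "g x"] by linarith
  then have "norm (indicat_real S x *\<^sub>R (f x * cnj (g x)))
     \<le> norm (indicat_real S x *\<^sub>R (cmod (f x))\<^sup>2 + indicat_real S x *\<^sub>R (cmod (g x))\<^sup>2)" for x
    by (simp add: indicator_def norm_mult)
  then show "AE x in lebesgue. norm (indicat_real S x *\<^sub>R (f x * cnj (g x)))
     \<le> norm (indicat_real S x *\<^sub>R (cmod (f x))\<^sup>2 + indicat_real S x *\<^sub>R (cmod (g x))\<^sup>2)"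
    by simp
qed

lemma L2_on_bounded_mult:
  assumes f: "L2_on S f" and p: "set_borel_measurable lebesgue S p" and B: "\<And>x. x \<in> S \<Longrightarrow> cmod (p x) \<le> B"
  shows "L2_on S (\<lambda>x. p x * f x)"
proof -
  have [measurable]: "(\<lambda>x. indicat_real S x *\<^sub>R f x) \<in> borel_measurable lebesgue"
    "(\<lambda>x. indicat_real S x *\<^sub>R p x) \<in> borel_measurable lebesgue"
    using f p by (auto simp: L2_on_def set_borel_measurable_def)
  have "(\<lambda>x. indicat_real S x *\<^sub>R (p x * f x)) = (\<lambda>x. (indicat_real S x *\<^sub>R p x) * (indicat_real S x *\<^sub>R f x))"
    by (auto simp: indicator_def)
  also have "\<dots> \<in> borel_measurable lebesgue" by measurable
  finally have m: "(\<lambda>x. indicat_real S x *\<^sub>R (p x * f x)) \<in> borel_measurable lebesgue" .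
  have "integrable lebesgue (\<lambda>x. indicat_real S x *\<^sub>R (cmod (p x * f x))\<^sup>2)"
  proof (rule Bochner_Integration.integrable_bound)
    show "integrable lebesgue (\<lambda>x. B\<^sup>2 * (indicat_real S x *\<^sub>R (cmod (f x))\<^sup>2))"
      using f by (auto simp: L2_on_def set_integrable_def)
    have "(\<lambda>x. indicat_real S x *\<^sub>R (cmod (p x * f x))\<^sup>2) = (\<lambda>x. (cmod (indicat_real S x *\<^sub>R (p x * f x)))\<^sup>2)"
      by (auto simp: indicator_def)
    also have "\<dots> \<in> borel_measurable lebesgue" using m by measurable
    finally show "(\<lambda>x. indicat_real S x *\<^sub>R (cmod (p x * f x))\<^sup>2) \<in> borel_measurable lebesgue" .
    have "(cmod (p x * f x))\<^sup>2 \<le> B\<^sup>2 * (cmod (f x))\<^sup>2" if "x \<in> S" for x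
      unfolding norm_mult power_mult_distrib using B[OF that]
      by (intro mult_right_mono power_mono) auto
    then show "AE x in lebesgue. norm (indicat_real S x *\<^sub>R (cmod (p x * f x))\<^sup>2)
        \<le> norm (B\<^sup>2 * (indicat_real S x *\<^sub>R (cmod (f x))\<^sup>2))"
      by (auto simp: indicator_def)
  qed
  with m show ?thesis by (simp add: L2_on_def set_borel_measurable_def set_integrable_def)
qed

lemma L2_on_add:
  assumes f: "L2_on S f" and g: "L2_on S g"
  shows "L2_on S (\<lambda>x. f x + g x)"
proof -
  have [measurable]: "(\<lambda>x. indicat_real S x *\<^sub>R f x) \<in> borel_measurable lebesgue"
    "(\<lambda>x. indicat_real S x *\<^sub>R g x) \<in> borel_measurable lebesgue"
    using f g by (auto simp: L2_on_def set_borel_measurable_def)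
  have m: "(\<lambda>x. indicat_real S x *\<^sub>R (f x + g x)) \<in> borel_measurable lebesgue"
    unfolding scaleR_add_right by measurable
  have "integrable lebesgue (\<lambda>x. indicat_real S x *\<^sub>R (cmod (f x + g x))\<^sup>2)"
  proof (rule Bochner_Integration.integrable_bound)
    show "integrable lebesgue (\<lambda>x. 2 * (indicat_real S x *\<^sub>R (cmod (f x))\<^sup>2) + 2 * (indicat_real S x *\<^sub>R (cmod (g x))\<^sup>2))"
      using f g by (auto simp: L2_on_def set_integrable_def)
    have "(\<lambda>x. indicat_real S x *\<^sub>R (cmod (f x + g x))\<^sup>2) = (\<lambda>x. (cmod (indicat_real S x *\<^sub>R (f x + g x)))\<^sup>2)"
      by (auto simp: indicator_def)
    also have "\<dots> \<in> borel_measurable lebesgue" using m by measurable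
    finally show "(\<lambda>x. indicat_real S x *\<^sub>R (cmod (f x + g x))\<^sup>2) \<in> borel_measurable lebesgue" .
    have "(cmod (f x + g x))\<^sup>2 \<le> 2 * (cmod (f x))\<^sup>2 + 2 * (cmod (g x))\<^sup>2" for x
    proof -
      have "(cmod (f x + g x))\<^sup>2 \<le> (cmod (f x) + cmod (g x))\<^sup>2"
        by (intro power_mono norm_triangle_ineq) auto
      also have "\<dots> \<le> 2 * (cmod (f x))\<^sup>2 + 2 * (cmod (g x))\<^sup>2"
        using sum_squares_bound[of "cmod (f x)" "cmod (g x)"] by (simp add: power2_sum)
      finally show ?thesis .
    qed
    then show "AE x in lebesgue. norm (indicat_real S x *\<^sub>R (cmod (f x + g x))\<^sup>2)
        \<le> norm (2 * (indicat_real S x *\<^sub>R (cmod (f x))\<^sup>2) + 2 * (indicat_real S x *\<^sub>R (cmod (g x))\<^sup>2))"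
      by (auto simp: indicator_def)
  qed
  with m show ?thesis by (simp add: L2_on_def set_borel_measurable_def set_integrable_def)
qed

lemma continuous_on_norm_bound:
  fixes p :: "real \<Rightarrow> 'a::real_normed_vector"
  assumes "continuous_on {u..v} p"
  obtains B where "\<And>x. x \<in> {u..v} \<Longrightarrow> norm (p x) \<le> B"
proof -
  have "bounded (p ` {u..v})"
    by (intro compact_imp_bounded compact_continuous_image assms) simp
  then show thesis by (auto simp: bounded_iff intro: that)
qed

lemma L2_on_continuous_mult:
  assumes f: "L2_on {u<..<v} f" and p: "continuous_on {u..v} p"
  shows "L2_on {u<..<v} (\<lambda>x. p x * f x)"
proof -
  have "continuous_on {u<..<v} p" using p by (rule continuous_on_subset) auto
  then have "(\<lambda>x. indicat_real {u<..<v} x *\<^sub>R p x) \<in> borel_measurable borel"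
    by (intro borel_measurable_continuous_on_indicator) auto
  then have m: "set_borel_measurable lebesgue {u<..<v} p"
    unfolding set_borel_measurable_def by (intro measurable_completion) auto
  obtain B where B: "\<And>x. x \<in> {u..v} \<Longrightarrow> cmod (p x) \<le> B"
    using continuous_on_norm_bound[OF p] by blast
  show ?thesis by (rule L2_on_bounded_mult[OF f m, where B=B]) (use B in auto)
qed

lemma L2_on_one: "L2_on {u<..<v} (\<lambda>x. 1)"
proof -
  have "set_integrable lebesgue {u<..<v} (\<lambda>x. 1::real)"
    by (rule set_integrable_subset[of _ "{u..v}"]) (auto intro: absolutely_integrable_continuous_real)
  then show ?thesis
    unfolding L2_on_def set_borel_measurable_def
    by (auto intro!: borel_measurable_scaleR borel_measurable_indicator)
qed

lemma L2_on_continuous: "continuous_on {u..v} p \<Longrightarrow> L2_on {u<..<v} p"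
  using L2_on_continuous_mult[OF L2_on_one, of u v p] by simp

lemma L2_on_cmult: "L2_on {u<..<v} f \<Longrightarrow> L2_on {u<..<v} (\<lambda>x. k * f x)"
  by (rule L2_on_continuous_mult) auto

lemma L2_on_uminus: "L2_on {u<..<v} f \<Longrightarrow> L2_on {u<..<v} (\<lambda>x. - f x)"
  using L2_on_cmult[of u v f "-1"] by simp

lemma L2_on_diff: "L2_on {u<..<v} f \<Longrightarrow> L2_on {u<..<v} g \<Longrightarrow> L2_on {u<..<v} (\<lambda>x. f x - g x)"
  using L2_on_add[OF _ L2_on_uminus, of u v f g] by simp

lemma L2_on_imp_absolutely_integrable_on:
  assumes "L2_on {u<..<v} f"
  shows "f absolutely_integrable_on {u..v}"
proof -
  have "set_integrable lebesgue {u<..<v} f"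
    using L2_on_integrable_mult_cnj[OF assms L2_on_one] by simp
  then show ?thesis
    by (rule absolutely_integrable_spike_set) (auto intro: negligible_subset[of "{u, v}"])
qed

lemma set_lebesgue_integral_open_interval:
  fixes f :: "real \<Rightarrow> complex"
  assumes "f absolutely_integrable_on {u..v}"
  shows "(LINT x:{u<..<v}|lebesgue. f x) = integral {u..v} f"
proof -
  have "f absolutely_integrable_on {u<..<v}"
    using assms by (rule set_integrable_subset) auto
  then show ?thesis
    using set_lebesgue_integral_eq_integral(2) integral_open_interval_real[of u v f] by metis
qed

section \<open>Criteria for absolute continuity\<close>

lemma ac_on_Lipschitz:
  fixes f :: "real \<Rightarrow> 'a::real_normed_vector"
  assumes "\<And>x y. \<lbrakk>x \<in> S; y \<in> S\<rbrakk> \<Longrightarrow> norm (f y - f x) \<le> B * \<bar>y - x\<bar>"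
  shows "ac_on S f"
proof -
  have id: "ac_on S (\<lambda>x. x)"
    unfolding ac_on_def
  proof (intro allI impI)
    fix \<epsilon> :: real assume "0 < \<epsilon>"
    then show "\<exists>\<delta>>0. \<forall>(n::nat) s t. (\<forall>i<n. s i \<in> S \<and> t i \<in> S \<and> s i \<le> t i) \<and>
     (\<forall>i<n. \<forall>j<n. i \<noteq> j \<longrightarrow> t i \<le> s j \<or> t j \<le> s i) \<and>
     (\<Sum>i<n. t i - s i) < \<delta> \<longrightarrow> (\<Sum>i<n. norm (t i - s i)) < \<epsilon>"
      by (intro exI[of _ \<epsilon>]) auto
  qed
  show ?thesis
  proof (rule ac_on_dominated[OF id id, where B="B / 2"])
    fix x y assume "x \<in> S" "y \<in> S"
    then show "norm (f y - f x) \<le> B / 2 * (norm (y - x) + norm (y - x))"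
      using assms by simp
  qed
qed

lemma ac_on_C1:
  fixes f :: "real \<Rightarrow> complex"
  assumes der: "\<And>x. x \<in> {u..v} \<Longrightarrow> (f has_vector_derivative f1 x) (at x within {u..v})"
    and cont: "continuous_on {u..v} f1"
  shows "ac_on {u..v} f"
proof -
  obtain B where B: "\<And>x. x \<in> {u..v} \<Longrightarrow> norm (f1 x) \<le> B"
    using continuous_on_norm_bound[OF cont] by blast
  show ?thesis
  proof (rule ac_on_Lipschitz[where B=B])
    fix x y assume xy: "x \<in> {u..v}" "y \<in> {u..v}"
    show "norm (f y - f x) \<le> B * \<bar>y - x\<bar>"
    proof (rule differentiable_bound[of "{u..v}" f "\<lambda>x h. h *\<^sub>R f1 x" B y x, unfolded real_norm_def])
      show "onorm (\<lambda>h. h *\<^sub>R f1 z) \<le> B" if "z \<in> {u..v}" for z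
        by (rule onorm_le) (use B[OF that] in \<open>auto simp: mult.commute[of B] intro!: mult_left_mono\<close>)
    qed (use der xy in \<open>auto simp: has_vector_derivative_def\<close>)
  qed
qed

lemma ac_on_mult_cnj:
  fixes f g :: "real \<Rightarrow> complex"
  assumes f: "ac_on {u..v} f" and g: "ac_on {u..v} g"
  shows "ac_on {u..v} (\<lambda>x. f x * cnj (g x))"
proof -
  have cont: "continuous_on {u..v} f" "continuous_on {u..v} g"
    using f g by (auto intro!: uniformly_continuous_imp_continuous ac_on_imp_uniformly_continuous_on)
  obtain A where A: "\<And>x. x \<in> {u..v} \<Longrightarrow> cmod (f x) \<le> A"
    using continuous_on_norm_bound[OF cont(1)] by blast
  obtain B where B: "\<And>x. x \<in> {u..v} \<Longrightarrow> cmod (g x) \<le> B"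
    using continuous_on_norm_bound[OF cont(2)] by blast
  show ?thesis
  proof (rule ac_on_dominated[OF f g, where B="\<bar>A\<bar> + \<bar>B\<bar>"])
    fix x y assume xy: "x \<in> {u..v}" "y \<in> {u..v}"
    have "f y * cnj (g y) - f x * cnj (g x) = (f y - f x) * cnj (g x) + f y * cnj (g y - g x)"
      by (simp add: algebra_simps)
    also have "norm \<dots> \<le> norm (f y - f x) * norm (g x) + norm (f y) * norm (g y - g x)"
      by (rule order_trans[OF norm_triangle_ineq]) (simp add: norm_mult flip: complex_cnj_diff)
    also have "\<dots> \<le> norm (f y - f x) * (\<bar>A\<bar> + \<bar>B\<bar>) + (\<bar>A\<bar> + \<bar>B\<bar>) * norm (g y - g x)"
      using A[OF xy(2)] B[OF xy(1)] by (intro add_mono mult_left_mono mult_right_mono) auto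
    finally show "norm (f y * cnj (g y) - f x * cnj (g x)) \<le> (\<bar>A\<bar> + \<bar>B\<bar>) * (norm (f y - f x) + norm (g y - g x))"
      by (simp add: algebra_simps)
  qed
qed

text \<open>The Sobolev space of order two over \<open>L2\<close> on \<open>[u, v]\<close>, with
  representatives made explicit: \<open>f1\<close> is the derivative everywhere, one-sided at the
  endpoints, whereas \<open>f2\<close> is an arbitrary representative of the second
  derivative.\<close>

definition sobolev2 :: "real \<Rightarrow> real \<Rightarrow> (real \<Rightarrow> complex) \<Rightarrow> (real \<Rightarrow> complex) \<Rightarrow> (real \<Rightarrow> complex) \<Rightarrow> bool" where
  "sobolev2 u v f f1 f2 \<longleftrightarrow>
     (\<forall>x\<in>{u..v}. (f has_vector_derivative f1 x) (at x within {u..v})) \<and>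
     ac_on {u..v} f1 \<and> L2_on {u<..<v} f2 \<and>
     (\<exists>N. negligible N \<and> (\<forall>x\<in>{u<..<v} - N. (f1 has_vector_derivative f2 x) (at x)))"

lemma sobolev2D:
  assumes "sobolev2 u v f f1 f2"
  shows "\<And>x. x \<in> {u..v} \<Longrightarrow> (f has_vector_derivative f1 x) (at x within {u..v})"
    "ac_on {u..v} f" "ac_on {u..v} f1" "L2_on {u<..<v} f2"
    "continuous_on {u..v} f" "continuous_on {u..v} f1"
proof -
  show 1: "\<And>x. x \<in> {u..v} \<Longrightarrow> (f has_vector_derivative f1 x) (at x within {u..v})"
    and 2: "ac_on {u..v} f1" and "L2_on {u<..<v} f2"
    using assms by (auto simp: sobolev2_def)
  show "continuous_on {u..v} f1"
    using ac_on_imp_uniformly_continuous_on[OF 2] by (rule uniformly_continuous_imp_continuous)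
  with 1 show 3: "ac_on {u..v} f" by (rule ac_on_C1)
  show "continuous_on {u..v} f"
    using ac_on_imp_uniformly_continuous_on[OF 3] by (rule uniformly_continuous_imp_continuous)
qed

text \<open>The Wronskian is absolutely continuous, and the products of first derivatives cancel in
  its derivative. The fundamental theorem then leaves only its values at the endpoints.\<close>

lemma sobolev2_green:
  assumes "u \<le> v" and f: "sobolev2 u v f f1 f2" and g: "sobolev2 u v g g1 g2"
  shows "(LINT x:{u<..<v}|lebesgue. f x * cnj (g2 x)) - (LINT x:{u<..<v}|lebesgue. f2 x * cnj (g x))
    = (f v * cnj (g1 v) - f1 v * cnj (g v)) - (f u * cnj (g1 u) - f1 u * cnj (g u))"
proof -
  define W where "W x = f x * cnj (g1 x) - f1 x * cnj (g x)" for x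
  have W: "ac_on {u..v} W"
    unfolding W_def using sobolev2D[OF f] sobolev2D[OF g] by (intro ac_on_diff ac_on_mult_cnj) auto
  obtain N M where N: "negligible N" "\<And>x. x \<in> {u<..<v} - N \<Longrightarrow> (f1 has_vector_derivative f2 x) (at x)"
    and M: "negligible M" "\<And>x. x \<in> {u<..<v} - M \<Longrightarrow> (g1 has_vector_derivative g2 x) (at x)"
    using f g by (auto simp: sobolev2_def)
  have der: "(W has_vector_derivative (f x * cnj (g2 x) - f2 x * cnj (g x))) (at x)"
    if x: "x \<in> {u<..<v} - (N \<union> M)" for x
  proof -
    have int: "at x within {u..v} = at x" using x by (intro at_within_interior) auto
    have *: "(f has_vector_derivative f1 x) (at x)" "(g has_vector_derivative g1 x) (at x)"
      using sobolev2D(1)[OF f, of x] sobolev2D(1)[OF g, of x] x unfolding int by auto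
    have "(W has_vector_derivative (f x * cnj (g2 x) + f1 x * cnj (g1 x) - (f1 x * cnj (g1 x) + f2 x * cnj (g x)))) (at x)"
      unfolding W_def using * N(2)[of x] M(2)[of x] x
      by (intro has_vector_derivative_diff has_vector_derivative_mult has_vector_derivative_cnj) auto
    then show ?thesis by simp
  qed
  note ftc = ac_on_fundamental_theorem[OF W \<open>u \<le> v\<close> negligible_Un[OF N(1) M(1)] der]
  have i1: "set_integrable lebesgue {u<..<v} (\<lambda>x. f x * cnj (g2 x))"
    using L2_on_integrable_mult_cnj[OF L2_on_continuous[OF sobolev2D(5)[OF f]] sobolev2D(4)[OF g]] .
  have i2: "set_integrable lebesgue {u<..<v} (\<lambda>x. f2 x * cnj (g x))"
    using L2_on_integrable_mult_cnj[OF sobolev2D(4)[OF f] L2_on_continuous[OF sobolev2D(5)[OF g]]] .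
  have "(LINT x:{u<..<v}|lebesgue. f x * cnj (g2 x)) - (LINT x:{u<..<v}|lebesgue. f2 x * cnj (g x))
     = (LINT x:{u<..<v}|lebesgue. f x * cnj (g2 x) - f2 x * cnj (g x))"
    using set_integral_diff(2)[OF i1 i2] by simp
  also have "\<dots> = integral {u..v} (\<lambda>x. f x * cnj (g2 x) - f2 x * cnj (g x))"
    using ftc(1) by (rule set_lebesgue_integral_open_interval)
  also have "\<dots> = W v - W u" using ftc(2)[of v] \<open>u \<le> v\<close> by simp
  finally show ?thesis by (simp add: W_def)
qed

text \<open>The initial value problem for \<open>f'' = h\<close>, solved by two integrations. Square
  integrability makes the first integral absolutely continuous; being continuous, it is the
  derivative of the second one up to the endpoints.\<close>

lemma sobolev2_of_L2:
  assumes h: "L2_on {u<..<v} h" and "u \<le> v"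
  obtains f f1 where "sobolev2 u v f f1 h" "f u = y0" "f1 u = y1"
proof -
  have int: "h absolutely_integrable_on {u..v}" by (rule L2_on_imp_absolutely_integrable_on[OF h])
  have int': "h integrable_on {u..v}" using int by (rule set_lebesgue_integral_eq_integral(1))
  have h2: "(\<lambda>x. (cmod (h x))\<^sup>2) integrable_on {u..v}"
    using h set_lebesgue_integral_eq_integral(1)[of "{u<..<v}" "\<lambda>x. (cmod (h x))\<^sup>2"]
    by (simp add: L2_on_def integrable_on_open_interval_real)
  define f1 where "f1 x = y1 + integral {u..x} h" for x
  define f where "f x = y0 + integral {u..x} f1" for x
  have f1: "\<And>x. x \<in> {u..v} \<Longrightarrow> integral {u..x} h = f1 x - f1 u"
    using \<open>u \<le> v\<close> by (simp add: f1_def)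
  have ac: "ac_on {u..v} f1" by (rule ac_on_indefinite_integral[OF int h2 f1])
  have cont: "continuous_on {u..v} f1"
    using ac_on_imp_uniformly_continuous_on[OF ac] by (rule uniformly_continuous_imp_continuous)
  have "sobolev2 u v f f1 h"
    unfolding sobolev2_def
  proof (intro conjI ballI ac h)
    fix x assume x: "x \<in> {u..v}"
    have "((\<lambda>x. y0 + integral {u..x} f1) has_vector_derivative 0 + f1 x) (at x within {u..v})"
      by (intro derivative_intros integral_has_vector_derivative cont x)
    then show "(f has_vector_derivative f1 x) (at x within {u..v})" by (simp add: f_def[abs_def])
  next
    show "\<exists>N. negligible N \<and> (\<forall>x\<in>{u<..<v} - N. (f1 has_vector_derivative h x) (at x))"
      using has_vector_derivative_of_density[OF int' f1] by metis
  qed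
  then show thesis by (rule that) (simp_all add: f_def f1_def)
qed

section \<open>Functions on the two halves\<close>


lemma at_within_interval_neq_bot:
  fixes u v x :: real
  assumes "{u<..<v} \<subseteq> S" "x \<in> {u..v}" "u < v"
  shows "at x within S \<noteq> bot"
proof -
  have "x islimpt S"
  proof (cases "x < v")
    case True
    then have "x islimpt {x<..<v}" by (rule islimpt_greaterThanLessThan1)
    then show ?thesis by (rule islimpt_subset) (use assms in auto)
  next
    case False
    then have "x = v" using assms by auto
    then show ?thesis using islimpt_greaterThanLessThan2[OF \<open>u < v\<close>] assms(1) islimpt_subset by blast
  qed
  then show ?thesis by (simp add: trivial_limit_within)
qed

lemma ac_on_subset: "ac_on T f \<Longrightarrow> S \<subseteq> T \<Longrightarrow> ac_on S f"
  using ac_on_compose_contraction[of T f "\<lambda>x. x" S] by (auto simp: mono_def)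

lemma ac_on_cong:
  assumes "ac_on S f" "\<And>x. x \<in> S \<Longrightarrow> g x = f x"
  shows "ac_on S g"
  by (rule ac_on_dominated[OF assms(1) assms(1), where B=1]) (simp add: assms(2))

text \<open>\<open>S\<close> stands for a half-open interval. \<open>f\<close> and its derivative
  within \<open>S\<close> are extended separately; in the interior the extensions are still function
  and derivative. Writing \<open>F\<close> as the integral of the continuous \<open>F1\<close>
  yields the one-sided derivatives at the endpoints.\<close>

lemma sobolev2_extension:
  assumes "u < v" and S: "{u<..<v} \<subseteq> S" "S \<subseteq> {u..v}"
    and diff: "\<And>x. x \<in> S \<Longrightarrow> f differentiable (at x within S)"
    and d: "\<And>x. x \<in> S \<Longrightarrow> d x = vector_derivative f (at x within S)"
    and acf: "ac_on S f" and acd: "ac_on S d"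
    and h: "L2_on {u<..<v} h" "\<And>x. x \<in> {u<..<v} \<Longrightarrow> h x = vector_derivative d (at x within S)"
  obtains F F1 where "sobolev2 u v F F1 h" "\<And>x. x \<in> S \<Longrightarrow> F x = f x" "\<And>x. x \<in> S \<Longrightarrow> F1 x = d x"
proof -
  obtain F where F: "ac_on {u..v} F" "\<And>x. x \<in> S \<Longrightarrow> F x = f x"
    using ac_on_extension[OF acf \<open>u < v\<close> S] by blast
  obtain F1 where F1: "ac_on {u..v} F1" "\<And>x. x \<in> S \<Longrightarrow> F1 x = d x"
    using ac_on_extension[OF acd \<open>u < v\<close> S] by blast
  have at: "at x within S = at x" if "x \<in> {u<..<v}" for x
    using that S(1) by (metis at_within_open_subset open_greaterThanLessThan)
  have transfer: "(k has_vector_derivative l) (at x)"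
    if "(j has_vector_derivative l) (at x)" "x \<in> {u<..<v}" "\<And>x. x \<in> S \<Longrightarrow> j x = k x" for j k l x
    by (rule has_vector_derivative_transform_within_open[OF that(1), of "{u<..<v}"]) (use that S(1) in auto)
  have derF: "(F has_vector_derivative F1 x) (at x)" if x: "x \<in> {u<..<v} - {}" for x
  proof -
    have "x \<in> S" using x S(1) by auto
    then have "(f has_vector_derivative d x) (at x within S)"
      using diff d by (simp add: vector_derivative_works)
    then have "(f has_vector_derivative d x) (at x)" using at x by simp
    then show ?thesis using transfer[of f "d x" x F] x F(2) F1(2)[OF \<open>x \<in> S\<close>] by simp
  qed
  have cont: "continuous_on {u..v} F1"
    using ac_on_imp_uniformly_continuous_on[OF F1(1)] by (rule uniformly_continuous_imp_continuous)
  have int: "\<And>x. x \<in> {u..v} \<Longrightarrow> integral {u..x} F1 = F x - F u"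
    using ac_on_fundamental_theorem(2)[OF F(1) less_imp_le[OF \<open>u < v\<close>] negligible_empty derF] by simp
  have "sobolev2 u v F F1 h"
    unfolding sobolev2_def
  proof (intro conjI ballI F1(1) h(1))
    fix x assume x: "x \<in> {u..v}"
    have "((\<lambda>x. F u + integral {u..x} F1) has_vector_derivative 0 + F1 x) (at x within {u..v})"
      by (intro derivative_intros integral_has_vector_derivative cont x)
    then have "((\<lambda>x. F u + integral {u..x} F1) has_vector_derivative F1 x) (at x within {u..v})" by simp
    then show "(F has_vector_derivative F1 x) (at x within {u..v})"
      by (rule has_vector_derivative_transform[OF x, rotated]) (simp add: int)
  next
    \<comment> \<open>\<open>h\<close> is given by \<open>vector_derivative\<close>, which means
      something only where \<open>d\<close> is differentiable. The density of \<open>F1\<close>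
      shows that this is so almost everywhere.\<close>
    obtain k where k: "k absolutely_integrable_on {u..v}" "\<And>x. x \<in> {u..v} \<Longrightarrow> integral {u..x} k = F1 x - F1 u"
      using ac_on_density[OF F1(1)] \<open>u < v\<close> by (metis less_imp_le)
    obtain N where N: "negligible N" "\<And>x. x \<in> {u<..<v} - N \<Longrightarrow> (F1 has_vector_derivative k x) (at x)"
      using has_vector_derivative_of_density[OF set_lebesgue_integral_eq_integral(1)[OF k(1)] k(2)] by blast
    have "(F1 has_vector_derivative h x) (at x)" if x: "x \<in> {u<..<v} - N" for x
    proof -
      have "(d has_vector_derivative k x) (at x)"
        using transfer[OF N(2)[OF x], of d] x F1(2) by simp
      then have "h x = k x"
        using h(2)[of x] at[of x] x by (simp add: vector_derivative_at)
      then show ?thesis using N(2)[OF x] by simp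
    qed
    with N(1) show "\<exists>N. negligible N \<and> (\<forall>x\<in>{u<..<v} - N. (F1 has_vector_derivative h x) (at x))"
      by blast
  qed
  then show thesis by (rule that) (use F F1 in auto)
qed

text \<open>The way back from the closed interval to the derivatives within \<open>S\<close> that
  occur in the domain. The second derivative returns only almost everywhere, and \<open>d\<close>
  need agree with \<open>F1\<close> on \<open>S\<close> only, which fits \<open>D1\<close> of a
  glued function.\<close>

lemma sobolev2_restriction:
  assumes "u < v" and S: "{u<..<v} \<subseteq> S" "S \<subseteq> {u..v}" and F: "sobolev2 u v F F1 h"
    and f: "\<And>x. x \<in> S \<Longrightarrow> f x = F x"
  shows "\<And>x. x \<in> S \<Longrightarrow> (f has_vector_derivative F1 x) (at x within S)"
    "\<And>x. x \<in> S \<Longrightarrow> vector_derivative f (at x within S) = F1 x"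
    "\<And>d. (\<And>x. x \<in> S \<Longrightarrow> d x = F1 x) \<Longrightarrow>
       AE x in lebesgue. x \<in> {u<..<v} \<longrightarrow> vector_derivative d (at x within S) = h x"
    "ac_on S f" "L2_on {u<..<v} f"
proof -
  show der: "(f has_vector_derivative F1 x) (at x within S)" if "x \<in> S" for x
  proof (rule has_vector_derivative_transform[OF that f])
    show "(F has_vector_derivative F1 x) (at x within S)"
      using sobolev2D(1)[OF F, of x] that S(2) by (meson has_vector_derivative_within_subset subsetD)
  qed
  show "vector_derivative f (at x within S) = F1 x" if "x \<in> S" for x
  proof -
    have "x \<in> {u..v}" using that S(2) by blast
    then show ?thesis
      using vector_derivative_within[OF at_within_interval_neq_bot[OF S(1) _ \<open>u < v\<close>] der[OF that]] by blast
  qed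
  show "AE x in lebesgue. x \<in> {u<..<v} \<longrightarrow> vector_derivative d (at x within S) = h x"
    if d: "\<And>x. x \<in> S \<Longrightarrow> d x = F1 x" for d
  proof -
    obtain N where N: "negligible N" "\<And>x. x \<in> {u<..<v} - N \<Longrightarrow> (F1 has_vector_derivative h x) (at x)"
      using F by (auto simp: sobolev2_def)
    have "vector_derivative d (at x within S) = h x" if x: "x \<in> {u<..<v} - N" for x
    proof -
      have "(d has_vector_derivative h x) (at x)"
        by (rule has_vector_derivative_transform_within_open[OF N(2)[OF x], of "{u<..<v}"]) (use x d S(1) in auto)
      moreover have "at x within S = at x"
        using x S(1) by (metis DiffD1 at_within_open_subset open_greaterThanLessThan)
      ultimately show ?thesis by (simp add: vector_derivative_at)
    qed
    moreover have "AE x in lebesgue. x \<notin> N"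
      using N(1) by (simp add: negligible_iff_null_sets AE_not_in)
    ultimately show ?thesis by (auto elim!: eventually_mono)
  qed
  show "ac_on S f"
    by (rule ac_on_cong[OF ac_on_subset[OF sobolev2D(2)[OF F] S(2)] f])
  show "L2_on {u<..<v} f"
    using L2_on_continuous[OF sobolev2D(5)[OF F]] L2_on_cong[of "{u<..<v}" f F] f S(1) by blast
qed

text \<open>Each half carries its own value and derivative at \<open>c\<close>, so one-sided limits
  become ordinary values of \<open>l\<close>, \<open>l1\<close>, \<open>r\<close>,
  \<open>r1\<close>. The value of \<open>f\<close> at \<open>c\<close> itself is left open.\<close>

definition glues :: "real \<Rightarrow> real \<Rightarrow> real \<Rightarrow> (real \<Rightarrow> complex) \<Rightarrow>
    (real \<Rightarrow> complex) \<Rightarrow> (real \<Rightarrow> complex) \<Rightarrow> (real \<Rightarrow> complex) \<Rightarrow>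
    (real \<Rightarrow> complex) \<Rightarrow> (real \<Rightarrow> complex) \<Rightarrow> (real \<Rightarrow> complex) \<Rightarrow> bool" where
  "glues a c b f l l1 l2 r r1 r2 \<longleftrightarrow> sobolev2 a c l l1 l2 \<and> sobolev2 c b r r1 r2 \<and>
     (\<forall>x\<in>{a..<c}. f x = l x) \<and> (\<forall>x\<in>{c<..b}. f x = r x)"

lemma continuous_on_tendsto_at_left:
  fixes g :: "real \<Rightarrow> complex"
  assumes "continuous_on {a..c} g" "a < c" "\<And>x. x \<in> {a..<c} \<Longrightarrow> f x = g x"
  shows "(f \<longlongrightarrow> g c) (at_left c)"
proof -
  have "(g \<longlongrightarrow> g c) (at_left c)"
    using assms(1,2) continuous_on_Icc_at_leftD by blast
  moreover have "\<forall>\<^sub>F x in at_left c. x \<in> {a<..<c}"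
    using \<open>a < c\<close> by (rule eventually_at_left_real)
  then have "\<forall>\<^sub>F x in at_left c. f x = g x"
    by eventually_elim (use assms(3) in auto)
  ultimately show ?thesis by (simp add: tendsto_cong)
qed

lemma continuous_on_tendsto_at_right:
  fixes g :: "real \<Rightarrow> complex"
  assumes "continuous_on {c..b} g" "c < b" "\<And>x. x \<in> {c<..b} \<Longrightarrow> f x = g x"
  shows "(f \<longlongrightarrow> g c) (at_right c)"
proof -
  have "(g \<longlongrightarrow> g c) (at_right c)"
    using assms(1,2) continuous_on_Icc_at_rightD by blast
  moreover have "\<forall>\<^sub>F x in at_right c. x \<in> {c<..<b}"
    using \<open>c < b\<close> by (rule eventually_at_right_real)
  then have "\<forall>\<^sub>F x in at_right c. f x = g x"
    by eventually_elim (use assms(3) in auto)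
  ultimately show ?thesis by (simp add: tendsto_cong)
qed

context
  fixes a b c :: real
  assumes ac: "a < c" and cb: "c < b"
begin

lemma D1_left: "x \<in> {a..<c} \<Longrightarrow> D1 a c b f x = vector_derivative f (at x within {a..<c})"
  by (simp add: D1_def)

lemma D1_right: "x \<in> {c<..b} \<Longrightarrow> D1 a c b f x = vector_derivative f (at x within {c<..b})"
  by (simp add: D1_def)

lemma left_half: "{a<..<c} \<subseteq> {a..<c}" "{a..<c} \<subseteq> {a..c}"
  by auto

lemma right_half: "{c<..<b} \<subseteq> {c<..b}" "{c<..b} \<subseteq> {c..b}"
  by auto

lemma glues_exists:
  assumes f: "pw_regular a c b f"
    and L2: "L2_on {a<..<c} (D1 a c b (D1 a c b f))" "L2_on {c<..<b} (D1 a c b (D1 a c b f))"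
  obtains l l1 r r1 where
    "glues a c b f l l1 (D1 a c b (D1 a c b f)) r r1 (D1 a c b (D1 a c b f))"
proof -
  obtain l l1 where l: "sobolev2 a c l l1 (D1 a c b (D1 a c b f))" "\<And>x. x \<in> {a..<c} \<Longrightarrow> l x = f x"
    by (rule sobolev2_extension[OF ac left_half _ _ _ _ L2(1), of f "D1 a c b f"])
       (use f D1_left in \<open>auto simp: pw_regular_def\<close>)
  obtain r r1 where r: "sobolev2 c b r r1 (D1 a c b (D1 a c b f))" "\<And>x. x \<in> {c<..b} \<Longrightarrow> r x = f x"
    by (rule sobolev2_extension[OF cb right_half _ _ _ _ L2(2), of f "D1 a c b f"])
       (use f D1_right in \<open>auto simp: pw_regular_def\<close>)
  show thesis
    using l r by (intro that[of l l1 r r1]) (auto simp: glues_def)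
qed

context
  fixes f l l1 l2 r r1 r2
  assumes g: "glues a c b f l l1 l2 r r1 r2"
begin

lemma glues_sobolev2: "sobolev2 a c l l1 l2" "sobolev2 c b r r1 r2"
  and glues_eq: "x \<in> {a..<c} \<Longrightarrow> f x = l x" "x \<in> {c<..b} \<Longrightarrow> f x = r x"
  using g by (auto simp: glues_def)

lemmas glues_left = sobolev2_restriction[OF ac left_half glues_sobolev2(1) glues_eq(1)]
lemmas glues_right = sobolev2_restriction[OF cb right_half glues_sobolev2(2) glues_eq(2)]

lemma glues_D1: "x \<in> {a..<c} \<Longrightarrow> D1 a c b f x = l1 x" "x \<in> {c<..b} \<Longrightarrow> D1 a c b f x = r1 x"
  using D1_left D1_right glues_left(2) glues_right(2) by simp_all

lemma glues_D1_D1: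
  "AE x in lebesgue. x \<in> {a<..<c} \<longrightarrow> D1 a c b (D1 a c b f) x = l2 x"
  "AE x in lebesgue. x \<in> {c<..<b} \<longrightarrow> D1 a c b (D1 a c b f) x = r2 x"
proof -
  have "AE x in lebesgue. x \<in> {a<..<c} \<longrightarrow> vector_derivative (D1 a c b f) (at x within {a..<c}) = l2 x"
    using glues_left(3)[OF _ glues_D1(1)] by simp
  then show "AE x in lebesgue. x \<in> {a<..<c} \<longrightarrow> D1 a c b (D1 a c b f) x = l2 x"
    by eventually_elim (use D1_left in auto)
  have "AE x in lebesgue. x \<in> {c<..<b} \<longrightarrow> vector_derivative (D1 a c b f) (at x within {c<..b}) = r2 x"
    using glues_right(3)[OF _ glues_D1(2)] by simp
  then show "AE x in lebesgue. x \<in> {c<..<b} \<longrightarrow> D1 a c b (D1 a c b f) x = r2 x"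
    by eventually_elim (use D1_right in auto)
qed

lemma glues_tendsto:
  "(f \<longlongrightarrow> l c) (at_left c)" "(D1 a c b f \<longlongrightarrow> l1 c) (at_left c)"
  "(f \<longlongrightarrow> r c) (at_right c)" "(D1 a c b f \<longlongrightarrow> r1 c) (at_right c)"
  using continuous_on_tendsto_at_left[OF sobolev2D(5)[OF glues_sobolev2(1)] ac glues_eq(1)]
    continuous_on_tendsto_at_left[OF sobolev2D(6)[OF glues_sobolev2(1)] ac glues_D1(1)]
    continuous_on_tendsto_at_right[OF sobolev2D(5)[OF glues_sobolev2(2)] cb glues_eq(2)]
    continuous_on_tendsto_at_right[OF sobolev2D(6)[OF glues_sobolev2(2)] cb glues_D1(2)]
  by simp_all

lemma glues_pw_regular: "pw_regular a c b f"
  unfolding pw_regular_def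
proof (intro conjI ballI)
  show "f differentiable (at x within {a..<c})" if "x \<in> {a..<c}" for x
    using glues_left(1)[OF _ that] by (auto simp: differentiable_def has_vector_derivative_def)
  show "f differentiable (at x within {c<..b})" if "x \<in> {c<..b}" for x
    using glues_right(1)[OF _ that] by (auto simp: differentiable_def has_vector_derivative_def)
  show "ac_on {a..<c} f" "ac_on {c<..b} f"
    using glues_left(4) glues_right(4) by simp_all
  show "ac_on {a..<c} (D1 a c b f)"
    by (rule ac_on_cong[OF ac_on_subset[OF sobolev2D(3)[OF glues_sobolev2(1)] left_half(2)] glues_D1(1)])
  show "ac_on {c<..b} (D1 a c b f)"
    by (rule ac_on_cong[OF ac_on_subset[OF sobolev2D(3)[OF glues_sobolev2(2)] right_half(2)] glues_D1(2)])
qed (use glues_tendsto in blast)+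

lemma glues_L2: "L2_on {a<..<c} f" "L2_on {c<..<b} f"
  using glues_left(5) glues_right(5) by simp_all

lemma glues_boundary:
  "tau1 a c b al10 al11 f = of_real al10 * l a + of_real al11 * l1 a"
  "tau_c a c b b0m b1m b0p b1p f
     = of_real b1m * l1 c + of_real b0m * l c + of_real b1p * r1 c + of_real b0p * r c"
  "Tb a c b al0 al1 f = of_real al0 * r b - of_real al1 * r1 b"
  using ac cb glues_eq glues_D1 glues_tendsto
  by (simp_all add: tau1_def tau_c_def Tb_def tendsto_Lim)

end

end

section \<open>Density\<close>


text \<open>Multiplication by \<open>\<psi>\<close> erases the value and derivative of an
  approximant at both endpoints. \<open>\<sigma>\<close> does so at \<open>u\<close> but preserves
  them at \<open>v\<close>, which allows prescribed data there to be added.\<close>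

definition cutoff_pair :: "real \<Rightarrow> real \<Rightarrow> (real \<Rightarrow> real) \<Rightarrow> (real \<Rightarrow> real) \<Rightarrow> bool" where
  "cutoff_pair u v \<psi> \<sigma> \<longleftrightarrow> polynomial_function \<psi> \<and> polynomial_function \<sigma> \<and>
     (\<forall>x\<in>{u..v}. \<psi> x \<in> {0..1} \<and> \<sigma> x \<in> {0..1}) \<and>
     \<psi> u = 0 \<and> \<psi> v = 0 \<and> \<sigma> u = 0 \<and> \<sigma> v = 1 \<and>
     (\<psi> has_real_derivative 0) (at u) \<and> (\<psi> has_real_derivative 0) (at v) \<and>
     (\<sigma> has_real_derivative 0) (at u) \<and> (\<sigma> has_real_derivative 0) (at v)"

text \<open>With \<open>s\<close> running from 0 to 1, \<open>A n\<close> has a double zero at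
  \<open>u\<close>, and \<open>R n\<close> equals 1 with zero derivative at \<open>u\<close> and has
  a double zero at \<open>v\<close>. The squares produce the double zeros; an exponent of at least 2
  makes the derivative of \<open>s ^ (n + 2)\<close> vanish at \<open>u\<close>. Both tend to 1 in
  the interior, so \<open>A n * R n\<close> and \<open>1 - R n\<close> are as required.\<close>

lemma cutoff_polynomials:
  fixes u v :: real
  assumes "u < v"
  shows "\<exists>\<psi> \<sigma>. (\<forall>n::nat. cutoff_pair u v (\<psi> n) (\<sigma> n)) \<and>
    (\<forall>x\<in>{u<..<v}. (\<lambda>n. \<psi> n x) \<longlonglongrightarrow> 1 \<and> (\<lambda>n. \<sigma> n x) \<longlonglongrightarrow> 0)"
proof -
  define s where "s x = (x - u) * (1 / (v - u))" for x
  define A where "A n x = (1 - (1 - s x) ^ (n + 2))\<^sup>2" for n x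
  define R where "R n x = (1 - s x ^ (n + 2))\<^sup>2" for n x
  have s_end: "s u = 0" "s v = 1" using assms by (auto simp: s_def)
  have s01: "0 \<le> s x" "s x \<le> 1" if "x \<in> {u..v}" for x
    using that assms by (auto simp: s_def field_simps)
  have s_strict: "0 < s x" "s x < 1" if "x \<in> {u<..<v}" for x
    using that assms by (auto simp: s_def field_simps)
  have poly_s: "polynomial_function s"
    unfolding s_def by (intro polynomial_function_mult[where 'b=real, unfolded real_scaleR_def] polynomial_function_diff polynomial_function_id polynomial_function_const)
  have pow01: "0 \<le> (1 - t ^ k)\<^sup>2" "(1 - t ^ k)\<^sup>2 \<le> 1" if "0 \<le> t" "t \<le> 1" for t :: real and k :: nat
    using that by (auto intro!: power_le_one simp: power_le_one)
  have lim1: "(\<lambda>n. (1 - t ^ (n + 2))\<^sup>2) \<longlonglongrightarrow> 1" if "0 \<le> t" "t < 1" for t :: real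
  proof -
    have "(\<lambda>n. t ^ (n + 2)) \<longlonglongrightarrow> 0"
      using LIMSEQ_ignore_initial_segment[OF LIMSEQ_realpow_zero[OF that], of 2] .
    then have "(\<lambda>n. (1 - t ^ (n + 2))\<^sup>2) \<longlonglongrightarrow> (1 - 0)\<^sup>2" by (intro tendsto_intros)
    then show ?thesis by simp
  qed
  define e where "e = 1 / (v - u)"
  have ds: "(s has_real_derivative e) (at x)" for x
    unfolding s_def e_def using assms by (auto intro!: derivative_eq_intros)
  have ds': "((\<lambda>x. 1 - s x) has_real_derivative - e) (at x)" for x
    using DERIV_diff[OF DERIV_const ds, of 1] by simp
  have dpow: "((\<lambda>x. (1 - \<phi> x ^ (n + 2))\<^sup>2) has_real_derivative
      2 * (1 - \<phi> x ^ (n + 2)) * (- (real (n + 2) * (d * \<phi> x ^ (n + 1))))) (at x)"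
    if "(\<phi> has_real_derivative d) (at x)" for \<phi> d x and n :: nat
  proof -
    have "((\<lambda>x. 1 - \<phi> x ^ (n + 2)) has_real_derivative 0 - real (n + 2) * (d * \<phi> x ^ (n + 2 - Suc 0))) (at x)"
      by (intro DERIV_diff DERIV_const DERIV_power that)
    from DERIV_power[OF this, of 2] show ?thesis
      by (simp add: algebra_simps)
  qed
  have derA: "(A n has_real_derivative 0) (at u)" for n
    using dpow[OF ds'[of u], of n] by (simp add: A_def[abs_def] s_end)
  have derR: "(R n has_real_derivative 0) (at u)" "(R n has_real_derivative 0) (at v)" for n
    using dpow[OF ds[of u], of n] dpow[OF ds[of v], of n] by (simp_all add: R_def[abs_def] s_end)
  have Rend: "R n u = 1" "R n v = 0" "A n u = 0" for n
    by (auto simp: R_def A_def s_end)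
  have derA': "\<exists>d. (A n has_real_derivative d) (at v)" for n
    unfolding A_def using dpow[OF ds'[of v], of n] by blast
  have derAR: "((\<lambda>x. A n x * R n x) has_real_derivative 0) (at u)" 
     "((\<lambda>x. A n x * R n x) has_real_derivative 0) (at v)" for n
  proof -
    show "((\<lambda>x. A n x * R n x) has_real_derivative 0) (at u)"
      using DERIV_mult[OF derA derR(1), of n n] by (simp add: Rend)
    obtain d where "(A n has_real_derivative d) (at v)" using derA' by blast
    from DERIV_mult[OF this derR(2), of n] show "((\<lambda>x. A n x * R n x) has_real_derivative 0) (at v)"
      by (simp add: Rend)
  qed
  have der1R: "((\<lambda>x. 1 - R n x) has_real_derivative 0) (at u)" 
     "((\<lambda>x. 1 - R n x) has_real_derivative 0) (at v)" for n
    using DERIV_diff[OF DERIV_const derR(1), of 1 n] DERIV_diff[OF DERIV_const derR(2), of 1 n] by simp_all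
  have polyA: "polynomial_function (A n)" and polyR: "polynomial_function (R n)" for n
  proof -
    have s: "real_polynomial_function s" using poly_s by (simp add: real_polynomial_function_eq)
    have c: "real_polynomial_function (\<lambda>x. 1)" by (simp add: real_polynomial_function_eq)
    note rp = real_polynomial_function_power real_polynomial_function_diff
    have "real_polynomial_function (A n)"
      unfolding A_def by (rule rp(1)[OF rp(2)[OF c rp(1)[OF rp(2)[OF c s]]]])
    moreover have "real_polynomial_function (R n)"
      unfolding R_def by (rule rp(1)[OF rp(2)[OF c rp(1)[OF s]]])
    ultimately show "polynomial_function (A n)" "polynomial_function (R n)"
      by (simp_all add: real_polynomial_function_eq)
  qed
  have cut: "cutoff_pair u v (\<lambda>x. A n x * R n x) (\<lambda>x. 1 - R n x)" for n
    unfolding cutoff_pair_def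
  proof (intro conjI ballI)
    show "polynomial_function (\<lambda>x. A n x * R n x)"
      using polynomial_function_mult[OF polyA polyR] by simp
    show "polynomial_function (\<lambda>x. 1 - R n x)"
      by (intro polynomial_function_diff polynomial_function_const polyR)
    fix x assume x: "x \<in> {u..v}"
    have 01: "0 \<le> A n x" "A n x \<le> 1" "0 \<le> R n x" "R n x \<le> 1"
      using pow01[of "1 - s x" "n + 2", folded A_def] pow01[of "s x" "n + 2", folded R_def] s01[OF x] by simp_all
    show "A n x * R n x \<in> {0..1}"
      using 01 by (auto intro: mult_le_one)
    show "1 - R n x \<in> {0..1}" using 01 by auto
  qed (use derAR der1R Rend in simp_all)
  have lim: "(\<lambda>n. A n x * R n x) \<longlonglongrightarrow> 1 \<and> (\<lambda>n. 1 - R n x) \<longlonglongrightarrow> 0" if x: "x \<in> {u<..<v}" for x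
  proof -
    have A: "(\<lambda>n. A n x) \<longlonglongrightarrow> 1" and R: "(\<lambda>n. R n x) \<longlonglongrightarrow> 1"
      using lim1[of "1 - s x", folded A_def] lim1[of "s x", folded R_def] s_strict[OF x] by simp_all
    show ?thesis using tendsto_mult[OF A R] tendsto_diff[OF tendsto_const R, of 1] by simp
  qed
  define \<psi> where "\<psi> n x = A n x * R n x" for n x
  define \<sigma> where "\<sigma> n x = 1 - R n x" for n x
  have "\<forall>n. cutoff_pair u v (\<psi> n) (\<sigma> n)"
    unfolding \<psi>_def \<sigma>_def by (intro allI cut)
  moreover have "\<forall>x\<in>{u<..<v}. (\<lambda>n. \<psi> n x) \<longlonglongrightarrow> 1 \<and> (\<lambda>n. \<sigma> n x) \<longlonglongrightarrow> 0"
    unfolding \<psi>_def \<sigma>_def by (intro ballI lim)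
  ultimately show ?thesis by (intro exI conjI)
qed

lemma sobolev2_polynomial_function:
  fixes f :: "real \<Rightarrow> complex"
  assumes "polynomial_function f"
  obtains f1 f2 where "sobolev2 u v f f1 f2" "\<And>x. (f has_vector_derivative f1 x) (at x)"
proof -
  obtain f1 where f1: "polynomial_function f1" "\<And>x. (f has_vector_derivative f1 x) (at x)"
    using has_vector_derivative_polynomial_function[OF assms] by blast
  obtain f2 where f2: "polynomial_function f2" "\<And>x. (f1 has_vector_derivative f2 x) (at x)"
    using has_vector_derivative_polynomial_function[OF f1(1)] by blast
  have cont: "continuous_on {u..v} f2" using f2(1) by (rule continuous_on_polymonial_function)
  have "sobolev2 u v f f1 f2"
    unfolding sobolev2_def
  proof (intro conjI ballI)
    show "(f has_vector_derivative f1 x) (at x within {u..v})" for x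
      using f1(2) by (rule has_vector_derivative_at_within)
    show "ac_on {u..v} f1"
      using has_vector_derivative_at_within[OF f2(2)] cont by (rule ac_on_C1)
    show "L2_on {u<..<v} f2" using cont by (rule L2_on_continuous)
    show "\<exists>N. negligible N \<and> (\<forall>x\<in>{u<..<v} - N. (f1 has_vector_derivative f2 x) (at x))"
      using f2(2) negligible_empty by blast
  qed
  then show thesis using f1(2) by (rule that)
qed

text \<open>A measurable function is an almost everywhere limit of continuous ones. Nearest-point
  projection onto the ball of radius \<open>M\<close> is continuous and fixes the values of
  \<open>g\<close>, so it adds the uniform bound that dominated convergence needs.\<close>

lemma bounded_measurable_continuous_approx:
  fixes g :: "real \<Rightarrow> complex"
  assumes g: "g \<in> borel_measurable lebesgue" and M: "\<And>x. cmod (g x) \<le> M" "0 < M"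
  obtains k where "\<And>n::nat. continuous_on UNIV (k n)" "\<And>n x. cmod (k n x) \<le> M"
    "AE x in lebesgue. (\<lambda>n. k n x) \<longlonglongrightarrow> g x"
proof -
  have "g measurable_on UNIV"
    using g lebesgue_measurable_imp_measurable_on[of g UNIV] by (simp add: lebesgue_on_UNIV_eq)
  then obtain N h where N: "negligible N" and h: "\<And>n. continuous_on UNIV (h n)"
    "\<And>x. x \<notin> N \<Longrightarrow> (\<lambda>n. h n x) \<longlonglongrightarrow> g x"
    unfolding measurable_on_def by auto
  define clip where "clip z = closest_point (cball 0 M) z" for z :: complex
  have ne: "cball (0::complex) M \<noteq> {}" using M by simp
  have clip_cont: "continuous_on UNIV clip"
    unfolding clip_def using ne by (intro continuous_on_closest_point) auto
  have clip_in: "cmod (clip z) \<le> M" for z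
    using closest_point_in_set[OF closed_cball ne, of z] by (simp add: clip_def)
  have clip_id: "clip (g x) = g x" for x
    unfolding clip_def using M by (intro closest_point_self) auto
  show thesis
  proof
    show "continuous_on UNIV (\<lambda>x. clip (h n x))" for n
      by (rule continuous_on_compose2[OF clip_cont h(1)]) auto
    show "cmod (clip (h n x)) \<le> M" for n x by (rule clip_in)
    have "AE x in lebesgue. x \<notin> N"
      using N by (simp add: negligible_iff_null_sets AE_not_in)
    then show "AE x in lebesgue. (\<lambda>n. clip (h n x)) \<longlonglongrightarrow> g x"
    proof eventually_elim
      case (elim x)
      have "(\<lambda>n. clip (h n x)) \<longlonglongrightarrow> clip (g x)"
        by (rule continuous_on_tendsto_compose[OF clip_cont h(2)[OF elim]]) auto
      then show ?case by (simp add: clip_id)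
    qed
  qed
qed

text \<open>Values and derivatives at endpoints are not continuous in the \<open>L2\<close> norm, so
  they can be prescribed at no cost. Polynomials approximate the continuous \<open>k n\<close>
  uniformly, and the cutoffs correct their boundary data; the corrected \<open>F n\<close> stay
  uniformly bounded and converge almost everywhere, hence in \<open>L2\<close>.\<close>

lemma L2_dense_sobolev2_bounded:
  fixes g :: "real \<Rightarrow> complex"
  assumes "u < v" and g: "g \<in> borel_measurable lebesgue" and M: "\<And>x. cmod (g x) \<le> M" "0 < M" and "0 < \<epsilon>"
  shows "\<exists>f f1 f2. sobolev2 u v f f1 f2 \<and> f u = 0 \<and> f1 u = 0 \<and> f v = y0 \<and> f1 v = y1 \<and>
    (LINT x:{u<..<v}|lebesgue. (cmod (g x - f x))\<^sup>2) < \<epsilon>"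
proof -
  obtain k where k: "\<And>n::nat. continuous_on UNIV (k n)" "\<And>n x. cmod (k n x) \<le> M"
    "AE x in lebesgue. (\<lambda>n. k n x) \<longlonglongrightarrow> g x"
    using bounded_measurable_continuous_approx[OF g M] by blast
  have "\<exists>p. polynomial_function p \<and> (\<forall>x\<in>{u..v}. norm (k n x - p x) < 1 / real (Suc n))" for n
    using k(1)[of n] by (intro Stone_Weierstrass_polynomial_function) (auto intro: continuous_on_subset)
  then have "\<exists>p. \<forall>n. polynomial_function (p n) \<and> (\<forall>x\<in>{u..v}. norm (k n x - p n x) < 1 / real (Suc n))"
    by (intro choice allI)
  then obtain p where p': "\<forall>n. polynomial_function (p n) \<and> (\<forall>x\<in>{u..v}. norm (k n x - p n x) < 1 / real (Suc n))"
    by (elim exE)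
  then have p: "polynomial_function (p n)" "x \<in> {u..v} \<Longrightarrow> norm (k n x - p n x) < 1 / real (Suc n)" for n x
    by blast+
  obtain \<psi> \<sigma> :: "nat \<Rightarrow> real \<Rightarrow> real" where \<psi>\<sigma>: "\<forall>n. cutoff_pair u v (\<psi> n) (\<sigma> n)"
    and lim: "\<forall>x\<in>{u<..<v}. (\<lambda>n. \<psi> n x) \<longlonglongrightarrow> 1 \<and> (\<lambda>n. \<sigma> n x) \<longlonglongrightarrow> 0"
    using cutoff_polynomials[OF \<open>u < v\<close>] by (elim exE conjE)
  have poly: "polynomial_function (\<psi> n)" "polynomial_function (\<sigma> n)"
    and val: "\<psi> n u = 0" "\<psi> n v = 0" "\<sigma> n u = 0" "\<sigma> n v = 1"
    and der: "(\<psi> n has_real_derivative 0) (at u)" "(\<psi> n has_real_derivative 0) (at v)"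
    "(\<sigma> n has_real_derivative 0) (at u)" "(\<sigma> n has_real_derivative 0) (at v)" for n
    using \<psi>\<sigma>[rule_format, of n] by (simp_all add: cutoff_pair_def)
  have bd: "\<psi> n x \<in> {0..1}" "\<sigma> n x \<in> {0..1}" if "x \<in> {u..v}" for n x
    using \<psi>\<sigma>[rule_format, of n] that unfolding cutoff_pair_def by blast+
  \<comment> \<open>The affine function with value \<open>y0\<close> and derivative
    \<open>y1\<close> at \<open>v\<close>.\<close>
  define l where "l x = y0 + (x - v) *\<^sub>R y1" for x
  have poly_l: "polynomial_function l"
    unfolding l_def by (intro polynomial_function_add polynomial_function_mult polynomial_function_diff
        polynomial_function_const polynomial_function_id)
  have der_l: "(l has_vector_derivative y1) (at x)" for x
  proof -
    have "(l has_vector_derivative (0 + ((x - v) *\<^sub>R 0 + (1 - 0) *\<^sub>R y1))) (at x)"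
      unfolding l_def
      by (intro has_vector_derivative_add has_vector_derivative_const has_vector_derivative_scaleR
          DERIV_diff DERIV_ident DERIV_const)
    then show ?thesis by simp
  qed
  define F where "F n x = \<psi> n x *\<^sub>R p n x + \<sigma> n x *\<^sub>R l x" for n x
  have polyF: "polynomial_function (F n)" for n
    unfolding F_def by (intro polynomial_function_add polynomial_function_mult poly p poly_l)
  have derF: "(F n has_vector_derivative 0) (at u)" "(F n has_vector_derivative y1) (at v)" for n
  proof -
    obtain p' where p': "\<And>x. (p n has_vector_derivative p' x) (at x)"
      using has_vector_derivative_polynomial_function[OF p(1)] by blast
    have "(F n has_vector_derivative ((\<psi> n z *\<^sub>R p' z + 0 *\<^sub>R p n z) + (\<sigma> n z *\<^sub>R y1 + 0 *\<^sub>R l z))) (at z)"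
      if "z = u \<or> z = v" for z
      unfolding F_def
      using der[of n] that
      by (intro has_vector_derivative_add has_vector_derivative_scaleR p' der_l) auto
    from this[of u] this[of v] show "(F n has_vector_derivative 0) (at u)" "(F n has_vector_derivative y1) (at v)"
      by (simp_all add: val)
  qed
  have F_end: "F n u = 0" "F n v = y0" for n
    by (simp_all add: F_def val l_def)
  have "continuous_on {u..v} l" using poly_l by (rule continuous_on_polymonial_function)
  then obtain B where B: "\<And>x. x \<in> {u..v} \<Longrightarrow> norm (l x) \<le> B"
    using continuous_on_norm_bound by blast
  have F_bound: "norm (F n x) \<le> (M + 1) + B" if x: "x \<in> {u..v}" for n x
  proof -
    have "norm (p n x) \<le> norm (k n x) + norm (k n x - p n x)"
      using norm_triangle_sub[of "p n x" "k n x"] by (simp add: norm_minus_commute)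
    also have "\<dots> \<le> M + 1"
    proof -
      have "1 / real (Suc n) \<le> 1" by simp
      then show ?thesis using k(2)[of n x] p(2)[OF x, of n] by linarith
    qed
    finally have P: "norm (p n x) \<le> M + 1" .
    have "norm (F n x) \<le> \<bar>\<psi> n x\<bar> * norm (p n x) + \<bar>\<sigma> n x\<bar> * norm (l x)"
      unfolding F_def by (rule order_trans[OF norm_triangle_ineq]) simp
    also have "\<dots> \<le> 1 * (M + 1) + 1 * B"
      using bd[OF x, of n] P B[OF x] M by (intro add_mono mult_mono) auto
    finally show ?thesis by simp
  qed
  have F_lim: "AE x in lebesgue. x \<in> {u<..<v} \<longrightarrow> (\<lambda>n. F n x) \<longlonglongrightarrow> g x"
    using k(3)
  proof eventually_elim
    case (elim x)
    show ?case
    proof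
      assume x: "x \<in> {u<..<v}"
      have "(\<lambda>n. k n x - p n x) \<longlonglongrightarrow> 0"
      proof (rule Lim_null_comparison[OF _ LIMSEQ_inverse_real_of_nat])
        show "\<forall>\<^sub>F n in sequentially. norm (k n x - p n x) \<le> inverse (real (Suc n))"
          using p(2)[of x] x by (intro always_eventually allI) (simp add: inverse_eq_divide less_imp_le)
      qed
      from tendsto_diff[OF elim this] have "(\<lambda>n. p n x) \<longlonglongrightarrow> g x" by simp
      then have "(\<lambda>n. F n x) \<longlonglongrightarrow> 1 *\<^sub>R g x + 0 *\<^sub>R l x"
        unfolding F_def using lim x by (intro tendsto_intros) auto
      then show "(\<lambda>n. F n x) \<longlonglongrightarrow> g x" by simp
    qed
  qed
  have F_meas: "F n \<in> borel_measurable lebesgue" for n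
    using continuous_on_polymonial_function[OF polyF, of UNIV n]
    by (intro measurable_completion) (simp add: borel_measurable_continuous_onI)
  \<comment> \<open>\<open>M\<close> bounds \<open>g\<close>; \<open>M + 1\<close> bounds the
    polynomials, whose uniform error is at most 1; \<open>B\<close> bounds the affine
    correction.\<close>
  define C where "C = M + (M + 1) + B"
  have "(\<lambda>n. \<integral>x. indicat_real {u<..<v} x *\<^sub>R (cmod (g x - F n x))\<^sup>2 \<partial>lebesgue) \<longlonglongrightarrow> (\<integral>x. 0 \<partial>(lebesgue :: real measure))"
  proof (rule integral_dominated_convergence[where w="\<lambda>x. indicat_real {u<..<v} x *\<^sub>R C\<^sup>2"])
    show "(\<lambda>x. indicat_real {u<..<v} x *\<^sub>R (cmod (g x - F n x))\<^sup>2) \<in> borel_measurable lebesgue" for n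
      using F_meas[of n] g by (intro borel_measurable_scaleR borel_measurable_indicator borel_measurable_power
          borel_measurable_norm borel_measurable_diff) auto
    have "set_integrable lebesgue {u<..<v} (\<lambda>x. C\<^sup>2)"
      by (rule set_integrable_subset[of _ "{u..v}"]) (auto intro: absolutely_integrable_continuous_real)
    then show "integrable lebesgue (\<lambda>x. indicat_real {u<..<v} x *\<^sub>R C\<^sup>2)"
      by (simp add: set_integrable_def)
    show "AE x in lebesgue. (\<lambda>n. indicat_real {u<..<v} x *\<^sub>R (cmod (g x - F n x))\<^sup>2) \<longlonglongrightarrow> 0"
      using F_lim
    proof eventually_elim
      case (elim x)
      show ?case
      proof (cases "x \<in> {u<..<v}")
        case True
        then have "(\<lambda>n. (cmod (g x - F n x))\<^sup>2) \<longlonglongrightarrow> (cmod (g x - g x))\<^sup>2"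
          using elim by (intro tendsto_intros) auto
        then show ?thesis using True by simp
      qed simp
    qed
    show "AE x in lebesgue. norm (indicat_real {u<..<v} x *\<^sub>R (cmod (g x - F n x))\<^sup>2) \<le> indicat_real {u<..<v} x *\<^sub>R C\<^sup>2" for n
    proof (intro AE_I2)
      fix x :: real
      show "norm (indicat_real {u<..<v} x *\<^sub>R (cmod (g x - F n x))\<^sup>2) \<le> indicat_real {u<..<v} x *\<^sub>R C\<^sup>2"
      proof (cases "x \<in> {u<..<v}")
        case True
        have "cmod (g x - F n x) \<le> C"
          using norm_triangle_ineq4[of "g x" "F n x"] M(1)[of x] F_bound[of x n] True by (simp add: C_def)
        then show ?thesis using True by (simp add: power_mono)
      qed simp
    qed
  qed simp
  then have "(\<lambda>n. LINT x:{u<..<v}|lebesgue. (cmod (g x - F n x))\<^sup>2) \<longlonglongrightarrow> 0"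
    by (simp add: set_lebesgue_integral_def)
  then have "\<forall>\<^sub>F n in sequentially. (LINT x:{u<..<v}|lebesgue. (cmod (g x - F n x))\<^sup>2) < \<epsilon>"
    using \<open>0 < \<epsilon>\<close> by (rule order_tendstoD(2))
  then obtain n where n: "(LINT x:{u<..<v}|lebesgue. (cmod (g x - F n x))\<^sup>2) < \<epsilon>"
    by (auto simp: eventually_sequentially)
  obtain f1 f2 where f: "sobolev2 u v (F n) f1 f2" "\<And>x. (F n has_vector_derivative f1 x) (at x)"
    using sobolev2_polynomial_function[OF polyF] by blast
  have "f1 u = 0" "f1 v = y1"
    using vector_derivative_unique_at[OF f(2) derF(1)] vector_derivative_unique_at[OF f(2) derF(2)] by auto
  with f(1) show ?thesis using F_end[of n] n by blast
qed

lemma L2_dense_sobolev2: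
  assumes "u < v" and g: "L2_on {u<..<v} g" and "0 < \<epsilon>"
  shows "\<exists>f f1 f2. sobolev2 u v f f1 f2 \<and> f u = 0 \<and> f1 u = 0 \<and> f v = y0 \<and> f1 v = y1 \<and>
    (LINT x:{u<..<v}|lebesgue. (cmod (g x - f x))\<^sup>2) < \<epsilon>"
proof -
  define S where "S = {u<..<v}"
  define G where "G x = indicat_real S x *\<^sub>R g x" for x
  have G [measurable]: "G \<in> borel_measurable lebesgue"
    using g unfolding G_def[abs_def] S_def by (simp add: L2_on_def set_borel_measurable_def)
  \<comment> \<open>Truncation to a bounded function; the height \<open>Suc n\<close> is positive
    also for \<open>n = 0\<close>, as the bounded case demands. Truncation and approximation each
    get an error below \<open>\<epsilon> / 4\<close>, because the square of a sum costs a factor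
    2.\<close>
  define T where "T n x = (if cmod (G x) \<le> real (Suc n) then G x else 0)" for n x
  have T [measurable]: "T n \<in> borel_measurable lebesgue" for n
    unfolding T_def by measurable
  have intG: "integrable lebesgue (\<lambda>x. (cmod (G x))\<^sup>2)"
  proof -
    have "(\<lambda>x. (cmod (G x))\<^sup>2) = (\<lambda>x. indicat_real S x *\<^sub>R (cmod (g x))\<^sup>2)"
      by (auto simp: G_def indicator_def)
    then show ?thesis using g by (simp add: L2_on_def set_integrable_def S_def)
  qed
  have "(\<lambda>n. \<integral>x. (cmod (G x - T n x))\<^sup>2 \<partial>lebesgue) \<longlonglongrightarrow> (\<integral>x. 0 \<partial>(lebesgue :: real measure))"
  proof (rule integral_dominated_convergence[where w="\<lambda>x. (cmod (G x))\<^sup>2"])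
    show "AE x in lebesgue. (\<lambda>n. (cmod (G x - T n x))\<^sup>2) \<longlonglongrightarrow> 0"
    proof (intro AE_I2 tendsto_eventually)
      fix x
      obtain m where "cmod (G x) \<le> real m" using real_arch_simple by blast
      then have "T n x = G x" if "m \<le> n" for n
        using that by (simp add: T_def)
      then show "\<forall>\<^sub>F n in sequentially. (cmod (G x - T n x))\<^sup>2 = 0"
        unfolding eventually_sequentially by (intro exI[of _ m]) simp
    qed
    show "AE x in lebesgue. norm ((cmod (G x - T n x))\<^sup>2) \<le> (cmod (G x))\<^sup>2" for n
      by (intro AE_I2) (simp add: T_def)
  qed (use intG in simp_all)
  then have "(\<lambda>n. \<integral>x. (cmod (G x - T n x))\<^sup>2 \<partial>lebesgue) \<longlonglongrightarrow> 0" by simp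
  then have "\<forall>\<^sub>F n in sequentially. (\<integral>x. (cmod (G x - T n x))\<^sup>2 \<partial>lebesgue) < \<epsilon> / 4"
    using \<open>0 < \<epsilon>\<close> by (intro order_tendstoD(2)) auto
  then obtain n where n: "(\<integral>x. (cmod (G x - T n x))\<^sup>2 \<partial>lebesgue) < \<epsilon> / 4"
    by (auto simp: eventually_sequentially)
  have Tb: "cmod (T n x) \<le> real (Suc n)" for x by (simp add: T_def)
  have Suc_pos: "0 < real (Suc n)" by simp
  have "0 < \<epsilon> / 4" using \<open>0 < \<epsilon>\<close> by simp
  obtain f f1 f2 where f: "sobolev2 u v f f1 f2" "f u = 0" "f1 u = 0" "f v = y0" "f1 v = y1"
    "(LINT x:S|lebesgue. (cmod (T n x - f x))\<^sup>2) < \<epsilon> / 4"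
    using L2_dense_sobolev2_bounded[OF \<open>u < v\<close> T Tb Suc_pos \<open>0 < \<epsilon> / 4\<close>, of y0 y1]
    unfolding S_def by (elim exE conjE) auto
  have i1: "integrable lebesgue (\<lambda>x. (cmod (G x - T n x))\<^sup>2)"
    by (rule Bochner_Integration.integrable_bound[OF intG]) (auto simp: T_def)
  have L2f: "L2_on S f" unfolding S_def by (rule L2_on_continuous[OF sobolev2D(5)[OF f(1)]])
  have [measurable]: "S \<in> sets lebesgue" by (simp add: S_def)
  have "L2_on S (T n)"
    unfolding L2_on_def set_borel_measurable_def set_integrable_def
  proof
    show "(\<lambda>x. indicat_real S x *\<^sub>R T n x) \<in> borel_measurable lebesgue" by measurable
    show "integrable lebesgue (\<lambda>x. indicat_real S x *\<^sub>R (cmod (T n x))\<^sup>2)"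
    proof (rule Bochner_Integration.integrable_bound[OF intG])
      show "(\<lambda>x. indicat_real S x *\<^sub>R (cmod (T n x))\<^sup>2) \<in> borel_measurable lebesgue" by measurable
    qed (auto simp: T_def indicator_def)
  qed
  from L2_on_diff[OF this[unfolded S_def] L2f[unfolded S_def]]
  have i2: "integrable lebesgue (\<lambda>x. indicat_real S x *\<^sub>R (cmod (T n x - f x))\<^sup>2)"
    by (simp add: L2_on_def set_integrable_def S_def)
  have i3: "integrable lebesgue (\<lambda>x. indicat_real S x *\<^sub>R (cmod (g x - f x))\<^sup>2)"
    using L2_on_diff[OF g L2f[unfolded S_def]] by (simp add: L2_on_def set_integrable_def S_def)
  have "(LINT x:S|lebesgue. (cmod (g x - f x))\<^sup>2)
      \<le> (\<integral>x. 2 * (cmod (G x - T n x))\<^sup>2 + 2 * (indicat_real S x *\<^sub>R (cmod (T n x - f x))\<^sup>2) \<partial>lebesgue)"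
    unfolding set_lebesgue_integral_def
  proof (rule integral_mono[OF i3])
    fix x :: real
    show "indicat_real S x *\<^sub>R (cmod (g x - f x))\<^sup>2
      \<le> 2 * (cmod (G x - T n x))\<^sup>2 + 2 * (indicat_real S x *\<^sub>R (cmod (T n x - f x))\<^sup>2)"
    proof (cases "x \<in> S")
      case True
      have "(cmod (g x - f x))\<^sup>2 \<le> (cmod (G x - T n x) + cmod (T n x - f x))\<^sup>2"
        using norm_triangle_ineq[of "G x - T n x" "T n x - f x"] True
        by (intro power_mono) (auto simp: G_def)
      also have "\<dots> \<le> 2 * (cmod (G x - T n x))\<^sup>2 + 2 * (cmod (T n x - f x))\<^sup>2"
        using sum_squares_bound[of "cmod (G x - T n x)" "cmod (T n x - f x)"] by (simp add: power2_sum)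
      finally show ?thesis using True by simp
    qed simp
  qed (use i1 i2 in simp)
  also have "\<dots> = 2 * (\<integral>x. (cmod (G x - T n x))\<^sup>2 \<partial>lebesgue) + 2 * (LINT x:S|lebesgue. (cmod (T n x - f x))\<^sup>2)"
    unfolding set_lebesgue_integral_def using i1 i2 by (subst Bochner_Integration.integral_add) auto
  also have "\<dots> < \<epsilon>" using n f(6) by simp
  finally show ?thesis using f(1-5) unfolding S_def by blast
qed


section \<open>Integrals that enter the inner product\<close>

lemma LINT_mult_cnj_cong_right:
  assumes "L2_on S f" "L2_on S g" "L2_on S h" and eq: "AE x in lebesgue. x \<in> S \<longrightarrow> g x = h x"
  shows "(LINT x:S|lebesgue. f x * cnj (g x)) = (LINT x:S|lebesgue. f x * cnj (h x))"
  unfolding set_lebesgue_integral_def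
proof (rule integral_cong_AE)
  show "(\<lambda>x. indicat_real S x *\<^sub>R (f x * cnj (g x))) \<in> borel_measurable lebesgue"
    "(\<lambda>x. indicat_real S x *\<^sub>R (f x * cnj (h x))) \<in> borel_measurable lebesgue"
    using L2_on_integrable_mult_cnj[OF assms(1,2)] L2_on_integrable_mult_cnj[OF assms(1,3)]
    by (auto simp: set_integrable_def)
  show "AE x in lebesgue. indicat_real S x *\<^sub>R (f x * cnj (g x)) = indicat_real S x *\<^sub>R (f x * cnj (h x))"
    using eq by eventually_elim (auto simp: indicator_def)
qed

text \<open>Contribution of one half to the proof that the adjoint is no larger: \<open>p\<close>
  stands for \<open>A F\<close>, \<open>k\<close> for the candidate value of the adjoint at
  \<open>g\<close>, and \<open>k'\<close> for \<open>A G'\<close>. The difference of the two adjoint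
  identities is a squared norm.\<close>

lemma LINT_mult_cnj_combine:
  assumes L2: "L2_on S p" "L2_on S g" "L2_on S f" "L2_on S k" "L2_on S g'" "L2_on S k'"
    and eq: "AE x in lebesgue. x \<in> S \<longrightarrow>
      p x * cnj (g x) - f x * cnj (k x) - (p x * cnj (g' x) - f x * cnj (k' x)) = of_real ((cmod (g x - g' x))\<^sup>2)"
  shows "(LINT x:S|lebesgue. p x * cnj (g x)) - (LINT x:S|lebesgue. f x * cnj (k x)) -
      ((LINT x:S|lebesgue. p x * cnj (g' x)) - (LINT x:S|lebesgue. f x * cnj (k' x)))
    = of_real (LINT x:S|lebesgue. (cmod (g x - g' x))\<^sup>2)"
proof -
  note i1 = L2_on_integrable_mult_cnj[OF L2(1,2)] and i2 = L2_on_integrable_mult_cnj[OF L2(3,4)]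
    and i3 = L2_on_integrable_mult_cnj[OF L2(1,5)] and i4 = L2_on_integrable_mult_cnj[OF L2(3,6)]
  note j1 = set_integral_diff[OF i1 i2] and j2 = set_integral_diff[OF i3 i4]
  note j3 = set_integral_diff[OF j1(1) j2(1)]
  have "(LINT x:S|lebesgue. p x * cnj (g x)) - (LINT x:S|lebesgue. f x * cnj (k x)) -
      ((LINT x:S|lebesgue. p x * cnj (g' x)) - (LINT x:S|lebesgue. f x * cnj (k' x)))
    = (LINT x:S|lebesgue. p x * cnj (g x) - f x * cnj (k x) - (p x * cnj (g' x) - f x * cnj (k' x)))"
    unfolding j3(2) j1(2) j2(2) ..
  also have "\<dots> = (LINT x|lebesgue. of_real (indicat_real S x *\<^sub>R (cmod (g x - g' x))\<^sup>2))"
    unfolding set_lebesgue_integral_def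
  proof (rule integral_cong_AE)
    show 1: "(\<lambda>x. indicat_real S x *\<^sub>R (p x * cnj (g x) - f x * cnj (k x) - (p x * cnj (g' x) - f x * cnj (k' x))))
      \<in> borel_measurable lebesgue"
      using j3(1) unfolding set_integrable_def by (rule borel_measurable_integrable)
    show 2: "AE x in lebesgue. indicat_real S x *\<^sub>R (p x * cnj (g x) - f x * cnj (k x) - (p x * cnj (g' x) - f x * cnj (k' x)))
      = of_real (indicat_real S x *\<^sub>R (cmod (g x - g' x))\<^sup>2)"
      using eq by eventually_elim (auto simp: indicator_def)
    show "(\<lambda>x. complex_of_real (indicat_real S x *\<^sub>R (cmod (g x - g' x))\<^sup>2)) \<in> borel_measurable lebesgue"
      by (rule borel_measurable_AE[OF 1 2])
  qed
  also have "\<dots> = of_real (LINT x:S|lebesgue. (cmod (g x - g' x))\<^sup>2)"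
    unfolding set_lebesgue_integral_def by (rule integral_complex_of_real)
  finally show ?thesis .
qed

lemma LINT_mult_cnj_self: "(LINT x:S|lebesgue. f x * cnj (f x)) = of_real (LINT x:S|lebesgue. (cmod (f x))\<^sup>2)"
proof -
  have "(LINT x:S|lebesgue. f x * cnj (f x)) = (LINT x|lebesgue. of_real (indicat_real S x *\<^sub>R (cmod (f x))\<^sup>2))"
    unfolding set_lebesgue_integral_def complex_norm_square[symmetric]
    by (rule Bochner_Integration.integral_cong) (auto simp: scaleR_conv_of_real)
  also have "\<dots> = of_real (LINT x:S|lebesgue. (cmod (f x))\<^sup>2)"
    unfolding set_lebesgue_integral_def by (rule integral_complex_of_real)
  finally show ?thesis .
qed

lemma LINT_norm_nonneg: "0 \<le> (LINT x:S|lebesgue. (cmod (g x - h x))\<^sup>2)"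
  unfolding set_lebesgue_integral_def by (intro Bochner_Integration.integral_nonneg) simp

lemma LINT_norm_eq_0_AE:
  assumes d: "L2_on S (\<lambda>x. g x - h x)" and "(LINT x:S|lebesgue. (cmod (g x - h x))\<^sup>2) = 0"
  shows "AE x in lebesgue. x \<in> S \<longrightarrow> g x = h x"
proof -
  have "AE x in lebesgue. indicat_real S x *\<^sub>R (cmod (g x - h x))\<^sup>2 = 0"
  proof (rule iffD1[OF integral_nonneg_eq_0_iff_AE])
    show "integrable lebesgue (\<lambda>x. indicat_real S x *\<^sub>R (cmod (g x - h x))\<^sup>2)"
      using d by (simp add: L2_on_def set_integrable_def)
    show "(LINT x|lebesgue. indicat_real S x *\<^sub>R (cmod (g x - h x))\<^sup>2) = 0"
      using assms(2) by (simp add: set_lebesgue_integral_def)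
  qed simp
  then show ?thesis by eventually_elim (auto simp: indicator_def)
qed

section \<open>The potential as a bounded multiplier on each half\<close>

lemma continuous_on_extend_left:
  fixes q :: "real \<Rightarrow> real"
  assumes "a < c" "continuous_on {a..<c} q" "(q \<longlongrightarrow> L) (at_left c)"
  shows "continuous_on {a..c} (\<lambda>x. if x < c then q x else L)"
  unfolding continuous_on_def
proof
  fix x assume x: "x \<in> {a..c}"
  show "((\<lambda>x. if x < c then q x else L) \<longlongrightarrow> (if x < c then q x else L)) (at x within {a..c})"
  proof (cases "x < c")
    case True
    have "at x within {a..c} = at x within {a..<c}"
      by (rule at_within_nhd[of x "{..<c}"]) (use True in auto)
    moreover have "(q \<longlongrightarrow> q x) (at x within {a..<c})"
      using assms(2) x True by (auto simp: continuous_on_def)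
    moreover have "\<forall>\<^sub>F y in at x within {a..<c}. (if y < c then q y else L) = q y"
      by (auto simp: eventually_at_filter)
    ultimately show ?thesis using True by (simp add: tendsto_cong)
  next
    case False
    then have "x = c" using x by simp
    moreover have "at c within {a..c} = at_left c"
      using \<open>a < c\<close> by (rule at_within_Icc_at_left)
    moreover have "\<forall>\<^sub>F y in at_left c. (if y < c then q y else L) = q y"
      by (auto simp: eventually_at_filter)
    ultimately show ?thesis using assms(3) by (simp add: tendsto_cong)
  qed
qed

lemma continuous_on_extend_right:
  fixes q :: "real \<Rightarrow> real"
  assumes "c < b" "continuous_on {c<..b} q" "(q \<longlongrightarrow> L) (at_right c)"
  shows "continuous_on {c..b} (\<lambda>x. if c < x then q x else L)"
  unfolding continuous_on_def
proof
  fix x assume x: "x \<in> {c..b}"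
  show "((\<lambda>x. if c < x then q x else L) \<longlongrightarrow> (if c < x then q x else L)) (at x within {c..b})"
  proof (cases "c < x")
    case True
    have "at x within {c..b} = at x within {c<..b}"
      by (rule at_within_nhd[of x "{c<..}"]) (use True in auto)
    moreover have "(q \<longlongrightarrow> q x) (at x within {c<..b})"
      using assms(2) x True by (auto simp: continuous_on_def)
    moreover have "\<forall>\<^sub>F y in at x within {c<..b}. (if c < y then q y else L) = q y"
      by (auto simp: eventually_at_filter)
    ultimately show ?thesis using True by (simp add: tendsto_cong)
  next
    case False
    then have "x = c" using x by simp
    moreover have "at c within {c..b} = at_right c"
      using \<open>c < b\<close> by (rule at_within_Icc_at_right)
    moreover have "\<forall>\<^sub>F y in at_right c. (if c < y then q y else L) = q y"
      by (auto simp: eventually_at_filter)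
    ultimately show ?thesis using assms(3) by (simp add: tendsto_cong)
  qed
qed

lemma L2_on_extension_mult:
  fixes q :: "real \<Rightarrow> real"
  assumes Q: "continuous_on {u..v} Q" "\<And>x. x \<in> {u<..<v} \<Longrightarrow> Q x = q x" and f: "L2_on {u<..<v} f"
  shows "L2_on {u<..<v} (\<lambda>x. complex_of_real (q x) * f x)"
proof -
  have "L2_on {u<..<v} (\<lambda>x. complex_of_real (Q x) * f x)"
    by (intro L2_on_continuous_mult[OF f] continuous_on_of_real Q(1))
  then show ?thesis
    using L2_on_cong[of "{u<..<v}" "\<lambda>x. complex_of_real (q x) * f x" "\<lambda>x. complex_of_real (Q x) * f x"] Q(2) by simp
qed

section \<open>Solutions of \<open>f'' = 0\<close> and linear algebra of boundary data\<close>

lemma sobolev2_affine: "sobolev2 u v (\<lambda>x. k0 + of_real (x - u) * k1) (\<lambda>x. k1) (\<lambda>x. 0)"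
  unfolding sobolev2_def
proof (intro conjI ballI)
  fix x assume "x \<in> {u..v}"
  have "((\<lambda>x. x - u) has_real_derivative 1 - 0) (at x within {u..v})"
    by (intro DERIV_diff DERIV_ident DERIV_const)
  then have "((\<lambda>x. k0 + (x - u) *\<^sub>R k1) has_vector_derivative (0 + ((x - u) *\<^sub>R 0 + (1 - 0) *\<^sub>R k1))) (at x within {u..v})"
    by (intro has_vector_derivative_add has_vector_derivative_const has_vector_derivative_scaleR)
  then show "((\<lambda>x. k0 + of_real (x - u) * k1) has_vector_derivative k1) (at x within {u..v})"
    by (simp add: scaleR_conv_of_real)
next
  show "ac_on {u..v} (\<lambda>x. k1)" by (rule ac_on_Lipschitz[where B=0]) simp
  show "L2_on {u<..<v} (\<lambda>x. 0)" by (rule L2_on_continuous) simp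
  have "((\<lambda>x. k1) has_vector_derivative 0) (at x)" for x by (rule has_vector_derivative_const)
  then show "\<exists>N. negligible N \<and> (\<forall>x\<in>{u<..<v} - N. ((\<lambda>x. k1) has_vector_derivative 0) (at x))"
    using negligible_empty by blast
qed

lemma sobolev2_add_cmult:
  assumes f: "sobolev2 u v f f1 f2" and g: "sobolev2 u v g g1 (\<lambda>x. 0)"
  shows "sobolev2 u v (\<lambda>x. f x + s * g x) (\<lambda>x. f1 x + s * g1 x) f2"
  unfolding sobolev2_def
proof (intro conjI ballI)
  fix x assume "x \<in> {u..v}"
  then show "((\<lambda>x. f x + s * g x) has_vector_derivative f1 x + s * g1 x) (at x within {u..v})"
    using sobolev2D(1)[OF f] sobolev2D(1)[OF g]
    by (intro has_vector_derivative_add has_vector_derivative_mult_right) auto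
next
  show "ac_on {u..v} (\<lambda>x. f1 x + s * g1 x)"
  proof (rule ac_on_dominated[OF sobolev2D(3)[OF f] sobolev2D(3)[OF g], where B="1 + cmod s"])
    fix x y
    have eq: "(f1 y + s * g1 y) - (f1 x + s * g1 x) = (f1 y - f1 x) + s * (g1 y - g1 x)"
      by (simp add: algebra_simps)
    have "norm ((f1 y + s * g1 y) - (f1 x + s * g1 x)) \<le> norm (f1 y - f1 x) + cmod s * norm (g1 y - g1 x)"
      unfolding eq norm_mult[symmetric] by (rule norm_triangle_ineq)
    also have "\<dots> \<le> (1 + cmod s) * (norm (f1 y - f1 x) + norm (g1 y - g1 x))"
      by (simp add: algebra_simps)
    finally show "norm ((f1 y + s * g1 y) - (f1 x + s * g1 x)) \<le> (1 + cmod s) * (norm (f1 y - f1 x) + norm (g1 y - g1 x))" .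
  qed
  show "L2_on {u<..<v} f2" by (rule sobolev2D(4)[OF f])
  have "\<exists>N. negligible N \<and> (\<forall>x\<in>{u<..<v} - N. (f1 has_vector_derivative f2 x) (at x))"
    "\<exists>N. negligible N \<and> (\<forall>x\<in>{u<..<v} - N. (g1 has_vector_derivative 0) (at x))"
    using f g by (simp_all add: sobolev2_def)
  then obtain N M where N: "negligible N" "\<forall>x\<in>{u<..<v} - N. (f1 has_vector_derivative f2 x) (at x)"
    and M: "negligible M" "\<forall>x\<in>{u<..<v} - M. (g1 has_vector_derivative 0) (at x)"
    by (elim exE conjE)
  have "((\<lambda>x. f1 x + s * g1 x) has_vector_derivative f2 x) (at x)" if "x \<in> {u<..<v} - (N \<union> M)" for x
  proof -
    have "((\<lambda>x. f1 x + s * g1 x) has_vector_derivative f2 x + s * 0) (at x)"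
      using N(2) M(2) that by (intro has_vector_derivative_add has_vector_derivative_mult_right) auto
    then show ?thesis by simp
  qed
  then show "\<exists>N. negligible N \<and> (\<forall>x\<in>{u<..<v} - N. ((\<lambda>x. f1 x + s * g1 x) has_vector_derivative f2 x) (at x))"
    using negligible_Un[OF N(1) M(1)] by blast
qed

text \<open>The coefficients are real, so the conjugated pair satisfies the same equation. Both
  pairs then lie in the kernel of one nonzero functional on the plane, which is a line, and their
  determinant vanishes.\<close>

lemma wronskian_eq_0:
  fixes x y X Y :: complex and p q :: real
  assumes "(p, q) \<noteq> (0, 0)" "of_real p * x + of_real q * y = 0" "of_real p * X + of_real q * Y = 0"
  shows "x * cnj Y - y * cnj X = 0"
proof -
  have *: "of_real p * cnj X + of_real q * cnj Y = 0"
    using arg_cong[OF assms(3), of cnj] by simp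
  have "of_real p * (x * cnj Y - y * cnj X) = (of_real p * x + of_real q * y) * cnj Y - y * (of_real p * cnj X + of_real q * cnj Y)"
    "of_real q * (x * cnj Y - y * cnj X) = x * (of_real p * cnj X + of_real q * cnj Y) - cnj X * (of_real p * x + of_real q * y)"
    by (simp_all add: algebra_simps)
  then have "of_real p * (x * cnj Y - y * cnj X) = 0" "of_real q * (x * cnj Y - y * cnj X) = 0"
    unfolding * assms(2) by simp_all
  then show ?thesis using assms(1) by (auto simp only: mult_eq_0_iff of_real_eq_0_iff prod.inject)
qed

lemma det_solve:
  fixes p q r s :: real and e1 e2 :: complex
  assumes "p * s - q * r \<noteq> 0"
  shows "\<exists>z0 z1. of_real p * z0 + of_real q * z1 = e1 \<and> of_real r * z0 + of_real s * z1 = e2"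
proof (intro exI conjI)
  let ?D = "complex_of_real (p * s - q * r)"
  have D: "?D \<noteq> 0" using assms by (simp only: of_real_eq_0_iff not_False_eq_True)
  have "of_real p * ((of_real s * e1 - of_real q * e2) / ?D) + of_real q * ((of_real p * e2 - of_real r * e1) / ?D)
      = (?D * e1) / ?D"
    "of_real r * ((of_real s * e1 - of_real q * e2) / ?D) + of_real s * ((of_real p * e2 - of_real r * e1) / ?D)
      = (?D * e2) / ?D"
    unfolding times_divide_eq_right add_divide_distrib[symmetric]
    by (rule arg_cong[where f="\<lambda>z. z / ?D"], simp add: algebra_simps)+
  then show "of_real p * ((of_real s * e1 - of_real q * e2) / ?D) + of_real q * ((of_real p * e2 - of_real r * e1) / ?D) = e1"
    "of_real r * ((of_real s * e1 - of_real q * e2) / ?D) + of_real s * ((of_real p * e2 - of_real r * e1) / ?D) = e2"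
    by (simp_all only: nonzero_mult_div_cancel_left[OF D])
qed

lemma det_kernel:
  fixes p q r s :: real and z0 z1 :: complex
  assumes "p * s - q * r \<noteq> 0" "of_real p * z0 + of_real q * z1 = 0" "of_real r * z0 + of_real s * z1 = 0"
  shows "z0 = 0" "z1 = 0"
proof -
  let ?D = "complex_of_real (p * s - q * r)"
  have D: "?D \<noteq> 0" using assms(1) by (simp only: of_real_eq_0_iff not_False_eq_True)
  have "?D * z0 = of_real s * (of_real p * z0 + of_real q * z1) - of_real q * (of_real r * z0 + of_real s * z1)"
    "?D * z1 = of_real p * (of_real r * z0 + of_real s * z1) - of_real r * (of_real p * z0 + of_real q * z1)"
    by (simp_all add: algebra_simps)
  then have "?D * z0 = 0" "?D * z1 = 0" unfolding assms(2,3) by simp_all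
  then show "z0 = 0" "z1 = 0" using D by (simp_all only: mult_eq_0_iff simp_thms)
qed

text \<open>The terms with \<open>q\<close> cancel because \<open>q\<close> is real. What remains is
  Green's identity, once \<open>f\<close> and \<open>g\<close> are replaced on the open interval by
  their extensions \<open>l\<close> and \<open>m\<close>.\<close>

lemma LINT_green:
  fixes q :: "real \<Rightarrow> real"
  assumes S: "{u<..<v} \<subseteq> T" and "u \<le> v"
    and F: "sobolev2 u v l l1 f2" "\<And>x. x \<in> T \<Longrightarrow> f x = l x"
    and G: "sobolev2 u v m m1 g2" "\<And>x. x \<in> T \<Longrightarrow> g x = m x"
    and L2: "L2_on {u<..<v} f" "L2_on {u<..<v} g" "L2_on {u<..<v} f2" "L2_on {u<..<v} g2"
      "L2_on {u<..<v} (\<lambda>x. - f2 x + of_real (q x) * f x)" "L2_on {u<..<v} (\<lambda>x. - g2 x + of_real (q x) * g x)"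
  shows "(LINT x:{u<..<v}|lebesgue. (- f2 x + of_real (q x) * f x) * cnj (g x))
      - (LINT x:{u<..<v}|lebesgue. f x * cnj (- g2 x + of_real (q x) * g x))
    = (l v * cnj (m1 v) - l1 v * cnj (m v)) - (l u * cnj (m1 u) - l1 u * cnj (m u))"
proof -
  have Sm: "{u<..<v} \<in> sets lebesgue" by simp
  have "(LINT x:{u<..<v}|lebesgue. (- f2 x + of_real (q x) * f x) * cnj (g x))
      - (LINT x:{u<..<v}|lebesgue. f x * cnj (- g2 x + of_real (q x) * g x))
    = (LINT x:{u<..<v}|lebesgue. (- f2 x + of_real (q x) * f x) * cnj (g x) - f x * cnj (- g2 x + of_real (q x) * g x))"
    by (rule set_integral_diff(2)[OF L2_on_integrable_mult_cnj[OF L2(5,2)] L2_on_integrable_mult_cnj[OF L2(1,6)], symmetric])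
  also have "\<dots> = (LINT x:{u<..<v}|lebesgue. f x * cnj (g2 x) - f2 x * cnj (g x))"
    by (rule arg_cong[where f="set_lebesgue_integral lebesgue {u<..<v}"]) (simp add: fun_eq_iff algebra_simps)
  also have "\<dots> = (LINT x:{u<..<v}|lebesgue. f x * cnj (g2 x)) - (LINT x:{u<..<v}|lebesgue. f2 x * cnj (g x))"
    by (rule set_integral_diff(2)[OF L2_on_integrable_mult_cnj[OF L2(1,4)] L2_on_integrable_mult_cnj[OF L2(3,2)]])
  also have "(LINT x:{u<..<v}|lebesgue. f x * cnj (g2 x)) = (LINT x:{u<..<v}|lebesgue. l x * cnj (g2 x))"
    by (rule set_lebesgue_integral_cong[OF Sm]) (use S F(2) in auto)
  also have "(LINT x:{u<..<v}|lebesgue. f2 x * cnj (g x)) = (LINT x:{u<..<v}|lebesgue. f2 x * cnj (m x))"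
    by (rule set_lebesgue_integral_cong[OF Sm]) (use S G(2) in auto)
  finally show ?thesis
    by (simp only: sobolev2_green[OF \<open>u \<le> v\<close> F(1) G(1)])
qed

section \<open>The transmission problem\<close>


locale transmission_problem =
  fixes a b c :: real and q :: "real \<Rightarrow> real"
    and al10 al11 al20 al21 al20' al21' :: real
    and b10m b11m b10p b11p b20m b21m b20p b21p :: real
  assumes ac: "a < c" and cb: "c < b"
    and q_left: "continuous_on {a..<c} q" and q_right: "continuous_on {c<..b} q"
    and q_at_left: "\<exists>L. (q \<longlongrightarrow> L) (at_left c)" and q_at_right: "\<exists>L. (q \<longlongrightarrow> L) (at_right c)"
    and al1: "(al10, al11) \<noteq> (0, 0)"
    and det_minus: "b10m * b21m - b11m * b20m > 0"
    and det_plus: "b10p * b21p - b11p * b20p > 0"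
    and det_b: "al21 * al20' - al20 * al21' > 0"
begin

abbreviation "D12 \<equiv> b10m * b21m - b11m * b20m"
abbreviation "D34 \<equiv> b10p * b21p - b11p * b20p"
abbreviation "D0 \<equiv> al21 * al20' - al20 * al21'"
abbreviation "inH \<equiv> inH1 a c b"
abbreviation "inDom \<equiv> domA a c b q al10 al11 al20' al21' b10m b11m b10p b11p b20m b21m b20p b21p"
abbreviation "opr \<equiv> opA a c b q al20 al21"
abbreviation "ip \<equiv> ipH1 a c b D12 D34 D0"
abbreviation "DD f \<equiv> D1 a c b (D1 a c b f)"

lemma q_mult_L2:
  "L2_on {a<..<c} f \<Longrightarrow> L2_on {a<..<c} (\<lambda>x. complex_of_real (q x) * f x)"
  "L2_on {c<..<b} f \<Longrightarrow> L2_on {c<..<b} (\<lambda>x. complex_of_real (q x) * f x)"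
proof -
  obtain L where "(q \<longlongrightarrow> L) (at_left c)" using q_at_left by blast
  from continuous_on_extend_left[OF ac q_left this]
  show "L2_on {a<..<c} f \<Longrightarrow> L2_on {a<..<c} (\<lambda>x. complex_of_real (q x) * f x)"
    by (rule L2_on_extension_mult) auto
  obtain R where "(q \<longlongrightarrow> R) (at_right c)" using q_at_right by blast
  from continuous_on_extend_right[OF cb q_right this]
  show "L2_on {c<..<b} f \<Longrightarrow> L2_on {c<..<b} (\<lambda>x. complex_of_real (q x) * f x)"
    by (rule L2_on_extension_mult) auto
qed

lemma fst_opr: "fst (opr F) = (\<lambda>x. - DD (fst F) x + of_real (q x) * fst F x)"
  by (simp add: opA_def Lop_def fun_eq_iff)

text \<open>The domain asks for \<open>-f'' + q f\<close> in \<open>L2\<close>, not for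
  \<open>f''\<close>. Since multiplication by \<open>q\<close> preserves \<open>L2\<close>, the
  second derivative is recovered as a difference.\<close>

lemma dom_L2:
  assumes "inDom F"
  shows "L2_on {a<..<c} (fst F)" "L2_on {c<..<b} (fst F)"
    "L2_on {a<..<c} (fst (opr F))" "L2_on {c<..<b} (fst (opr F))"
    "L2_on {a<..<c} (DD (fst F))" "L2_on {c<..<b} (DD (fst F))"
proof -
  show *: "L2_on {a<..<c} (fst F)" "L2_on {c<..<b} (fst F)"
    "L2_on {a<..<c} (fst (opr F))" "L2_on {c<..<b} (fst (opr F))"
    using assms by (simp_all add: domA_def inH1_def opA_def)
  have "DD (fst F) = (\<lambda>x. complex_of_real (q x) * fst F x - fst (opr F) x)"
    unfolding fst_opr by (simp add: fun_eq_iff)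
  then show "L2_on {a<..<c} (DD (fst F))" "L2_on {c<..<b} (DD (fst F))"
    using L2_on_diff[OF q_mult_L2(1)[OF *(1)] *(3)] L2_on_diff[OF q_mult_L2(2)[OF *(2)] *(4)] by simp_all
qed

lemma dom_inH: "inDom F \<Longrightarrow> inH F" "inDom F \<Longrightarrow> inH (opr F)"
  using dom_L2 unfolding inH1_def by blast+

text \<open>The arguments are value and derivative at \<open>a\<close>, at \<open>c-\<close> and at
  \<open>c+\<close>. The data at \<open>b\<close> stay free; they enter through the second component
  alone.\<close>

definition boundary_conditions :: "complex \<Rightarrow> complex \<Rightarrow> complex \<Rightarrow> complex \<Rightarrow> complex \<Rightarrow> complex \<Rightarrow> bool" where
  "boundary_conditions ya ya1 ym ym1 yp yp1 \<longleftrightarrow> of_real al10 * ya + of_real al11 * ya1 = 0 \<and>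
     of_real b11m * ym1 + of_real b10m * ym + of_real b11p * yp1 + of_real b10p * yp = 0 \<and>
     of_real b21m * ym1 + of_real b20m * ym + of_real b21p * yp1 + of_real b20p * yp = 0"

lemma dom_glues:
  assumes "inDom F"
  shows "\<exists>l l1 r r1. glues a c b (fst F) l l1 (DD (fst F)) r r1 (DD (fst F)) \<and>
    boundary_conditions (l a) (l1 a) (l c) (l1 c) (r c) (r1 c)"
proof -
  have "pw_regular a c b (fst F)" using assms by (simp add: domA_def)
  from glues_exists[OF ac cb this dom_L2(5,6)[OF assms]]
  obtain l l1 r r1 where g: "glues a c b (fst F) l l1 (DD (fst F)) r r1 (DD (fst F))" by blast
  have "boundary_conditions (l a) (l1 a) (l c) (l1 c) (r c) (r1 c)"
    using assms unfolding domA_def boundary_conditions_def glues_boundary[OF ac cb g] by blast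
  with g show ?thesis by blast
qed

text \<open>Membership in the domain is thereby reduced to the six boundary numbers; the second
  component is forced by \<open>f\<close>.\<close>

lemma glues_dom:
  assumes g: "glues a c b f l l1 l2 r r1 r2"
    and bc: "boundary_conditions (l a) (l1 a) (l c) (l1 c) (r c) (r1 c)"
  shows "inDom (f, Tb a c b al20' al21' f)"
proof -
  have left: "L2_on {a<..<c} (Lop a c b q f)"
  proof (rule L2_on_cong_AE)
    show "L2_on {a<..<c} (\<lambda>x. complex_of_real (q x) * f x - l2 x)"
      by (intro L2_on_diff q_mult_L2 glues_L2[OF ac cb g] sobolev2D(4)[OF glues_sobolev2(1)[OF ac cb g]])
    show "AE x in lebesgue. x \<in> {a<..<c} \<longrightarrow> complex_of_real (q x) * f x - l2 x = Lop a c b q f x"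
      using glues_D1_D1(1)[OF ac cb g] by eventually_elim (simp add: Lop_def)
  qed
  have right: "L2_on {c<..<b} (Lop a c b q f)"
  proof (rule L2_on_cong_AE)
    show "L2_on {c<..<b} (\<lambda>x. complex_of_real (q x) * f x - r2 x)"
      by (intro L2_on_diff q_mult_L2 glues_L2[OF ac cb g] sobolev2D(4)[OF glues_sobolev2(2)[OF ac cb g]])
    show "AE x in lebesgue. x \<in> {c<..<b} \<longrightarrow> complex_of_real (q x) * f x - r2 x = Lop a c b q f x"
      using glues_D1_D1(2)[OF ac cb g] by eventually_elim (simp add: Lop_def)
  qed
  show ?thesis
    using left right glues_L2[OF ac cb g] glues_pw_regular[OF ac cb g] bc
    unfolding domA_def inH1_def boundary_conditions_def glues_boundary[OF ac cb g] fst_conv snd_conv by blast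
qed

text \<open>A Wronskian is the determinant of two vectors of boundary data. The minus columns of
  \<open>T\<close> multiply it by \<open>\<Delta>\<^sub>1\<^sub>2\<close>, the plus columns by
  \<open>\<Delta>\<^sub>3\<^sub>4\<close>. By the transmission conditions the two images of a vector
  differ only in sign, and the signs cancel in the determinant.\<close>

lemma wronskian_transmission:
  assumes "boundary_conditions ya ya1 ym ym1 yp yp1" "boundary_conditions za za1 zm zm1 zp zp1"
  shows "of_real D12 * (ym * cnj zm1 - ym1 * cnj zm) = of_real D34 * (yp * cnj zp1 - yp1 * cnj zp)"
proof -
  have neg: "x = - y" if "x + y = 0" for x y :: complex using that by (simp add: add_eq_0_iff2)
  have y: "of_real b10m * ym + of_real b11m * ym1 = - (of_real b10p * yp + of_real b11p * yp1)"
     "of_real b20m * ym + of_real b21m * ym1 = - (of_real b20p * yp + of_real b21p * yp1)"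
    by (rule neg, use assms(1) in \<open>simp add: boundary_conditions_def algebra_simps\<close>)+
  have z: "of_real b10m * zm + of_real b11m * zm1 = - (of_real b10p * zp + of_real b11p * zp1)"
     "of_real b20m * zm + of_real b21m * zm1 = - (of_real b20p * zp + of_real b21p * zp1)"
    by (rule neg, use assms(2) in \<open>simp add: boundary_conditions_def algebra_simps\<close>)+
  have z': "of_real b10m * cnj zm + of_real b11m * cnj zm1 = - (of_real b10p * cnj zp + of_real b11p * cnj zp1)"
     "of_real b20m * cnj zm + of_real b21m * cnj zm1 = - (of_real b20p * cnj zp + of_real b21p * cnj zp1)"
    using arg_cong[OF z(1), of cnj] arg_cong[OF z(2), of cnj] by simp_all
  have "of_real D12 * (ym * cnj zm1 - ym1 * cnj zm)
     = (of_real b10m * ym + of_real b11m * ym1) * (of_real b20m * cnj zm + of_real b21m * cnj zm1)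
     - (of_real b20m * ym + of_real b21m * ym1) * (of_real b10m * cnj zm + of_real b11m * cnj zm1)"
    by (simp add: algebra_simps)
  also have "\<dots> = of_real D34 * (yp * cnj zp1 - yp1 * cnj zp)"
    unfolding y z' by (simp add: algebra_simps)
  finally show ?thesis .
qed

lemma symmetric:
  assumes F: "inDom F" and G: "inDom G"
  shows "ip (opr F) G = ip F (opr G)"
proof -
  obtain l l1 r r1 where f: "glues a c b (fst F) l l1 (DD (fst F)) r r1 (DD (fst F))"
    and bf: "boundary_conditions (l a) (l1 a) (l c) (l1 c) (r c) (r1 c)"
    using dom_glues[OF F] by (elim exE conjE)
  obtain m m1 n n1 where g: "glues a c b (fst G) m m1 (DD (fst G)) n n1 (DD (fst G))"
    and bg: "boundary_conditions (m a) (m1 a) (m c) (m1 c) (n c) (n1 c)"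
    using dom_glues[OF G] by (elim exE conjE)
  note L2F = dom_L2[OF F, unfolded fst_opr] and L2G = dom_L2[OF G, unfolded fst_opr]
  have left: "(LINT x:{a<..<c}|lebesgue. fst (opr F) x * cnj (fst G x)) - (LINT x:{a<..<c}|lebesgue. fst F x * cnj (fst (opr G) x))
    = (l c * cnj (m1 c) - l1 c * cnj (m c)) - (l a * cnj (m1 a) - l1 a * cnj (m a))"
    unfolding fst_opr
    by (rule LINT_green[OF left_half(1)[OF ac cb] less_imp_le[OF ac] glues_sobolev2(1)[OF ac cb f] glues_eq(1)[OF ac cb f]
        glues_sobolev2(1)[OF ac cb g] glues_eq(1)[OF ac cb g] L2F(1) L2G(1) L2F(5) L2G(5) L2F(3) L2G(3)])
  have right: "(LINT x:{c<..<b}|lebesgue. fst (opr F) x * cnj (fst G x)) - (LINT x:{c<..<b}|lebesgue. fst F x * cnj (fst (opr G) x))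
    = (r b * cnj (n1 b) - r1 b * cnj (n b)) - (r c * cnj (n1 c) - r1 c * cnj (n c))"
    unfolding fst_opr
    by (rule LINT_green[OF right_half(1)[OF ac cb] less_imp_le[OF cb] glues_sobolev2(2)[OF ac cb f] glues_eq(2)[OF ac cb f]
        glues_sobolev2(2)[OF ac cb g] glues_eq(2)[OF ac cb g] L2F(2) L2G(2) L2F(6) L2G(6) L2F(4) L2G(4)])
  have at_a: "l a * cnj (m1 a) - l1 a * cnj (m a) = 0"
    by (rule wronskian_eq_0[OF al1]) (use bf bg in \<open>simp_all add: boundary_conditions_def\<close>)
  note Tf = glues_boundary(3)[OF ac cb f] and Tg = glues_boundary(3)[OF ac cb g]
  have snd: "snd F = of_real al20' * r b - of_real al21' * r1 b" "snd G = of_real al20' * n b - of_real al21' * n1 b"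
    "snd (opr F) = - (of_real al20 * r b - of_real al21 * r1 b)" "snd (opr G) = - (of_real al20 * n b - of_real al21 * n1 b)"
    using F G by (simp_all add: domA_def opA_def Tf Tg)
  \<comment> \<open>The same determinant rule for the two functionals at \<open>b\<close>: they
    multiply the Wronskian there by \<open>- \<Delta>\<^sub>0\<close>, which the weight of the
    second component turns into \<open>- \<Delta>\<^sub>3\<^sub>4\<close>.\<close>
  have at_b: "snd (opr F) * cnj (snd G) - snd F * cnj (snd (opr G)) = - of_real D0 * (r b * cnj (n1 b) - r1 b * cnj (n b))"
    unfolding snd by (simp add: algebra_simps)
  have D: "complex_of_real (D34 / D0) * (- of_real D0 * w) = - of_real D34 * w" for w
  proof -
    have "complex_of_real (D34 / D0) * of_real D0 = of_real (D34 / D0 * D0)" by (rule of_real_mult[symmetric])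
    also have "D34 / D0 * D0 = D34" using det_b by (intro nonzero_eq_divide_eq[THEN iffD1]) auto
    finally show ?thesis by (metis mult.assoc mult_minus_left mult_minus_right)
  qed
  have diff: "(A1 * I1 + A2 * I2 + A3 * s * t) - (A1 * J1 + A2 * J2 + A3 * s' * t')
    = A1 * (I1 - J1) + A2 * (I2 - J2) + A3 * (s * t - s' * t')" for A1 A2 A3 I1 I2 J1 J2 s s' t t' :: complex
    by (simp add: algebra_simps)
  have collect: "A * (x - 0) + B * (y - z) + (- B * y) = A * x - B * z" for A B x y z :: complex
    by (simp add: algebra_simps)
  have "ip (opr F) G - ip F (opr G)
    = of_real D12 * (l c * cnj (m1 c) - l1 c * cnj (m c) - 0)
      + of_real D34 * ((r b * cnj (n1 b) - r1 b * cnj (n b)) - (r c * cnj (n1 c) - r1 c * cnj (n c)))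
      + (- of_real D34 * (r b * cnj (n1 b) - r1 b * cnj (n b)))"
    unfolding ipH1_def diff left right at_a at_b D ..
  also have "\<dots> = of_real D12 * (l c * cnj (m1 c) - l1 c * cnj (m c)) - of_real D34 * (r c * cnj (n1 c) - r1 c * cnj (n c))"
    by (rule collect)
  also have "\<dots> = 0"
    unfolding wronskian_transmission[OF bf bg] by (rule diff_self)
  finally show ?thesis by simp
qed

section \<open>Solvability of the model problem\<close>

lemma ex_glue:
  assumes "sobolev2 a c l l1 l2" "sobolev2 c b r r1 r2"
  shows "\<exists>f. glues a c b f l l1 l2 r r1 r2"
proof
  show "glues a c b (\<lambda>x. if x < c then l x else r x) l l1 l2 r r1 r2"
    using assms by (simp add: glues_def)
qed

text \<open>Data at \<open>c-\<close> can always be continued across \<open>c\<close>, since the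
  plus columns of \<open>T\<close> have determinant
  \<open>\<Delta>\<^sub>3\<^sub>4 \<noteq> 0\<close>.\<close>

lemma ex_transmission:
  "\<exists>yp yp1. of_real b11m * ym1 + of_real b10m * ym + of_real b11p * yp1 + of_real b10p * yp = (0::complex) \<and>
    of_real b21m * ym1 + of_real b20m * ym + of_real b21p * yp1 + of_real b20p * yp = (0::complex)"
proof -
  have "b10p * b21p - b11p * b20p \<noteq> 0" using det_plus by simp
  from det_solve[OF this, of "- (of_real b11m * ym1 + of_real b10m * ym)" "- (of_real b21m * ym1 + of_real b20m * ym)"]
  obtain z0 z1 where z: "of_real b10p * z0 + of_real b11p * z1 = - (of_real b11m * ym1 + of_real b10m * ym)"
    "of_real b20p * z0 + of_real b21p * z1 = - (of_real b21m * ym1 + of_real b20m * ym)"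
    by (elim exE conjE)
  have "of_real b11m * ym1 + of_real b10m * ym + of_real b11p * z1 + of_real b10p * z0
      = (of_real b11m * ym1 + of_real b10m * ym) + (of_real b10p * z0 + of_real b11p * z1)"
    "of_real b21m * ym1 + of_real b20m * ym + of_real b21p * z1 + of_real b20p * z0
      = (of_real b21m * ym1 + of_real b20m * ym) + (of_real b20p * z0 + of_real b21p * z1)"
    by (simp_all add: algebra_simps)
  then have "of_real b11m * ym1 + of_real b10m * ym + of_real b11p * z1 + of_real b10p * z0 = 0"
    "of_real b21m * ym1 + of_real b20m * ym + of_real b21p * z1 + of_real b20p * z0 = 0"
    unfolding z by simp_all
  then show ?thesis by blast
qed

text \<open>Adding \<open>\<epsilon>\<close> times the projection onto the second component is a bounded symmetric perturbation;
  \<open>\<epsilon>\<close> is chosen so that the perturbed operator with \<open>q = 0\<close> has trivial kernel.\<close>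

lemma surjective:
  "\<exists>\<epsilon>::real. \<forall>H. inH H \<longrightarrow> (\<exists>F. inDom F \<and>
      (AE x in lebesgue. x \<in> {a<..<c} \<longrightarrow> DD (fst F) x = - fst H x) \<and>
      (AE x in lebesgue. x \<in> {c<..<b} \<longrightarrow> DD (fst F) x = - fst H x) \<and>
      - Tb a c b al20 al21 (fst F) + of_real \<epsilon> * snd F = snd H)"
proof -
  \<comment> \<open>Value and derivative at \<open>a\<close> of the homogeneous solution: a nonzero
    vector killed by the functional with coefficients \<open>al10\<close>, \<open>al11\<close>. The
    affine \<open>pl\<close> is continued across \<open>c\<close> by \<open>pr\<close>.\<close>
  define p0 p1 where "p0 = complex_of_real al11" and "p1 = - complex_of_real al10"
  define pl where "pl x = p0 + of_real (x - a) * p1" for x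
  obtain z0 z1 where z: "of_real b11m * p1 + of_real b10m * pl c + of_real b11p * z1 + of_real b10p * z0 = 0"
    "of_real b21m * p1 + of_real b20m * pl c + of_real b21p * z1 + of_real b20p * z0 = 0"
    using ex_transmission[of p1 "pl c"] by (elim exE conjE)
  define pr where "pr x = z0 + of_real (x - c) * z1" for x
  have pl: "sobolev2 a c pl (\<lambda>x. p1) (\<lambda>x. 0)" unfolding pl_def by (rule sobolev2_affine)
  have pr: "sobolev2 c b pr (\<lambda>x. z1) (\<lambda>x. 0)" unfolding pr_def by (rule sobolev2_affine)
  define B where "B s t = complex_of_real s * pr b - of_real t * z1" for s t
  \<comment> \<open>If both functionals at \<open>b\<close> vanished, the homogeneous solution could
    be traced back as zero: data at \<open>b\<close> vanish by
    \<open>\<Delta>\<^sub>0 \<noteq> 0\<close>, so does \<open>pr\<close>, then the data at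
    \<open>c-\<close> by \<open>\<Delta>\<^sub>1\<^sub>2 \<noteq> 0\<close>, and finally those at
    \<open>a\<close>.\<close>
  have nontrivial: "B al20 al21 \<noteq> 0 \<or> B al20' al21' \<noteq> 0"
  proof (rule ccontr)
    assume "\<not> ?thesis"
    then have B0: "of_real al20 * pr b + of_real (- al21) * z1 = 0" "of_real al20' * pr b + of_real (- al21') * z1 = 0"
      by (simp_all add: B_def)
    have "al20 * (- al21') - (- al21) * al20' \<noteq> 0" using det_b by simp
    from det_kernel[OF this B0] have z0: "z1 = 0" "z0 = 0" by (simp_all add: pr_def)
    have pc: "of_real b10m * pl c + of_real b11m * p1 = 0" "of_real b20m * pl c + of_real b21m * p1 = 0"
      using z unfolding z0 by (simp_all add: add.commute)
    have "b10m * b21m - b11m * b20m \<noteq> 0" using det_minus by simp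
    from det_kernel[OF this pc] have "pl c = 0" "p1 = 0" .
    then show False using al1 by (simp add: pl_def p0_def p1_def)
  qed
  \<comment> \<open>If \<open>B al20 al21\<close> vanishes, the other functional does not, and the
    value 1 lets it contribute alone to \<open>\<kappa>\<close>.\<close>
  define \<epsilon> :: real where "\<epsilon> = (if B al20 al21 \<noteq> 0 then 0 else 1)"
  define \<kappa> where "\<kappa> = - B al20 al21 + of_real \<epsilon> * B al20' al21'"
  have "\<kappa> \<noteq> 0" using nontrivial by (auto simp: \<kappa>_def \<epsilon>_def)
  have "\<exists>F. inDom F \<and>
      (AE x in lebesgue. x \<in> {a<..<c} \<longrightarrow> DD (fst F) x = - fst H x) \<and>
      (AE x in lebesgue. x \<in> {c<..<b} \<longrightarrow> DD (fst F) x = - fst H x) \<and>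
      - Tb a c b al20 al21 (fst F) + of_real \<epsilon> * snd F = snd H" if H: "inH H" for H
  proof -
    have L2: "L2_on {a<..<c} (\<lambda>x. - fst H x)" "L2_on {c<..<b} (\<lambda>x. - fst H x)"
      using H by (simp_all add: inH1_def L2_on_uminus)
    \<comment> \<open>A particular solution with zero data at \<open>a\<close>, which meets the
      condition there trivially; \<open>w0\<close> and \<open>w1\<close> continue it across
      \<open>c\<close>.\<close>
    obtain k k1 where k: "sobolev2 a c k k1 (\<lambda>x. - fst H x)" "k a = 0" "k1 a = 0"
      using sobolev2_of_L2[OF L2(1) less_imp_le[OF ac], of 0 0] by blast
    obtain w0 w1 where w: "of_real b11m * k1 c + of_real b10m * k c + of_real b11p * w1 + of_real b10p * w0 = 0"
      "of_real b21m * k1 c + of_real b20m * k c + of_real b21p * w1 + of_real b20p * w0 = 0"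
      using ex_transmission[of "k1 c" "k c"] by (elim exE conjE)
    obtain j j1 where j: "sobolev2 c b j j1 (\<lambda>x. - fst H x)" "j c = w0" "j1 c = w1"
      using sobolev2_of_L2[OF L2(2) less_imp_le[OF cb], of w0 w1] by blast
    define J where "J s t = complex_of_real s * j b - of_real t * j1 b" for s t
    \<comment> \<open>The multiple of the homogeneous solution that makes the second component equal
      to \<open>snd H\<close>: the particular solution contributes the \<open>J\<close> terms, and
      each unit of \<open>s\<close> contributes \<open>\<kappa>\<close>.\<close>
    define s where "s = (snd H - (- J al20 al21 + of_real \<epsilon> * J al20' al21')) / \<kappa>"
    obtain f where f: "glues a c b f (\<lambda>x. k x + s * pl x) (\<lambda>x. k1 x + s * p1) (\<lambda>x. - fst H x)
        (\<lambda>x. j x + s * pr x) (\<lambda>x. j1 x + s * z1) (\<lambda>x. - fst H x)"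
      using ex_glue[OF sobolev2_add_cmult[OF k(1) pl, of s] sobolev2_add_cmult[OF j(1) pr, of s]] by (elim exE)
    have prc: "pr c = z0" by (simp add: pr_def)
    have "boundary_conditions (k a + s * pl a) (k1 a + s * p1) (k c + s * pl c) (k1 c + s * p1) (j c + s * pr c) (j1 c + s * z1)"
      unfolding boundary_conditions_def
    proof (intro conjI)
      show "of_real al10 * (k a + s * pl a) + of_real al11 * (k1 a + s * p1) = 0"
        by (simp add: k pl_def p0_def p1_def)
      have "of_real b11m * (k1 c + s * p1) + of_real b10m * (k c + s * pl c) + of_real b11p * (j1 c + s * z1) + of_real b10p * (j c + s * pr c)
        = (of_real b11m * k1 c + of_real b10m * k c + of_real b11p * w1 + of_real b10p * w0)
          + s * (of_real b11m * p1 + of_real b10m * pl c + of_real b11p * z1 + of_real b10p * z0)"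
        unfolding j prc by (simp add: algebra_simps)
      then show "of_real b11m * (k1 c + s * p1) + of_real b10m * (k c + s * pl c) + of_real b11p * (j1 c + s * z1) + of_real b10p * (j c + s * pr c) = 0"
        unfolding w z by simp
      have "of_real b21m * (k1 c + s * p1) + of_real b20m * (k c + s * pl c) + of_real b21p * (j1 c + s * z1) + of_real b20p * (j c + s * pr c)
        = (of_real b21m * k1 c + of_real b20m * k c + of_real b21p * w1 + of_real b20p * w0)
          + s * (of_real b21m * p1 + of_real b20m * pl c + of_real b21p * z1 + of_real b20p * z0)"
        unfolding j prc by (simp add: algebra_simps)
      then show "of_real b21m * (k1 c + s * p1) + of_real b20m * (k c + s * pl c) + of_real b21p * (j1 c + s * z1) + of_real b20p * (j c + s * pr c) = 0"
        unfolding w z by simp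
    qed
    from glues_dom[OF f this] have domf: "inDom (f, Tb a c b al20' al21' f)" .
    have T: "Tb a c b x y f = J x y + s * B x y" for x y
      unfolding glues_boundary(3)[OF ac cb f] J_def B_def by (simp add: algebra_simps)
    have "- Tb a c b al20 al21 f + of_real \<epsilon> * Tb a c b al20' al21' f = (- J al20 al21 + of_real \<epsilon> * J al20' al21') + s * \<kappa>"
      unfolding T \<kappa>_def by (simp add: algebra_simps)
    also have "\<dots> = snd H"
      using \<open>\<kappa> \<noteq> 0\<close> by (simp add: s_def)
    finally show ?thesis
      using glues_D1_D1[OF ac cb f] domf by (intro exI[of _ "(f, Tb a c b al20' al21' f)"]) (simp only: fst_conv snd_conv simp_thms)
  qed
  then show ?thesis by (intro exI[of _ \<epsilon>] allI impI)
qed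

section \<open>Determination of the adjoint\<close>

lemma eqH1_D:
  assumes "eqH1 a b F G"
  shows "AE x in lebesgue. x \<in> {a<..<c} \<longrightarrow> fst F x = fst G x"
    "AE x in lebesgue. x \<in> {c<..<b} \<longrightarrow> fst F x = fst G x" "snd F = snd G"
proof -
  have "AE x in lebesgue. x \<in> {a<..<b} \<longrightarrow> fst F x = fst G x" and s: "snd F = snd G"
    using assms by (simp_all add: eqH1_def)
  then show "AE x in lebesgue. x \<in> {a<..<c} \<longrightarrow> fst F x = fst G x"
    "AE x in lebesgue. x \<in> {c<..<b} \<longrightarrow> fst F x = fst G x"
    by (eventually_elim, use ac cb in simp)+
  show "snd F = snd G" by (rule s)
qed

lemma eqH1_I:
  assumes "AE x in lebesgue. x \<in> {a<..<c} \<longrightarrow> fst F x = fst G x"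
    "AE x in lebesgue. x \<in> {c<..<b} \<longrightarrow> fst F x = fst G x" "snd F = snd G"
  shows "eqH1 a b F G"
proof -
  have "{c} \<in> null_sets lebesgue"
    using negligible_sing by (simp only: negligible_iff_null_sets)
  then have "AE x in lebesgue. x \<notin> {c}" by (rule AE_not_in)
  with assms(1,2) have "AE x in lebesgue. x \<in> {a<..<b} \<longrightarrow> fst F x = fst G x"
    by eventually_elim auto
  then show ?thesis using assms(3) by (simp add: eqH1_def)
qed

lemma ip_cong_right:
  assumes "inH F" "inH G" "inH K" "eqH1 a b G K"
  shows "ip F G = ip F K"
proof -
  have "(LINT x:{a<..<c}|lebesgue. fst F x * cnj (fst G x)) = (LINT x:{a<..<c}|lebesgue. fst F x * cnj (fst K x))"
    using assms(1-3) by (intro LINT_mult_cnj_cong_right eqH1_D(1)[OF assms(4)]) (simp_all add: inH1_def)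
  moreover have "(LINT x:{c<..<b}|lebesgue. fst F x * cnj (fst G x)) = (LINT x:{c<..<b}|lebesgue. fst F x * cnj (fst K x))"
    using assms(1-3) by (intro LINT_mult_cnj_cong_right eqH1_D(2)[OF assms(4)]) (simp_all add: inH1_def)
  ultimately show ?thesis unfolding ipH1_def eqH1_D(3)[OF assms(4)] by (simp only:)
qed

lemma adjoint_extends:
  assumes "inH G" "inH K" "inDom G'" "eqH1 a b G' G" "eqH1 a b (opr G') K" "inDom F"
  shows "ip (opr F) G = ip F K"
proof -
  have "ip (opr F) G = ip (opr F) G'"
    by (rule ip_cong_right[OF dom_inH(2)[OF assms(6)] dom_inH(1)[OF assms(3)] assms(1,4), symmetric])
  also have "\<dots> = ip F (opr G')" using assms by (intro symmetric)
  also have "\<dots> = ip F K"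
    by (rule ip_cong_right[OF dom_inH(1)[OF assms(6)] dom_inH(2)[OF assms(3)] assms(2,5)])
  finally show ?thesis .
qed

lemma adjoint_subset:
  assumes G: "inH G" and K: "inH K" and adj: "\<forall>F. inDom F \<longrightarrow> ip (opr F) G = ip F K"
  shows "\<exists>G'. inDom G' \<and> eqH1 a b G' G \<and> eqH1 a b (opr G') K"
proof -
  obtain \<epsilon> :: real where surj: "\<forall>H. inH H \<longrightarrow> (\<exists>F. inDom F \<and>
      (AE x in lebesgue. x \<in> {a<..<c} \<longrightarrow> DD (fst F) x = - fst H x) \<and>
      (AE x in lebesgue. x \<in> {c<..<b} \<longrightarrow> DD (fst F) x = - fst H x) \<and>
      - Tb a c b al20 al21 (fst F) + of_real \<epsilon> * snd F = snd H)"
    using surjective by (elim exE)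
  have L2: "L2_on {a<..<c} (fst G)" "L2_on {c<..<b} (fst G)" "L2_on {a<..<c} (fst K)" "L2_on {c<..<b} (fst K)"
    using G K by (simp_all add: inH1_def)
  \<comment> \<open>This is \<open>B\<^sup>* G\<close>: the perturbation that leads from
    \<open>A\<close> to \<open>B\<close> is applied to \<open>G\<close> and added to
    \<open>K\<close>. Here \<open>q\<close> multiplies \<open>G\<close> and not yet
    \<open>G'\<close>, and the two are shown to agree only at the end.\<close>
  have "inH (\<lambda>x. fst K x - of_real (q x) * fst G x, snd K + of_real \<epsilon> * snd G)"
    using L2 by (simp add: inH1_def L2_on_diff q_mult_L2)
  from surj[rule_format, OF this, unfolded fst_conv snd_conv] obtain G' where G': "inDom G'"
    and G'l: "AE x in lebesgue. x \<in> {a<..<c} \<longrightarrow> DD (fst G') x = - (fst K x - of_real (q x) * fst G x)"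
    and G'r: "AE x in lebesgue. x \<in> {c<..<b} \<longrightarrow> DD (fst G') x = - (fst K x - of_real (q x) * fst G x)"
    and G's: "- Tb a c b al20 al21 (fst G') + of_real \<epsilon> * snd G' = snd K + of_real \<epsilon> * snd G"
    by (elim exE conjE)
  note L2' = dom_L2[OF G']
  have "inH (\<lambda>x. fst G x - fst G' x, snd G - snd G')"
    using L2 L2' by (simp add: inH1_def L2_on_diff)
  from surj[rule_format, OF this, unfolded fst_conv snd_conv] obtain F where F: "inDom F"
    and Fl: "AE x in lebesgue. x \<in> {a<..<c} \<longrightarrow> DD (fst F) x = - (fst G x - fst G' x)"
    and Fr: "AE x in lebesgue. x \<in> {c<..<b} \<longrightarrow> DD (fst F) x = - (fst G x - fst G' x)"
    and Fs: "- Tb a c b al20 al21 (fst F) + of_real \<epsilon> * snd F = snd G - snd G'"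
    by (elim exE conjE)
  note L2F = dom_L2[OF F]
  \<comment> \<open>With \<open>p = q x\<close>, the equation for \<open>F\<close> turns
    \<open>A F\<close> into \<open>(g - g') + p f\<close>, and the equation for \<open>G'\<close>
    turns \<open>A G'\<close> into \<open>(k - p g) + p g'\<close>. As \<open>p\<close> is real, all
    terms with \<open>p\<close> and \<open>k\<close> cancel. The second component follows the same
    pattern with \<open>p = - \<epsilon>\<close>.\<close>
  have point: "((g - g') + of_real p * f) * cnj g - f * cnj k - (((g - g') + of_real p * f) * cnj g' - f * cnj ((k - of_real p * g) + of_real p * g'))
      = of_real ((cmod (g - g'))\<^sup>2)" for g g' f k :: complex and p :: real
    unfolding complex_norm_square by (simp add: algebra_simps)
  have pointwise: "fst (opr F) x * cnj (fst G x) - fst F x * cnj (fst K x)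
       - (fst (opr F) x * cnj (fst G' x) - fst F x * cnj (fst (opr G') x)) = of_real ((cmod (fst G x - fst G' x))\<^sup>2)"
    if "DD (fst F) x = - (fst G x - fst G' x)" "DD (fst G') x = - (fst K x - of_real (q x) * fst G x)" for x
    unfolding fst_opr that minus_minus by (rule point)
  define N1 N2 N3 where "N1 = (LINT x:{a<..<c}|lebesgue. (cmod (fst G x - fst G' x))\<^sup>2)"
    and "N2 = (LINT x:{c<..<b}|lebesgue. (cmod (fst G x - fst G' x))\<^sup>2)"
    and "N3 = (cmod (snd G - snd G'))\<^sup>2"
  have 1: "(LINT x:{a<..<c}|lebesgue. fst (opr F) x * cnj (fst G x)) - (LINT x:{a<..<c}|lebesgue. fst F x * cnj (fst K x))
      - ((LINT x:{a<..<c}|lebesgue. fst (opr F) x * cnj (fst G' x)) - (LINT x:{a<..<c}|lebesgue. fst F x * cnj (fst (opr G') x)))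
      = of_real N1"
    unfolding N1_def
  proof (rule LINT_mult_cnj_combine[OF L2F(3) L2(1) L2F(1) L2(3) L2'(1) L2'(3)])
    show "AE x in lebesgue. x \<in> {a<..<c} \<longrightarrow> fst (opr F) x * cnj (fst G x) - fst F x * cnj (fst K x)
       - (fst (opr F) x * cnj (fst G' x) - fst F x * cnj (fst (opr G') x)) = of_real ((cmod (fst G x - fst G' x))\<^sup>2)"
      using Fl G'l by eventually_elim (intro impI pointwise; blast)
  qed
  have 2: "(LINT x:{c<..<b}|lebesgue. fst (opr F) x * cnj (fst G x)) - (LINT x:{c<..<b}|lebesgue. fst F x * cnj (fst K x))
      - ((LINT x:{c<..<b}|lebesgue. fst (opr F) x * cnj (fst G' x)) - (LINT x:{c<..<b}|lebesgue. fst F x * cnj (fst (opr G') x)))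
      = of_real N2"
    unfolding N2_def
  proof (rule LINT_mult_cnj_combine[OF L2F(4) L2(2) L2F(2) L2(4) L2'(2) L2'(4)])
    show "AE x in lebesgue. x \<in> {c<..<b} \<longrightarrow> fst (opr F) x * cnj (fst G x) - fst F x * cnj (fst K x)
       - (fst (opr F) x * cnj (fst G' x) - fst F x * cnj (fst (opr G') x)) = of_real ((cmod (fst G x - fst G' x))\<^sup>2)"
      using Fr G'r by eventually_elim (intro impI pointwise; blast)
  qed
  have 3: "snd (opr F) * cnj (snd G) - snd F * cnj (snd K) - (snd (opr F) * cnj (snd G') - snd F * cnj (snd (opr G'))) = of_real N3"
  proof -
    have solve: "x = z + of_real (- \<epsilon>) * y" if "x + of_real \<epsilon> * y = z" for x y z :: complex
      unfolding that[symmetric] by simp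
    have "snd (opr F) = (snd G - snd G') + of_real (- \<epsilon>) * snd F"
      unfolding opA_def snd_conv by (rule solve[OF Fs])
    moreover have "snd (opr G') = (snd K - of_real (- \<epsilon>) * snd G) + of_real (- \<epsilon>) * snd G'"
      using solve[OF G's] unfolding opA_def snd_conv by simp
    ultimately show ?thesis unfolding N3_def by (simp only: point)
  qed
  have combine: "((A1 * I1 + A2 * I2 + A3 * s1 * t1) - (A1 * J1 + A2 * J2 + A3 * s2 * t2))
      - ((A1 * K1 + A2 * K2 + A3 * s3 * t3) - (A1 * M1 + A2 * M2 + A3 * s4 * t4))
    = A1 * (I1 - J1 - (K1 - M1)) + A2 * (I2 - J2 - (K2 - M2)) + A3 * (s1 * t1 - s2 * t2 - (s3 * t3 - s4 * t4))"
    for A1 A2 A3 I1 I2 J1 J2 K1 K2 M1 M2 s1 s2 s3 s4 t1 t2 t3 t4 :: complex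
    by (simp add: algebra_simps)
  have "(ip (opr F) G - ip F K) - (ip (opr F) G' - ip F (opr G'))
      = of_real D12 * of_real N1 + of_real D34 * of_real N2 + of_real (D34 / D0) * of_real N3"
    unfolding ipH1_def combine 1 2 3 ..
  moreover have "ip (opr F) G = ip F K" "ip (opr F) G' = ip F (opr G')"
    using adj F symmetric[OF F G'] by blast+
  ultimately have "of_real D12 * of_real N1 + of_real D34 * of_real N2 + of_real (D34 / D0) * of_real N3 = (0::complex)"
    by simp
  then have "complex_of_real (D12 * N1 + D34 * N2 + D34 / D0 * N3) = 0"
    by (simp only: of_real_add of_real_mult)
  then have sum0: "D12 * N1 + D34 * N2 + D34 / D0 * N3 = 0"
    by (simp only: of_real_eq_0_iff)
  have weights: "0 < D12" "0 < D34" "0 < D34 / D0" using det_minus det_plus det_b by simp_all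
  have N: "0 \<le> N1" "0 \<le> N2" "0 \<le> N3"
    unfolding N1_def N2_def N3_def using LINT_norm_nonneg by simp_all
  have "0 \<le> D12 * N1" "0 \<le> D34 * N2" "0 \<le> D34 / D0 * N3"
    using weights N by (simp_all only: mult_nonneg_nonneg less_imp_le)
  then have "D12 * N1 = 0" "D34 * N2 = 0" "D34 / D0 * N3 = 0" using sum0 by linarith+
  then have N0: "N1 = 0" "N2 = 0" "N3 = 0" using weights by (simp_all only: mult_eq_0_iff) auto
  have l: "AE x in lebesgue. x \<in> {a<..<c} \<longrightarrow> fst G x = fst G' x"
    by (rule LINT_norm_eq_0_AE[OF L2_on_diff[OF L2(1) L2'(1)]]) (use N0(1) N1_def in simp)
  have r: "AE x in lebesgue. x \<in> {c<..<b} \<longrightarrow> fst G x = fst G' x"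
    by (rule LINT_norm_eq_0_AE[OF L2_on_diff[OF L2(2) L2'(2)]]) (use N0(2) N2_def in simp)
  have s: "snd G = snd G'" using N0(3) by (simp add: N3_def)
  have "eqH1 a b G' G"
  proof (rule eqH1_I)
    show "AE x in lebesgue. x \<in> {a<..<c} \<longrightarrow> fst G' x = fst G x" using l by eventually_elim simp
    show "AE x in lebesgue. x \<in> {c<..<b} \<longrightarrow> fst G' x = fst G x" using r by eventually_elim simp
  qed (rule s[symmetric])
  moreover have "eqH1 a b (opr G') K"
  proof (rule eqH1_I)
    show "AE x in lebesgue. x \<in> {a<..<c} \<longrightarrow> fst (opr G') x = fst K x"
      using l G'l by eventually_elim (simp add: fst_opr)
    show "AE x in lebesgue. x \<in> {c<..<b} \<longrightarrow> fst (opr G') x = fst K x"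
      using r G'r by eventually_elim (simp add: fst_opr)
    show "snd (opr G') = snd K" using G's s by (simp add: opA_def)
  qed
  ultimately show ?thesis using G' by blast
qed

text \<open>The second component of a domain element is tied to its data at \<open>b\<close>. Since
  these data can be prescribed while approximating in \<open>L2\<close>, the second component is
  matched exactly and only the two integrals contribute an error. Zero data at \<open>a\<close> and
  on both sides of \<open>c\<close> satisfy the remaining conditions.\<close>

lemma dense:
  assumes G: "inH G" and "0 < \<epsilon>"
  shows "\<exists>F. inDom F \<and> Re (ip (subH1 F G) (subH1 F G)) < \<epsilon>"
proof -
  have L2: "L2_on {a<..<c} (fst G)" "L2_on {c<..<b} (fst G)" using G by (simp_all add: inH1_def)
  \<comment> \<open>The equation with value \<open>snd G\<close> is completed to a square system by
    requiring the other functional at \<open>b\<close> to vanish; the determinant is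
    \<open>\<Delta>\<^sub>0\<close>.\<close>
  have "al20' * al21 - (- al21') * (- al20) \<noteq> 0" using det_b by (simp add: mult.commute)
  from det_solve[OF this, of "snd G" 0] obtain y0 y1 where "of_real al20' * y0 + of_real (- al21') * y1 = snd G"
    by (elim exE conjE)
  then have y: "of_real al20' * y0 - of_real al21' * y1 = snd G" by simp
  \<comment> \<open>Weighted by \<open>\<Delta>\<^sub>1\<^sub>2\<close> and
    \<open>\<Delta>\<^sub>3\<^sub>4\<close>, the two errors together stay below
    \<open>\<epsilon> / 2\<close>.\<close>
  define d where "d = \<epsilon> / (2 * (D12 + D34))"
  have D: "0 < D12 + D34" using det_minus det_plus by simp
  have "0 < d" using \<open>0 < \<epsilon>\<close> D unfolding d_def by (intro divide_pos_pos mult_pos_pos) simp_all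
  obtain l l1 l2 where l: "sobolev2 a c l l1 l2" "l a = 0" "l1 a = 0" "l c = 0" "l1 c = 0"
    "(LINT x:{a<..<c}|lebesgue. (cmod (fst G x - l x))\<^sup>2) < d"
    using L2_dense_sobolev2[OF ac L2(1) \<open>0 < d\<close>, of 0 0] by (elim exE conjE)
  obtain r r1 r2 where r: "sobolev2 c b r r1 r2" "r c = 0" "r1 c = 0" "r b = y0" "r1 b = y1"
    "(LINT x:{c<..<b}|lebesgue. (cmod (fst G x - r x))\<^sup>2) < d"
    using L2_dense_sobolev2[OF cb L2(2) \<open>0 < d\<close>, of y0 y1] by (elim exE conjE)
  obtain f where f: "glues a c b f l l1 l2 r r1 r2"
    using ex_glue[OF l(1) r(1)] by (elim exE)
  have "boundary_conditions (l a) (l1 a) (l c) (l1 c) (r c) (r1 c)"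
    by (simp add: boundary_conditions_def l r)
  from glues_dom[OF f this] have domf: "inDom (f, Tb a c b al20' al21' f)" .
  have T: "Tb a c b al20' al21' f = snd G"
    unfolding glues_boundary(3)[OF ac cb f] r y ..
  have eql: "(LINT x:{a<..<c}|lebesgue. (cmod (f x - fst G x))\<^sup>2) = (LINT x:{a<..<c}|lebesgue. (cmod (fst G x - l x))\<^sup>2)"
    by (rule set_lebesgue_integral_cong) (use glues_eq(1)[OF ac cb f] in \<open>simp_all add: norm_minus_commute\<close>)
  have eqr: "(LINT x:{c<..<b}|lebesgue. (cmod (f x - fst G x))\<^sup>2) = (LINT x:{c<..<b}|lebesgue. (cmod (fst G x - r x))\<^sup>2)"
    by (rule set_lebesgue_integral_cong) (use glues_eq(2)[OF ac cb f] in \<open>simp_all add: norm_minus_commute\<close>)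
  have "Re (ip (subH1 (f, snd G) G) (subH1 (f, snd G) G))
    = D12 * (LINT x:{a<..<c}|lebesgue. (cmod (f x - fst G x))\<^sup>2) + D34 * (LINT x:{c<..<b}|lebesgue. (cmod (f x - fst G x))\<^sup>2)"
    unfolding ipH1_def subH1_def fst_conv snd_conv LINT_mult_cnj_self of_real_mult[symmetric] by simp
  also have "\<dots> < D12 * d + D34 * d"
    unfolding eql eqr using l(6) r(6) det_minus det_plus by (intro add_strict_mono mult_strict_left_mono)
  also have "\<dots> = (D12 + D34) * d" by (rule distrib_right[symmetric])
  also have "\<dots> = \<epsilon> / 2"
    using D unfolding d_def by (simp add: divide_simps)
  also have "\<dots> < \<epsilon>" using \<open>0 < \<epsilon>\<close> by simp
  finally show ?thesis using domf unfolding T by blast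
qed

lemma self_adjoint: "self_adjoint_op inH (eqH1 a b) ip subH1 inDom opr"
  unfolding self_adjoint_op_def
proof (intro conjI allI impI)
  fix F assume "inDom F" then show "inH F" "inH (opr F)" by (rule dom_inH)+
next
  fix G \<epsilon> assume "inH G" "(0::real) < \<epsilon>"
  then show "\<exists>F. inDom F \<and> Re (ip (subH1 F G) (subH1 F G)) < \<epsilon>" by (rule dense)
next
  fix G K assume *: "inH G \<and> inH K"
  show "(\<forall>F. inDom F \<longrightarrow> ip (opr F) G = ip F K) \<longleftrightarrow> (\<exists>G'. inDom G' \<and> eqH1 a b G' G \<and> eqH1 a b (opr G') K)"
  proof
    assume "\<forall>F. inDom F \<longrightarrow> ip (opr F) G = ip F K"
    with * show "\<exists>G'. inDom G' \<and> eqH1 a b G' G \<and> eqH1 a b (opr G') K"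
      by (intro adjoint_subset) simp_all
  next
    assume "\<exists>G'. inDom G' \<and> eqH1 a b G' G \<and> eqH1 a b (opr G') K"
    with * show "\<forall>F. inDom F \<longrightarrow> ip (opr F) G = ip F K"
      using adjoint_extends by blast
  qed
qed

end

theorem theorem2:
  fixes a b c :: real and q :: "real \<Rightarrow> real"
    and al10 al11 al20 al21 al20' al21' :: real
    and b10m b11m b10p b11p b20m b21m b20p b21p :: real
  assumes "a < c" and "c < b"
    and "continuous_on {a..<c} q" and "continuous_on {c<..b} q"
    and "\<exists>L. (q \<longlongrightarrow> L) (at_left c)" and "\<exists>L. (q \<longlongrightarrow> L) (at_right c)"
    and "(al10, al11) \<noteq> (0, 0)"
    and "b10m * b21m - b11m * b20m > 0"
    and "b10p * b21p - b11p * b20p > 0"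
    and "al21 * al20' - al20 * al21' > 0"
  shows "self_adjoint_op (inH1 a c b) (eqH1 a b)
           (ipH1 a c b (b10m * b21m - b11m * b20m) (b10p * b21p - b11p * b20p)
                 (al21 * al20' - al20 * al21'))
           subH1
           (domA a c b q al10 al11 al20' al21' b10m b11m b10p b11p b20m b21m b20p b21p)
           (opA a c b q al20 al21)"
proof -
  interpret transmission_problem a b c q al10 al11 al20 al21 al20' al21' b10m b11m b10p b11p b20m b21m b20p b21p
    using assms by unfold_locales
  show ?thesis by (rule self_adjoint)
qed

end
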